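(* Let $\{b_i\}_{i\in I}$ be a basis of $B$ for some index set $I$. The following are equivalent: (a) Conditions (C1)–(C4) below hold, and, if $d\geq 3$, Conditions (C5)–(C9) below hold additionally; (b) $\{ (b_{\lambda_1} \otimes \dots\otimes b_{\lambda_d}) H_w ~|~ \lambda_j \in I, w\in \Sigma_d\}$ forms a basis of $B \wr \mathcal{H}(d)$; (c) $\{H_w (b_{\lambda_1} \otimes \dots\otimes b_{\lambda_d}) ~|~ \lambda_j \in I, w\in \Sigma_d\}$ forms a basis of $B \wr \mathcal{H}(d)$. The conditions are (for $a,b\in B\otimes B$ in (C2)): (C1) $\sigma(1\otimes 1) = 1\otimes 1$, $\rho(1 \otimes1)=0$; (C2) $\sigma(ab) = \sigma(a)\sigma(b)$, $\rho(ab) = \sigma(a)\rho(b) + \rho(a)b$; (C3) $\sigma(S)S + \rho(S) + \sigma(R) = S^2+R$, $\rho(R) + \sigma(S)R = SR$; (C4) $r_S\sigma^2+\rho\sigma+\sigma\rho = l_{S}\sigma$, $r_R\sigma^2+\rho^2 = l_S\rho + l_R$ (as $K$-endomorphisms of $B\otimes B$); and, working in $B^{\otimes 3}$ with $\{i,j\}=\{1,2\}$: (C5) $\sigma_i\sigma_j\sigma_i = \sigma_j \sigma_i \sigma_j$, $\rho_i\sigma_j\sigma_i = \sigma_j \sigma_i \rho_j$; (C6) $\rho_i\sigma_j\rho_i = r_{S_j} \sigma_j \rho_i \sigma_j + \rho_j \rho_i \sigma_j + \sigma_j \rho_i \rho_j$; (C7) $\rho_i\rho_j\rho_i + r_{R_i}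 \sigma_i \rho_j \sigma_i = \rho_j\rho_i\rho_j + r_{R_j} \sigma_j \rho_i \sigma_j$; (C8) $S_i = \sigma_j\sigma_i(S_j)$, $R_i = \sigma_j\sigma_i(R_j)$, $\rho_j\sigma_i(S_j) = 0 = \rho_j\sigma_i(R_j)$; (C9) $\sigma_j\rho_i(S_j) S_j +\rho_j\rho_i(S_j) + \sigma_j\rho_i(R_j) = 0 = \rho_j\rho_i(R_j) + \sigma_j\rho_i(S_j) R_j$.
   Context: Let $K$ be a commutative ring, $B$ an associative $K$-algebra (free over $K$), and $d\geq 2$ an integer; tensor products are over $K$. Let $Q=(R,S,\rho,\sigma)$ with $R,S\in B\otimes B$ and $\rho,\sigma\in \operatorname{End}_K(B\otimes B)$, $\sigma$ an automorphism. For $Z\in B\otimes B$ and $1\leq i\leq d-1$, $Z_i\in B^{\otimes d}$ denotes $Z$ placed in tensor positions $i,i+1$ with $1$ elsewhere; for $\phi\in\operatorname{End}_K(B\otimes B)$, $\phi_i$ denotes $\phi$ acting on tensor factors $i,i+1$ of $B^{\otimes d}$ and identity elsewhere. The quantum wreath product $B\wr\mathcal{H}(d)=B\wr_Q\mathcal{H}(d)$ is the associative $K$-algebra generated by the algebra $B^{\otimes d}$ and elements $H_1,\dots,H_{d-1}$ subject to: the braid relations $H_kH_{k+1}H_k=H_{k+1}H_kH_{k+1}$ ($1\le k\le d-2$) and $H_iH_j=H_jH_i$ ($|i-j|\ge2$); the quadratic relations $H_i^2=S_iH_i+R_i$; and the wreath relations $H_ib=\sigma_i(b)H_i+\rho_i(b)$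 for $b\in B^{\otimes d}$. For $w\in\Sigma_d$ with reduced expression $w=s_{i_1}\cdots s_{i_N}$, $H_w:=H_{i_1}\cdots H_{i_N}$ (well defined by the braid relations). For $X\in B\otimes B$ (resp. $X\in B^{\otimes 3}$), $l_X$ and $r_X$ denote the $K$-endomorphisms given by left and right multiplication by $X$ in $B\otimes B$ (resp. $B^{\otimes 3}$); juxtaposition of endomorphisms denotes composition. *)

theory Defs
  imports Main "HOL-Library.Function_Algebras" "HOL-Combinatorics.Permutations"
          "HOL-Combinatorics.Transposition"
begin

text \<open>An element of a free K-module with basis indexed by 'a is a finitely supported
  coefficient function 'a => 'k.  Elements of the tensor power B^(n) are coefficient
  functions on lists of basis indices of length n (basis element b_l1 (x) ... (x) b_ln
  is delta [l1,...,ln]).  The algebra B is given by structure constants m and unit u: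
  b_i b_j = sum_k m i j k b_k, 1_B = sum_k u k b_k.\<close>

definition supp :: "('a \<Rightarrow> 'k::zero) \<Rightarrow> 'a set" where
  "supp x = {a. x a \<noteq> 0}"

definition delta :: "'a \<Rightarrow> 'a \<Rightarrow> 'k::{zero,one}" where
  "delta a = (\<lambda>b. if b = a then 1 else 0)"

definition scal :: "'k::times \<Rightarrow> ('a \<Rightarrow> 'k) \<Rightarrow> ('a \<Rightarrow> 'k)" where
  "scal c x = (\<lambda>a. c * x a)"

definition bmul :: "('i \<Rightarrow> 'i \<Rightarrow> 'i \<Rightarrow> 'k::comm_ring_1) \<Rightarrow> ('i \<Rightarrow> 'k) \<Rightarrow> ('i \<Rightarrow> 'k) \<Rightarrow> ('i \<Rightarrow> 'k)" where
  "bmul m x y = (\<lambda>k. \<Sum>i\<in>supp x. \<Sum>j\<in>supp y. x i * y j * m i j k)"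

definition basis_algebra :: "('i \<Rightarrow> 'i \<Rightarrow> 'i \<Rightarrow> 'k::comm_ring_1) \<Rightarrow> ('i \<Rightarrow> 'k) \<Rightarrow> bool" where
  "basis_algebra m u \<longleftrightarrow>
     (\<forall>i j. finite {k. m i j k \<noteq> 0}) \<and> finite (supp u) \<and>
     (\<forall>i j k. bmul m (bmul m (delta i) (delta j)) (delta k)
              = bmul m (delta i) (bmul m (delta j) (delta k))) \<and>
     (\<forall>i. bmul m u (delta i) = delta i \<and> bmul m (delta i) u = delta i)"

definition Tn :: "nat \<Rightarrow> ('i list \<Rightarrow> 'k::zero) set" where
  "Tn n = {x. finite (supp x) \<and> (\<forall>l. x l \<noteq> 0 \<longrightarrow> length l = n)}"

definition tmul :: "('i \<Rightarrow> 'i \<Rightarrow> 'i \<Rightarrow> 'k::comm_ring_1) \<Rightarrow> nat \<Rightarrow>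
    ('i list \<Rightarrow> 'k) \<Rightarrow> ('i list \<Rightarrow> 'k) \<Rightarrow> ('i list \<Rightarrow> 'k)" where
  "tmul m n x y = (\<lambda>v. if length v = n then
      (\<Sum>l\<in>supp x. \<Sum>l'\<in>supp y. x l * y l' *
          (if length l = n \<and> length l' = n then (\<Prod>t<n. m (l!t) (l'!t) (v!t)) else 0))
      else 0)"

definition tone :: "('i \<Rightarrow> 'k::comm_ring_1) \<Rightarrow> nat \<Rightarrow> ('i list \<Rightarrow> 'k)" where
  "tone u n = (\<lambda>v. if length v = n then (\<Prod>t<n. u (v!t)) else 0)"

text \<open>Z_i: Z in B(x)B placed in tensor positions i, i+1 (1-based) of B^(n), 1 elsewhere.\<close>
definition tplace :: "('i \<Rightarrow> 'k::comm_ring_1) \<Rightarrow> nat \<Rightarrow> nat \<Rightarrow> ('i list \<Rightarrow> 'k) \<Rightarrow> ('i list \<Rightarrow> 'k)" where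
  "tplace u n i Z = (\<lambda>v. if length v = n then
      Z [v!(i-1), v!i] * (\<Prod>t\<in>{..<n} - {i-1, i}. u (v!t)) else 0)"

text \<open>phi_i: the K-endomorphism phi of B(x)B acting on tensor positions i, i+1 (1-based)
  of B^(n) and as identity elsewhere (defined on basis elements, extended linearly).\<close>
definition tens_ext :: "nat \<Rightarrow> nat \<Rightarrow> (('i list \<Rightarrow> 'k) \<Rightarrow> ('i list \<Rightarrow> 'k)) \<Rightarrow>
    ('i list \<Rightarrow> 'k::comm_ring_1) \<Rightarrow> ('i list \<Rightarrow> 'k)" where
  "tens_ext n i phi x = (\<lambda>v. if length v = n then
      (\<Sum>l\<in>supp x. x l *
         (if length l = n \<and> (\<forall>t<n. t \<noteq> i-1 \<and> t \<noteq> i \<longrightarrow> l!t = v!t)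
          then phi (delta [l!(i-1), l!i]) [v!(i-1), v!i] else 0))
      else 0)"

definition klin :: "nat \<Rightarrow> (('i list \<Rightarrow> 'k) \<Rightarrow> ('i list \<Rightarrow> 'k::comm_ring_1)) \<Rightarrow> bool" where
  "klin n phi \<longleftrightarrow> (\<forall>x\<in>Tn n. phi x \<in> Tn n) \<and>
     (\<forall>x\<in>Tn n. \<forall>y\<in>Tn n. phi (x + y) = phi x + phi y) \<and>
     (\<forall>c. \<forall>x\<in>Tn n. phi (scal c x) = scal c (phi x))"

definition cond_C1_C4 :: "('i \<Rightarrow> 'i \<Rightarrow> 'i \<Rightarrow> 'k::comm_ring_1) \<Rightarrow> ('i \<Rightarrow> 'k) \<Rightarrow>
    ('i list \<Rightarrow> 'k) \<Rightarrow> ('i list \<Rightarrow> 'k) \<Rightarrow>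
    (('i list \<Rightarrow> 'k) \<Rightarrow> ('i list \<Rightarrow> 'k)) \<Rightarrow> (('i list \<Rightarrow> 'k) \<Rightarrow> ('i list \<Rightarrow> 'k)) \<Rightarrow> bool" where
  "cond_C1_C4 m u R S rho sigma \<longleftrightarrow>
     \<comment> \<open>(C1)\<close>
     (sigma (tone u 2) = tone u 2 \<and> rho (tone u 2) = 0) \<and>
     \<comment> \<open>(C2)\<close>
     (\<forall>a\<in>Tn 2. \<forall>b\<in>Tn 2.
        sigma (tmul m 2 a b) = tmul m 2 (sigma a) (sigma b) \<and>
        rho (tmul m 2 a b) = tmul m 2 (sigma a) (rho b) + tmul m 2 (rho a) b) \<and>
     \<comment> \<open>(C3)\<close>
     (tmul m 2 (sigma S) S + rho S + sigma R = tmul m 2 S S + R \<and>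
      rho R + tmul m 2 (sigma S) R = tmul m 2 S R) \<and>
     \<comment> \<open>(C4)\<close>
     (\<forall>x\<in>Tn 2.
        tmul m 2 (sigma (sigma x)) S + rho (sigma x) + sigma (rho x) = tmul m 2 S (sigma x) \<and>
        tmul m 2 (sigma (sigma x)) R + rho (rho x) = tmul m 2 S (rho x) + tmul m 2 R x)"

definition cond_C5_C9 :: "('i \<Rightarrow> 'i \<Rightarrow> 'i \<Rightarrow> 'k::comm_ring_1) \<Rightarrow> ('i \<Rightarrow> 'k) \<Rightarrow>
    ('i list \<Rightarrow> 'k) \<Rightarrow> ('i list \<Rightarrow> 'k) \<Rightarrow>
    (('i list \<Rightarrow> 'k) \<Rightarrow> ('i list \<Rightarrow> 'k)) \<Rightarrow> (('i list \<Rightarrow> 'k) \<Rightarrow> ('i list \<Rightarrow> 'k)) \<Rightarrow> bool" where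
  "cond_C5_C9 m u R S rho sigma \<longleftrightarrow>
     (\<forall>(i, j)\<in>{(1::nat, 2::nat), (2, 1)}.
       let si = tens_ext 3 i sigma; sj = tens_ext 3 j sigma;
           ri = tens_ext 3 i rho; rj = tens_ext 3 j rho;
           Si = tplace u 3 i S; Sj = tplace u 3 j S;
           Ri = tplace u 3 i R; Rj = tplace u 3 j R;
           mul = tmul m 3 in
       \<comment> \<open>(C5)\<close>
       (\<forall>x\<in>Tn 3. si (sj (si x)) = sj (si (sj x)) \<and> ri (sj (si x)) = sj (si (rj x))) \<and>
       \<comment> \<open>(C6)\<close>
       (\<forall>x\<in>Tn 3. ri (sj (ri x)) = mul (sj (ri (sj x))) Sj + rj (ri (sj x)) + sj (ri (rj x))) \<and>
       \<comment> \<open>(C7)\<close>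
       (\<forall>x\<in>Tn 3. ri (rj (ri x)) + mul (si (rj (si x))) Ri
                 = rj (ri (rj x)) + mul (sj (ri (sj x))) Rj) \<and>
       \<comment> \<open>(C8)\<close>
       (Si = sj (si Sj) \<and> Ri = sj (si Rj) \<and> rj (si Sj) = 0 \<and> rj (si Rj) = 0) \<and>
       \<comment> \<open>(C9)\<close>
       (mul (sj (ri Sj)) Sj + rj (ri Sj) + sj (ri Rj) = 0 \<and>
        rj (ri Rj) + mul (sj (ri Sj)) Rj = 0))"

text \<open>Generators: GB l stands for the element b_l1 (x) ... (x) b_ld of B^(d) (a K-basis
  of B^(d)); GH i stands for H_i.\<close>
datatype 'i gen = GB "'i list" | GH nat

definition validg :: "nat \<Rightarrow> 'i gen \<Rightarrow> bool" where
  "validg d g = (case g of GB l \<Rightarrow> length l = d | GH i \<Rightarrow> 1 \<le> i \<and> i \<le> d - 1)"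

text \<open>The free K-algebra on the valid generators: finitely supported coefficient
  functions on words.\<close>
definition FA :: "nat \<Rightarrow> ('i gen list \<Rightarrow> 'k::zero) set" where
  "FA d = {p. finite (supp p) \<and> (\<forall>w. p w \<noteq> 0 \<longrightarrow> (\<forall>g\<in>set w. validg d g))}"

definition wd :: "'g list \<Rightarrow> ('g list \<Rightarrow> 'k::{zero,one})" where
  "wd w = delta w"

definition fmul :: "('g list \<Rightarrow> 'k::comm_ring_1) \<Rightarrow> ('g list \<Rightarrow> 'k) \<Rightarrow> ('g list \<Rightarrow> 'k)" where
  "fmul p q = (\<lambda>w. \<Sum>k\<le>length w. p (take k w) * q (drop k w))"

definition emb :: "('i list \<Rightarrow> 'k::zero) \<Rightarrow> ('i gen list \<Rightarrow> 'k)" where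
  "emb x = (\<lambda>w. case w of [GB l] \<Rightarrow> x l | _ \<Rightarrow> 0)"

definition Hg :: "nat \<Rightarrow> ('i gen list \<Rightarrow> 'k::{zero,one})" where
  "Hg i = wd [GH i]"

definition wrels :: "('i \<Rightarrow> 'i \<Rightarrow> 'i \<Rightarrow> 'k::comm_ring_1) \<Rightarrow> ('i \<Rightarrow> 'k) \<Rightarrow> nat \<Rightarrow>
    ('i list \<Rightarrow> 'k) \<Rightarrow> ('i list \<Rightarrow> 'k) \<Rightarrow>
    (('i list \<Rightarrow> 'k) \<Rightarrow> ('i list \<Rightarrow> 'k)) \<Rightarrow> (('i list \<Rightarrow> 'k) \<Rightarrow> ('i list \<Rightarrow> 'k)) \<Rightarrow>
    ('i gen list \<Rightarrow> 'k) set" where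
  "wrels m u d R S rho sigma =
     \<comment> \<open>B^(d) is a subalgebra: unit and multiplication\<close>
     {emb (tone u d) - wd []} \<union>
     {fmul (emb x) (emb y) - emb (tmul m d x y) | x y. x \<in> Tn d \<and> y \<in> Tn d} \<union>
     \<comment> \<open>braid relations\<close>
     {fmul (Hg k) (fmul (Hg (k+1)) (Hg k)) - fmul (Hg (k+1)) (fmul (Hg k) (Hg (k+1))) | k.
        1 \<le> k \<and> k \<le> d - 2} \<union>
     {fmul (Hg i) (Hg j) - fmul (Hg j) (Hg i) | i j.
        1 \<le> i \<and> i \<le> d - 1 \<and> 1 \<le> j \<and> j \<le> d - 1 \<and> (i + 2 \<le> j \<or> j + 2 \<le> i)} \<union>
     \<comment> \<open>quadratic relations\<close>
     {fmul (Hg i) (Hg i) - fmul (emb (tplace u d i S)) (Hg i) - emb (tplace u d i R) | i.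
        1 \<le> i \<and> i \<le> d - 1} \<union>
     \<comment> \<open>wreath relations\<close>
     {fmul (Hg i) (emb b) - fmul (emb (tens_ext d i sigma b)) (Hg i) - emb (tens_ext d i rho b) | i b.
        1 \<le> i \<and> i \<le> d - 1 \<and> b \<in> Tn d}"

inductive_set wideal :: "nat \<Rightarrow> ('i gen list \<Rightarrow> 'k::comm_ring_1) set \<Rightarrow> ('i gen list \<Rightarrow> 'k) set"
  for d :: nat and rels :: "('i gen list \<Rightarrow> 'k) set" where
  zero: "0 \<in> wideal d rels"
| gen: "r \<in> rels \<Longrightarrow> r \<in> wideal d rels"
| add: "p \<in> wideal d rels \<Longrightarrow> q \<in> wideal d rels \<Longrightarrow> p + q \<in> wideal d rels"
| scal: "p \<in> wideal d rels \<Longrightarrow> scal c p \<in> wideal d rels"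
| lmul: "p \<in> wideal d rels \<Longrightarrow> \<forall>g\<in>set w. validg d g \<Longrightarrow> fmul (wd w) p \<in> wideal d rels"
| rmul: "p \<in> wideal d rels \<Longrightarrow> \<forall>g\<in>set w. validg d g \<Longrightarrow> fmul p (wd w) \<in> wideal d rels"

definition basis_mod :: "('x \<Rightarrow> ('g \<Rightarrow> 'k::comm_ring_1)) \<Rightarrow> 'x set \<Rightarrow> ('g \<Rightarrow> 'k) set \<Rightarrow>
    ('g \<Rightarrow> 'k) set \<Rightarrow> bool" where
  "basis_mod f X A J \<longleftrightarrow>
     (\<forall>c. finite {x\<in>X. c x \<noteq> 0} \<and> (\<Sum>x\<in>{x\<in>X. c x \<noteq> 0}. scal (c x) (f x)) \<in> J
          \<longrightarrow> (\<forall>x\<in>X. c x = 0)) \<and>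
     (\<forall>p\<in>A. \<exists>c. finite {x\<in>X. c x \<noteq> 0} \<and>
          p - (\<Sum>x\<in>{x\<in>X. c x \<noteq> 0}. scal (c x) (f x)) \<in> J)"

definition sprod :: "nat list \<Rightarrow> (nat \<Rightarrow> nat)" where
  "sprod is = foldr (\<lambda>i f. Transposition.transpose i (Suc i) \<circ> f) is id"

definition reduced_expr :: "nat \<Rightarrow> (nat \<Rightarrow> nat) \<Rightarrow> nat list \<Rightarrow> bool" where
  "reduced_expr d w is \<longleftrightarrow> set is \<subseteq> {1..d-1} \<and> sprod is = w \<and>
     (\<forall>js. set js \<subseteq> {1..d-1} \<and> sprod js = w \<longrightarrow> length is \<le> length js)"

definition rexp :: "nat \<Rightarrow> (nat \<Rightarrow> nat) \<Rightarrow> nat list" where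
  "rexp d w = (SOME is. reduced_expr d w is)"

definition Hw :: "nat \<Rightarrow> (nat \<Rightarrow> nat) \<Rightarrow> ('i gen list \<Rightarrow> 'k::{zero,one})" where
  "Hw d w = wd (map GH (rexp d w))"

definition idx :: "nat \<Rightarrow> ('i list \<times> (nat \<Rightarrow> nat)) set" where
  "idx d = {(l, w). length l = d \<and> w permutes {1..d}}"

end

theory Submission
  imports Defs
begin

text \<open>
  Let \<open>MM\<close> be the free left module over the tensor power with basis \<open>E w\<close>, where \<open>w\<close> runs through the
  symmetric group, and let \<open>T i\<close> be the operator on \<open>MM\<close> that the wreath and quadratic relations
  force upon left multiplication by \<open>H\<^sub>i\<close> on the elements \<open>\<Sum>\<^sub>w F\<^sub>w H\<^sub>w\<close>.  Without any condition,
  left multiplication by an element of the free algebra agrees, modulo the ideal of relations, with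
  its action on \<open>MM\<close>.  Hence the elements \<open>b H\<^sub>w\<close> always span, and they are a basis iff the map
  from \<open>MM\<close> to the quotient is injective, iff the defining relations act as zero on \<open>MM\<close>.

  Evaluating the relations on the generator \<open>E id\<close> and comparing coefficients gives exactly
  (C1)--(C9).  Conversely, (C1)--(C4) yield the wreath and quadratic relations on \<open>MM\<close>, while
  by (C5)--(C9) the vectors on which the two sides of a braid relation agree are closed under the
  tensor power and under both operators involved, so that the relation only has to be checked at
  \<open>E w\<close> for minimal coset representatives \<open>w\<close>, where it is a relation in the symmetric group.

  Finally, \<open>H\<^sub>w b\<close> equals \<open>\<sigma>\<^sub>w(b) H\<^sub>w\<close> up to terms with shorter permutations.  Since \<open>\<sigma>\<^sub>w\<close> is bijective,
  the families \<open>H\<^sub>w b\<close> and \<open>b H\<^sub>w\<close> are related by a triangular bijection of \<open>MM\<close>.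
\<close>

section \<open>Finitely supported functions\<close>

text \<open>The quotient algebra is never formed: statements about it are congruences modulo the
  ideal inside the free algebra, which acts on \<open>MM\<close> whatever the data are. The
  conditions concern two or three tensor factors, the relations \<open>d\<close> factors at any
  position. Pure tensors lead from few factors to many; padding with units, and cancelling them
  again, leads back. (C1) does not come from letting a relation act. With
  \<open>\<sigma> i one\<close> unknown, \<open>T i (E id one)\<close> is
  \<open>E (sp i) (\<sigma> i one) + E id (\<rho> i one)\<close>, and only the uniqueness of the
  normal form of \<open>Hg i\<close> identifies this with \<open>E (sp i) one\<close>. Checking the
  braid relation at every \<open>E w x\<close> would split according to the six places of
  \<open>w\<close> in its coset. The closure argument avoids this: (C5)--(C7) give closure under
  multiplication, (C8) and (C9) together with the quadratic relation give closure under the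
  operators, and (C1) makes the operators carry \<open>E w one\<close> up its coset.\<close>

definition fs :: "'a set \<Rightarrow> ('a \<Rightarrow> 'k::zero) set" where
  "fs A = {x. finite (supp x) \<and> supp x \<subseteq> A}"

text \<open>Linear extension from basis elements. The product, the placed endomorphisms and the
  action on \<open>MM\<close> are all brought into this form, so that linearity is proved
  once.\<close>

definition lin :: "('a \<Rightarrow> 'b \<Rightarrow> 'k) \<Rightarrow> ('a \<Rightarrow> 'k) \<Rightarrow> 'b \<Rightarrow> 'k::comm_ring_1" where
  "lin f x = (\<lambda>b. \<Sum>a\<in>supp x. x a * f a b)"

text \<open>Linearity is asked for on finitely supported functions only: a sum over an infinite
  support is 0 by convention, which destroys additivity.\<close>

definition linear_on :: "'a set \<Rightarrow> (('a \<Rightarrow> 'k) \<Rightarrow> 'b \<Rightarrow> 'k::comm_ring_1) \<Rightarrow> bool" where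
  "linear_on A g \<longleftrightarrow> (\<forall>x\<in>fs A. \<forall>y\<in>fs A. g (x + y) = g x + g y) \<and>
     (\<forall>c. \<forall>x\<in>fs A. g (scal c x) = scal c (g x))"

lemma scal_apply: "scal c x a = c * x a"
  by (simp add: scal_def)

lemma delta_apply: "delta a b = (if b = a then 1 else 0)"
  by (simp add: delta_def)

lemma supp_zero [simp]: "supp (0 :: 'a \<Rightarrow> 'k::zero) = {}"
  by (simp add: supp_def)

lemma supp_delta [simp]: "supp (delta a :: 'a \<Rightarrow> 'k::zero_neq_one) = {a}"
  by (auto simp: scal_apply supp_def delta_def)

lemma supp_add: "supp (x + y :: 'a \<Rightarrow> 'k::comm_ring_1) \<subseteq> supp x \<union> supp y"
  by (auto simp: scal_apply supp_def)

lemma supp_scal: "supp (scal c x :: 'a \<Rightarrow> 'k::comm_ring_1) \<subseteq> supp x"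
  by (auto simp: scal_apply supp_def)

lemma fs_subI: "finite B \<Longrightarrow> supp x \<subseteq> B \<Longrightarrow> B \<subseteq> A \<Longrightarrow> x \<in> fs A"
  by (auto simp: fs_def intro: finite_subset)

lemma fs_finite: "x \<in> fs A \<Longrightarrow> finite (supp x)"
  by (simp add: fs_def)

lemma fs_zero [simp]: "(0 :: 'a \<Rightarrow> 'k::zero) \<in> fs A"
  by (simp add: fs_def)

lemma fs_add [simp]: "x \<in> fs A \<Longrightarrow> y \<in> fs A \<Longrightarrow> (x + y :: 'a \<Rightarrow> 'k::comm_ring_1) \<in> fs A"
  using supp_add[of x y] by (auto simp: fs_def intro: finite_subset)

lemma fs_scal [simp]: "x \<in> fs A \<Longrightarrow> (scal c x :: 'a \<Rightarrow> 'k::comm_ring_1) \<in> fs A"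
  using supp_scal[of c x] by (auto simp: fs_def intro: finite_subset)

lemma fs_minus [simp]: "x \<in> fs A \<Longrightarrow> (- x :: 'a \<Rightarrow> 'k::comm_ring_1) \<in> fs A"
  by (simp add: fs_def supp_def)

lemma fs_diff [simp]: "x \<in> fs A \<Longrightarrow> y \<in> fs A \<Longrightarrow> (x - y :: 'a \<Rightarrow> 'k::comm_ring_1) \<in> fs A"
  using fs_add[of x A "- y"] by simp

lemma fs_delta [simp]: "(delta a :: 'a \<Rightarrow> 'k::zero_neq_one) \<in> fs A \<longleftrightarrow> a \<in> A"
  by (simp add: fs_def)

lemma fs_sum [simp]: "(\<And>i. i \<in> I \<Longrightarrow> g i \<in> fs A) \<Longrightarrow> (\<Sum>i\<in>I. g i :: 'a \<Rightarrow> 'k::comm_ring_1) \<in> fs A"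
  by (induction I rule: infinite_finite_induct) auto

lemma sum_apply: "(\<Sum>i\<in>I. g i) a = (\<Sum>i\<in>I. g i (a :: 'a) :: 'k::comm_monoid_add)"
  by (induction I rule: infinite_finite_induct) auto

lemma scal_zero [simp]: "scal c (0 :: 'a \<Rightarrow> 'k::comm_ring_1) = 0"
  by (auto simp: scal_apply fun_eq_iff)

lemma scal_0 [simp]: "scal 0 (x :: 'a \<Rightarrow> 'k::comm_ring_1) = 0"
  by (auto simp: scal_apply fun_eq_iff)

lemma scal_m1: "scal (- 1) (x :: 'a \<Rightarrow> 'k::comm_ring_1) = - x"
  by (auto simp: scal_apply fun_eq_iff)

lemma scal_add: "scal c (x + y :: 'a \<Rightarrow> 'k::comm_ring_1) = scal c x + scal c y"
  by (auto simp: scal_apply fun_eq_iff algebra_simps)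

lemma scal_diff: "scal c (x - y :: 'a \<Rightarrow> 'k::comm_ring_1) = scal c x - scal c y"
  by (auto simp: scal_apply fun_eq_iff algebra_simps)

lemma scal_sum: "scal c (\<Sum>i\<in>I. g i :: 'a \<Rightarrow> 'k::comm_ring_1) = (\<Sum>i\<in>I. scal c (g i))"
  by (rule ext) (simp add: scal_apply sum_apply sum_distrib_left)

lemma fs_expand:
  fixes x :: "'a \<Rightarrow> 'k::comm_ring_1"
  assumes "x \<in> fs A" "finite B" "supp x \<subseteq> B"
  shows "x = (\<Sum>a\<in>B. scal (x a) (delta a))"
proof
  fix b
  have "(\<Sum>a\<in>B. x a * (if b = a then 1 else 0)) = (if b \<in> B then x b else 0)"
    using assms(2) by (simp add: if_distrib sum.delta cong: if_cong)
  also have "\<dots> = x b" using assms(3) by (auto simp: scal_apply supp_def)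
  finally show "x b = (\<Sum>a\<in>B. scal (x a) (delta a)) b"
    by (simp add: sum_apply scal_apply delta_apply)
qed

lemma fs_induct [consumes 1, case_names zero add delta]:
  fixes x :: "'a \<Rightarrow> 'k::comm_ring_1"
  assumes x: "x \<in> fs A"
    and zero: "P 0"
    and add: "\<And>x y. x \<in> fs A \<Longrightarrow> y \<in> fs A \<Longrightarrow> P x \<Longrightarrow> P y \<Longrightarrow> P (x + y)"
    and delta: "\<And>c a. a \<in> A \<Longrightarrow> P (scal c (delta a))"
  shows "P x"
proof -
  have "B \<subseteq> A \<Longrightarrow> P (\<Sum>a\<in>B. scal (x a) (delta a))" if "finite B" for B
    using that
  proof (induction B)
    case empty
    show "P (\<Sum>a\<in>{}. scal (x a) (delta a))" using zero by simp
  next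
    case (insert b B)
    have "P (scal (x b) (delta b) + (\<Sum>a\<in>B. scal (x a) (delta a)))"
      using insert by (intro add delta) (auto intro!: fs_sum)
    then show "P (\<Sum>a\<in>insert b B. scal (x a) (delta a))"
      using insert by simp
  qed
  from this[of "supp x"] x fs_expand[OF x _ order_refl] show ?thesis
    by (simp add: fs_def)
qed

text \<open>Cancellation can shrink the support of a sum, so \<open>lin f (x + y)\<close> and its
  two summands are compared over a common finite superset.\<close>

lemma lin_superset:
  assumes "finite B" "supp x \<subseteq> B"
  shows "lin f x b = (\<Sum>a\<in>B. x a * f a b)"
  unfolding lin_def using assms by (intro sum.mono_neutral_left) (auto simp: supp_def)

lemma lin_add:
  assumes "x \<in> fs A" "y \<in> fs A" shows "lin f (x + y) = lin f x + lin f y"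
proof
  fix b
  let ?B = "supp x \<union> supp y"
  have fin: "finite ?B" using assms by (simp add: fs_def)
  show "lin f (x + y) b = (lin f x + lin f y) b"
    using lin_superset[OF fin, of "x + y" f b] lin_superset[OF fin, of x f b]
      lin_superset[OF fin, of y f b] supp_add[of x y]
    by (simp add: sum.distrib algebra_simps del: Un_iff)
qed

lemma lin_scal:
  assumes "x \<in> fs A" shows "lin f (scal c x) = scal c (lin f x)"
proof
  fix b
  show "lin f (scal c x) b = scal c (lin f x) b"
    using lin_superset[of "supp x" "scal c x" f b] supp_scal[of c x] assms
    by (simp add: lin_def scal_apply fs_def sum_distrib_left mult.assoc)
qed

lemma linear_on_lin [simp]: "linear_on A (lin f)"
  unfolding linear_on_def using lin_add lin_scal by blast

lemma lin_zero [simp]: "lin f 0 = 0"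
  by (auto simp: lin_def)

lemma lin_delta [simp]: "lin f (delta a) = f a"
  by (auto simp: lin_def delta_apply)

lemma lin_closed:
  assumes "x \<in> fs A" "\<And>a. a \<in> A \<Longrightarrow> f a \<in> fs B"
  shows "lin f x \<in> fs B"
  using assms(1)
proof (induction rule: fs_induct)
  case zero
  show "lin f 0 \<in> fs B" by simp
next
  case (add x y)
  then show "lin f (x + y) \<in> fs B" by (simp add: lin_add)
next
  case (delta c a)
  then show "lin f (scal c (delta a)) \<in> fs B"
    using lin_scal[of "delta a" A f c] assms(2)[of a] by simp
qed

lemma linear_onI:
  assumes "\<And>x y. x \<in> fs A \<Longrightarrow> y \<in> fs A \<Longrightarrow> g (x + y) = g x + g y"
    and "\<And>c x. x \<in> fs A \<Longrightarrow> g (scal c x) = scal c (g x)"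
  shows "linear_on A g"
  using assms by (simp add: linear_on_def)

lemma linear_onD:
  assumes "linear_on A g"
  shows "x \<in> fs A \<Longrightarrow> y \<in> fs A \<Longrightarrow> g (x + y) = g x + g y"
    and "x \<in> fs A \<Longrightarrow> g (scal c x) = scal c (g x)"
  using assms by (simp_all add: linear_on_def)

lemma linear_on_zero: "linear_on A g \<Longrightarrow> g 0 = 0"
  using linear_onD(2)[of A g 0 0] by simp

lemma linear_on_ext:
  assumes g: "linear_on A g" and h: "linear_on A h"
    and gh: "\<And>a. a \<in> A \<Longrightarrow> g (delta a) = h (delta a)" and x: "x \<in> fs A"
  shows "g x = h x"
  using x
proof (induction rule: fs_induct)
  case zero
  show "g 0 = h 0" using linear_on_zero g h by metis
next
  case (add x y)
  then show "g (x + y) = h (x + y)" by (simp add: linear_onD[OF g] linear_onD[OF h])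
next
  case (delta c a)
  then show "g (scal c (delta a)) = h (scal c (delta a))"
    by (simp add: linear_onD[OF g] linear_onD[OF h] gh)
qed

lemma linear_on_comp:
  assumes "linear_on A g" "linear_on B h" "\<And>x. x \<in> fs A \<Longrightarrow> g x \<in> fs B"
  shows "linear_on A (\<lambda>x. h (g x))"
  using assms by (auto simp: linear_on_def)

lemma linear_on_plus:
  assumes "linear_on A g" "linear_on A h"
  shows "linear_on A (\<lambda>x. g x + h x)"
  using assms by (auto simp: linear_on_def scal_add algebra_simps)

lemma linear_on_sum:
  assumes "linear_on A g" "\<And>i. i \<in> I \<Longrightarrow> f i \<in> fs A"
  shows "g (\<Sum>i\<in>I. f i) = (\<Sum>i\<in>I. g (f i))"
  using assms(2)
proof (induction I rule: infinite_finite_induct)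
  case (insert i I)
  then have "g (f i + sum f I) = g (f i) + (\<Sum>i\<in>I. g (f i))"
    by (simp add: linear_onD(1)[OF assms(1)])
  then show "g (\<Sum>i\<in>insert i I. f i) = (\<Sum>i\<in>insert i I. g (f i))"
    using insert by simp
next
  case empty
  show "g (\<Sum>i\<in>{}. f i) = (\<Sum>i\<in>{}. g (f i))" by (simp add: linear_on_zero[OF assms(1)])
next
  case (infinite I)
  then show "g (\<Sum>i\<in>I. f i) = (\<Sum>i\<in>I. g (f i))" by (simp add: linear_on_zero[OF assms(1)])
qed

section \<open>Tensor powers of a based algebra\<close>

text \<open>One cut at the fixed position \<open>a\<close> is enough: if \<open>x\<close> lies in
  \<open>Tn a\<close>, no other cut of \<open>v\<close> can contribute.\<close>

definition tens :: "nat \<Rightarrow> ('i list \<Rightarrow> 'k) \<Rightarrow> ('i list \<Rightarrow> 'k) \<Rightarrow> 'i list \<Rightarrow> 'k::comm_ring_1" where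
  "tens a x y = (\<lambda>v. x (take a v) * y (drop a v))"

abbreviation len :: "nat \<Rightarrow> 'i list set" where
  "len n \<equiv> {l. length l = n}"

definition basis_mul :: "('i \<Rightarrow> 'i \<Rightarrow> 'i \<Rightarrow> 'k::comm_ring_1) \<Rightarrow> nat \<Rightarrow> 'i list \<Rightarrow> 'i list \<Rightarrow> 'i list \<Rightarrow> 'k" where
  "basis_mul m n l l' = (\<lambda>v. if length v = n \<and> length l = n \<and> length l' = n
     then (\<Prod>t<n. m (l!t) (l'!t) (v!t)) else 0)"

lemma Tn_eq_fs: "Tn n = fs (len n)"
  by (auto simp: Tn_def fs_def supp_def)

lemma tens_closed [simp]:
  assumes "x \<in> Tn a" "y \<in> Tn b" shows "tens a x y \<in> Tn (a + b)"
  unfolding Tn_eq_fs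
proof (rule fs_subI)
  let ?B = "(\<lambda>(p, q). p @ q) ` (supp x \<times> supp y)"
  show "finite ?B" using assms by (simp add: Tn_def)
  show "supp (tens a x y) \<subseteq> ?B"
  proof
    fix v assume "v \<in> supp (tens a x y)"
    then have "x (take a v) \<noteq> 0" "y (drop a v) \<noteq> 0" by (auto simp: supp_def tens_def)
    then show "v \<in> ?B" by (intro image_eqI[of _ _ "(take a v, drop a v)"]) (auto simp: supp_def)
  qed
  show "?B \<subseteq> len (a + b)" using assms by (auto simp: Tn_def supp_def)
qed

lemma tens_delta:
  assumes "length p = a"
  shows "tens a (delta p) (delta q) = (delta (p @ q) :: 'i list \<Rightarrow> 'k::comm_ring_1)"
proof
  fix v
  have "v = p @ q \<longleftrightarrow> take a v = p \<and> drop a v = q" 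
    using assms by (metis append_eq_conv_conj append_take_drop_id)
  then show "tens a (delta p) (delta q) v = (delta (p @ q) v :: 'k)"
    by (auto simp: tens_def delta_apply)
qed

lemma tens_assoc: "tens (a + b) (tens a x y) z = tens a x (tens b y z)"
  by (auto simp: tens_def fun_eq_iff min_def drop_take mult.assoc add.commute)

lemma linear_on_id: "linear_on A (\<lambda>x. x)"
  by (simp add: linear_on_def)

lemma linear_on_tens_left: "linear_on A g \<Longrightarrow> linear_on A (\<lambda>x. tens a (g x) y)"
  by (auto simp: linear_on_def tens_def fun_eq_iff scal_apply algebra_simps)

lemma linear_on_tens_right: "linear_on A g \<Longrightarrow> linear_on A (\<lambda>y. tens a x (g y))"
  by (auto simp: linear_on_def tens_def fun_eq_iff scal_apply algebra_simps)

lemma linear_on_lin_param: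
  assumes "\<And>a. linear_on A (g a)"
  shows "linear_on A (\<lambda>y. lin (\<lambda>a. g a y) x)"
  by (rule linear_onI; rule ext)
    (simp_all add: lin_def scal_apply linear_onD[OF assms] algebra_simps sum.distrib sum_distrib_left)

lemma tens_zero [simp]: "tens a 0 y = 0" "tens a x 0 = 0"
  by (auto simp: tens_def fun_eq_iff)

lemma tmul_lin: "tmul m n x y = lin (\<lambda>l. lin (basis_mul m n l) y) x"
proof
  fix v
  show "tmul m n x y v = lin (\<lambda>l. lin (basis_mul m n l) y) x v"
    unfolding tmul_def lin_def basis_mul_def
    by (auto simp: sum_distrib_left mult.assoc intro!: sum.cong sum.neutral)
qed

lemma linear_on_tmul_left:
  assumes "linear_on A g" "\<And>x. x \<in> fs A \<Longrightarrow> g x \<in> Tn n"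
  shows "linear_on A (\<lambda>x. tmul m n (g x) y)"
  by (rule linear_on_comp[OF assms(1), where B = "len n"]) (use assms(2) in \<open>simp_all add: tmul_lin Tn_eq_fs\<close>)

lemma linear_on_tmul_right:
  assumes "linear_on A g" "\<And>x. x \<in> fs A \<Longrightarrow> g x \<in> Tn n"
  shows "linear_on A (\<lambda>y. tmul m n x (g y))"
  by (rule linear_on_comp[OF assms(1), where B = "len n"])
    (use assms(2) in \<open>simp_all add: tmul_lin linear_on_lin_param Tn_eq_fs\<close>)

lemmas linear_on_intros = linear_on_id linear_on_tens_left linear_on_tens_right
  linear_on_tmul_left linear_on_tmul_right

lemma tmul_delta: "tmul m n (delta l) (delta l') = basis_mul m n l l'"
  by (simp add: tmul_lin)

lemma prod_lessThan_add: "(\<Prod>t<a + b. f t) = (\<Prod>t<a. f t) * (\<Prod>t<b. f (a + t))"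
  for f :: "nat \<Rightarrow> 'k::comm_monoid_mult"
  by (induction b) (simp_all add: mult.assoc)

lemma basis_mul_append:
  assumes "length p = a" "length p' = a" "length q = b" "length q' = b"
  shows "basis_mul m (a + b) (p @ q) (p' @ q') = tens a (basis_mul m a p p') (basis_mul m b q q')"
proof
  fix v :: "'a list"
  have "length v = a + b \<longleftrightarrow> length (take a v) = a \<and> length (drop a v) = b" by auto
  then show "basis_mul m (a + b) (p @ q) (p' @ q') v = tens a (basis_mul m a p p') (basis_mul m b q q') v"
    using assms by (auto simp: basis_mul_def tens_def prod_lessThan_add nth_append)
qed

lemma tone_add: "tone u (a + b) = tens a (tone u a) (tone u b)"
proof
  fix v :: "'a list"
  have "length v = a + b \<longleftrightarrow> length (take a v) = a \<and> length (drop a v) = b" by auto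
  then show "tone u (a + b) v = tens a (tone u a) (tone u b) v"
    by (auto simp: tone_def tens_def prod_lessThan_add nth_append)
qed

text \<open>Identifies \<open>B\<close> with its first tensor power. Through it the axioms in
  \<open>basis_algebra\<close> enter the inductions on the number of factors.\<close>

definition up :: "('i \<Rightarrow> 'k) \<Rightarrow> 'i list \<Rightarrow> 'k::comm_ring_1" where
  "up z = (\<lambda>v. if length v = 1 then z (v!0) else 0)"

lemma supp_up: "supp (up z) = (\<lambda>i. [i]) ` supp z"
  by (auto simp: supp_def up_def length_Suc_conv image_iff)

lemma up_delta: "up (delta i) = (delta [i] :: 'i list \<Rightarrow> 'k::comm_ring_1)"
  by (auto simp: up_def delta_apply fun_eq_iff length_Suc_conv)

lemma tmul_up: "tmul m 1 (up x) (up y) = up (bmul m x y)"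
proof
  fix v
  have inj: "inj_on (\<lambda>i. [i]) A" for A :: "'a set" by (simp add: inj_on_def)
  show "tmul m 1 (up x) (up y) v = up (bmul m x y) v"
    unfolding tmul_def supp_up sum.reindex[OF inj] by (simp add: up_def bmul_def)
qed

lemma tone_1: "tone u 1 = up u"
  by (auto simp: tone_def up_def fun_eq_iff)

lemma tone_0: "tone u 0 = delta []"
  by (auto simp: tone_def delta_apply fun_eq_iff)

lemma basis_mul_0: "basis_mul m 0 [] [] = delta []"
  by (auto simp: basis_mul_def delta_apply fun_eq_iff)

lemma linear_on_ext_Tn:
  assumes "linear_on (len n) g" "linear_on (len n) h"
    and "\<And>l. length l = n \<Longrightarrow> g (delta l) = h (delta l)" and "x \<in> Tn n"
  shows "g x = h x"
  using linear_on_ext[OF assms(1,2)] assms(3,4) by (simp add: Tn_eq_fs)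

lemma delta_Tn [simp]: "(delta l :: 'i list \<Rightarrow> 'k::comm_ring_1) \<in> Tn n \<longleftrightarrow> length l = n"
  by (simp add: Tn_eq_fs)

lemma Tn_zero [simp]: "(0 :: 'i list \<Rightarrow> 'k::comm_ring_1) \<in> Tn n"
  by (simp add: Tn_eq_fs)

lemma Tn_add [simp]: "x \<in> Tn n \<Longrightarrow> y \<in> Tn n \<Longrightarrow> (x + y :: 'i list \<Rightarrow> 'k::comm_ring_1) \<in> Tn n"
  by (simp add: Tn_eq_fs)

lemma Tn_diff [simp]: "x \<in> Tn n \<Longrightarrow> y \<in> Tn n \<Longrightarrow> (x - y :: 'i list \<Rightarrow> 'k::comm_ring_1) \<in> Tn n"
  by (simp add: Tn_eq_fs)

lemma Tn_scal [simp]: "x \<in> Tn n \<Longrightarrow> (scal c x :: 'i list \<Rightarrow> 'k::comm_ring_1) \<in> Tn n"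
  by (simp add: Tn_eq_fs)

locale balg =
  fixes m :: "'i \<Rightarrow> 'i \<Rightarrow> 'i \<Rightarrow> 'k::comm_ring_1" and u :: "'i \<Rightarrow> 'k"
  assumes B: "basis_algebra m u"
begin

text \<open>A nonzero coefficient at \<open>v\<close> is a product of nonzero structure constants,
  so every entry of \<open>v\<close> lies in one fixed finite set.\<close>

lemma basis_mul_closed [simp]: "basis_mul m n l l' \<in> Tn n"
  unfolding Tn_eq_fs
proof (rule fs_subI)
  let ?K = "\<Union>t<n. {k. m (l!t) (l'!t) k \<noteq> 0}"
  let ?B = "{v. set v \<subseteq> ?K \<and> length v = n}"
  have "finite ?K" using B by (auto simp: basis_algebra_def)
  then show "finite ?B" by (rule finite_lists_length_eq)
  show "supp (basis_mul m n l l') \<subseteq> ?B"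
  proof
    fix v assume "v \<in> supp (basis_mul m n l l')"
    then have v: "length v = n" and nz: "(\<Prod>t<n. m (l!t) (l'!t) (v!t)) \<noteq> 0"
      by (auto simp: supp_def basis_mul_def split: if_splits)
    have "m (l!t) (l'!t) (v!t) \<noteq> 0" if "t < n" for t
    proof
      assume "m (l!t) (l'!t) (v!t) = 0"
      then have "(\<Prod>t<n. m (l!t) (l'!t) (v!t)) = 0"
        using that by (intro prod_zero) auto
      with nz show False by simp
    qed
    with v show "v \<in> ?B" by (fastforce simp: in_set_conv_nth)
  qed
qed auto

lemma tmul_closed [simp]:
  assumes "x \<in> Tn n" "y \<in> Tn n" shows "tmul m n x y \<in> Tn n"
  using assms basis_mul_closed unfolding tmul_lin Tn_eq_fs by (blast intro: lin_closed)

text \<open>Both sides are linear in each of the four arguments. The identity on basis lists is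
  extended to one argument at a time.\<close>

lemma tmul_tens:
  assumes "x \<in> Tn a" "x' \<in> Tn a" "y \<in> Tn b" "y' \<in> Tn b"
  shows "tmul m (a + b) (tens a x y) (tens a x' y') = tens a (tmul m a x x') (tmul m b y y')"
proof -
  have 1: "tmul m (a + b) (tens a (delta p) (delta q)) (tens a (delta p') (delta q'))
      = tens a (tmul m a (delta p) (delta p')) (tmul m b (delta q) (delta q'))"
    if "length p = a" "length p' = a" "length q = b" "length q' = b" for p p' q q'
    using that by (simp add: tens_delta tmul_delta basis_mul_append)
  have 2: "tmul m (a + b) (tens a x (delta q)) (tens a (delta p') (delta q'))
      = tens a (tmul m a x (delta p')) (tmul m b (delta q) (delta q'))"
    if "length p' = a" "length q = b" "length q' = b" for p' q q'
    by (rule linear_on_ext_Tn[OF _ _ _ assms(1)]; (intro linear_on_intros 1 that)?) (use that in \<open>simp_all add: Tn_eq_fs[symmetric]\<close>)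
  have 3: "tmul m (a + b) (tens a x (delta q)) (tens a x' (delta q'))
      = tens a (tmul m a x x') (tmul m b (delta q) (delta q'))"
    if "length q = b" "length q' = b" for q q'
    by (rule linear_on_ext_Tn[OF _ _ _ assms(2)]; (intro linear_on_intros 2 that)?) (use that assms in \<open>simp_all add: Tn_eq_fs[symmetric]\<close>)
  have 4: "tmul m (a + b) (tens a x y) (tens a x' (delta q'))
      = tens a (tmul m a x x') (tmul m b y (delta q'))"
    if "length q' = b" for q'
    by (rule linear_on_ext_Tn[OF _ _ _ assms(3)]; (intro linear_on_intros 3 that)?) (use that assms in \<open>simp_all add: Tn_eq_fs[symmetric]\<close>)
  show ?thesis
    by (rule linear_on_ext_Tn[OF _ _ _ assms(4)]; (intro linear_on_intros 4)?) (use assms in \<open>simp_all add: Tn_eq_fs[symmetric]\<close>)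
qed

lemma up_closed: "finite (supp z) \<Longrightarrow> up z \<in> Tn 1"
  using supp_up[of z] by (auto simp: Tn_eq_fs fs_def)

lemma tone_closed [simp]: "tone u n \<in> Tn n"
proof (induction n)
  case 0 show ?case by (simp add: tone_0)
next
  case (Suc n)
  have "up u \<in> Tn 1" using B up_closed[of u] by (simp add: basis_algebra_def)
  then have "tens 1 (tone u 1) (tone u n) \<in> Tn (1 + n)" using Suc by (simp only: tone_1 tens_closed)
  then show ?case by (simp add: tone_add[symmetric])
qed

text \<open>Peeling off the first factor splits the claim by \<open>tmul_tens\<close> into
  associativity of \<open>B\<close> and the claim for one factor less.\<close>

lemma basis_assoc:
  assumes "length x = n" "length y = n" "length z = n"
  shows "tmul m n (tmul m n (delta x) (delta y)) (delta z) = tmul m n (delta x) (tmul m n (delta y) (delta z))"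
  using assms
proof (induction n arbitrary: x y z)
  case 0 then show ?case by (simp add: tmul_delta basis_mul_0)
next
  case (Suc n)
  obtain i x' where x: "x = [i] @ x'" "length x' = n" using Suc.prems by (auto simp: length_Suc_conv)
  obtain j y' where y: "y = [j] @ y'" "length y' = n" using Suc.prems by (auto simp: length_Suc_conv)
  obtain k z' where z: "z = [k] @ z'" "length z' = n" using Suc.prems by (auto simp: length_Suc_conv)
  have one: "tmul m 1 (tmul m 1 (delta [i]) (delta [j])) (delta [k])
      = tmul m 1 (delta [i]) (tmul m 1 (delta [j]) (delta [k]))"
    using B by (simp only: up_delta[symmetric] tmul_up basis_algebra_def)
  have d: "delta x = tens 1 (delta [i]) (delta x')" "delta y = tens 1 (delta [j]) (delta y')"
    "delta z = tens 1 (delta [k]) (delta z')"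
    by (simp_all add: x y z tens_delta)
  have cl: "(delta [l] :: 'i list \<Rightarrow> 'k) \<in> Tn 1" for l by simp
  have cl': "(delta x' :: 'i list \<Rightarrow> 'k) \<in> Tn n" "(delta y' :: 'i list \<Rightarrow> 'k) \<in> Tn n"
    "(delta z' :: 'i list \<Rightarrow> 'k) \<in> Tn n" using x y z by simp_all
  have "tmul m (1 + n) (tmul m (1 + n) (delta x) (delta y)) (delta z)
      = tmul m (1 + n) (delta x) (tmul m (1 + n) (delta y) (delta z))"
    unfolding d using cl cl' one Suc.IH[OF x(2) y(2) z(2)] by (simp only: tmul_tens tmul_closed)
  then show ?case by simp
qed

lemma tmul_assoc:
  assumes "x \<in> Tn n" "y \<in> Tn n" "z \<in> Tn n"
  shows "tmul m n (tmul m n x y) z = tmul m n x (tmul m n y z)"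
proof -
  have 1: "tmul m n (tmul m n x (delta l)) (delta l') = tmul m n x (tmul m n (delta l) (delta l'))"
    if "length l = n" "length l' = n" for l l'
    by (rule linear_on_ext_Tn[OF _ _ _ assms(1)]; (intro linear_on_intros basis_assoc that)?)
      (use that in \<open>simp_all add: Tn_eq_fs[symmetric]\<close>)
  have 2: "tmul m n (tmul m n x y) (delta l') = tmul m n x (tmul m n y (delta l'))"
    if "length l' = n" for l'
    by (rule linear_on_ext_Tn[OF _ _ _ assms(2)]; (intro linear_on_intros 1 that)?)
      (use that assms in \<open>simp_all add: Tn_eq_fs[symmetric]\<close>)
  show ?thesis
    by (rule linear_on_ext_Tn[OF _ _ _ assms(3)]; (intro linear_on_intros 2)?)
      (use assms in \<open>simp_all add: Tn_eq_fs[symmetric]\<close>)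
qed

lemma basis_unit:
  assumes "length x = n"
  shows "tmul m n (tone u n) (delta x) = delta x \<and> tmul m n (delta x) (tone u n) = delta x"
  using assms
proof (induction n arbitrary: x)
  case 0 then show ?case by (simp add: tmul_delta basis_mul_0 tone_0)
next
  case (Suc n)
  obtain i x' where x: "x = [i] @ x'" "length x' = n" using Suc.prems by (auto simp: length_Suc_conv)
  have one: "tmul m 1 (tone u 1) (delta [i]) = delta [i]" "tmul m 1 (delta [i]) (tone u 1) = delta [i]"
    using B by (simp_all only: tone_1 up_delta[symmetric] tmul_up basis_algebra_def)
  have d: "delta x = tens 1 (delta [i]) (delta x')" by (simp add: x tens_delta)
  have cl: "(delta [i] :: 'i list \<Rightarrow> 'k) \<in> Tn 1" "(delta x' :: 'i list \<Rightarrow> 'k) \<in> Tn n" using x by simp_all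
  have "tmul m (1 + n) (tone u (1 + n)) (delta x) = delta x \<and> tmul m (1 + n) (delta x) (tone u (1 + n)) = delta x"
    unfolding d tone_add using cl one Suc.IH[OF x(2)] by (simp only: tmul_tens tone_closed)
  then show ?case by simp
qed

lemma tmul_1_left [simp]: 
  assumes "x \<in> Tn n" shows "tmul m n (tone u n) x = x"
  by (rule linear_on_ext_Tn[OF _ _ _ assms]; (intro linear_on_intros)?) (simp_all add: basis_unit Tn_eq_fs[symmetric])

lemma tmul_1_right [simp]: 
  assumes "x \<in> Tn n" shows "tmul m n x (tone u n) = x"
  by (rule linear_on_ext_Tn[OF _ _ _ assms]; (intro linear_on_intros)?) (simp_all add: basis_unit Tn_eq_fs[symmetric])

lemma tmul_add_left:
  "x \<in> Tn n \<Longrightarrow> y \<in> Tn n \<Longrightarrow> tmul m n (x + y) z = tmul m n x z + tmul m n y z"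
  using linear_onD(1)[OF linear_on_tmul_left[OF linear_on_id, of "len n" n m z]] by (simp add: Tn_eq_fs)

lemma tmul_add_right:
  "x \<in> Tn n \<Longrightarrow> y \<in> Tn n \<Longrightarrow> tmul m n z (x + y) = tmul m n z x + tmul m n z y"
  using linear_onD(1)[OF linear_on_tmul_right[OF linear_on_id, of "len n" n m z]] by (simp add: Tn_eq_fs)

lemma tmul_scal_left: "x \<in> Tn n \<Longrightarrow> tmul m n (scal c x) z = scal c (tmul m n x z)"
  using linear_onD(2)[OF linear_on_tmul_left[OF linear_on_id, of "len n" n m z]] by (simp add: Tn_eq_fs)

lemma tmul_scal_right: "x \<in> Tn n \<Longrightarrow> tmul m n z (scal c x) = scal c (tmul m n z x)"
  using linear_onD(2)[OF linear_on_tmul_right[OF linear_on_id, of "len n" n m z]] by (simp add: Tn_eq_fs)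

lemma tmul_zero [simp]: "tmul m n 0 z = 0" "tmul m n z 0 = 0"
  by (auto simp: tmul_def fun_eq_iff)

end

(* Keeps sizes in the shape a + (2 + b) on which the block lemmas match. *)
declare add_2_eq_Suc [simp del] add_2_eq_Suc' [simp del]

section \<open>Endomorphisms acting on two adjacent tensor factors\<close>

lemma klin_iff: "klin n phi \<longleftrightarrow> linear_on (len n) phi \<and> (\<forall>x\<in>Tn n. phi x \<in> Tn n)"
  by (auto simp: klin_def linear_on_def Tn_eq_fs)

lemma klin_closed: "klin n phi \<Longrightarrow> x \<in> Tn n \<Longrightarrow> phi x \<in> Tn n"
  by (simp add: klin_def)

lemma tens_ext_lin:
  "tens_ext n i phi x = lin (\<lambda>l v. if length v = n then
     (if length l = n \<and> (\<forall>t<n. t \<noteq> i-1 \<and> t \<noteq> i \<longrightarrow> l!t = v!t)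
      then phi (delta [l!(i-1), l!i]) [v!(i-1), v!i] else 0) else 0) x"
  by (auto simp: tens_ext_def lin_def fun_eq_iff)

lemma linear_on_tens_ext:
  assumes "linear_on A g" "\<And>x. x \<in> fs A \<Longrightarrow> g x \<in> Tn n'"
  shows "linear_on A (\<lambda>x. tens_ext n i phi (g x))"
  by (rule linear_on_comp[OF assms(1), where B = "len n'"])
    (use assms(2) in \<open>simp_all add: tens_ext_lin Tn_eq_fs\<close>)

lemma length_2_conv: "length c = 2 \<longleftrightarrow> (\<exists>x y. c = [x, y])"
  by (auto simp: numeral_2_eq_2 length_Suc_conv)

lemma split_mid:
  assumes "length v = a + (k + b)"
  obtains p c q where "v = p @ c @ q" "length p = a" "length c = k" "length q = b"
proof (rule that)
  show "v = take a v @ take k (drop a v) @ drop k (drop a v)" by (simp only: append_take_drop_id)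
qed (use assms in auto)

text \<open>Turns the index condition in \<open>tens_ext\<close> into a condition on blocks.\<close>

lemma agree_off_mid:
  assumes "length p = a" "length p' = a" "length q = b" "length q' = b"
  shows "(\<forall>t<a + (2 + b). t \<noteq> a \<and> t \<noteq> Suc a \<longrightarrow> (p @ [x, y] @ q) ! t = (p' @ [x', y'] @ q') ! t)
    \<longleftrightarrow> p = p' \<and> q = q'" (is "?L \<longleftrightarrow> _")
proof
  assume L: ?L
  have "p = p'"
  proof (rule nth_equalityI)
    fix t assume "t < length p"
    then show "p ! t = p' ! t" using spec[OF L, of t] assms by (simp add: nth_append)
  qed (use assms in simp)
  moreover have "q = q'"
  proof (rule nth_equalityI)
    fix t assume "t < length q"
    then show "q ! t = q' ! t" using spec[OF L, of "a + (2 + t)"] assms by (simp add: nth_append)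
  qed (use assms in simp)
  ultimately show "p = p' \<and> q = q'" by simp
next
  assume "p = p' \<and> q = q'"
  moreover have "[x, y] ! (t - a) = [x', y'] ! (t - a)" if "t \<noteq> a" "t \<noteq> Suc a" "\<not> t < a" "t - a < 2" for t
    using that by auto
  ultimately show ?L using assms by (auto simp: nth_append nth_Cons split: nat.split)
qed

lemma tens_ext_delta:
  fixes phi :: "('i list \<Rightarrow> 'k::comm_ring_1) \<Rightarrow> 'i list \<Rightarrow> 'k"
  assumes "length p = a" "length c = 2" "length q = b" and phi: "phi (delta c) \<in> Tn 2"
  shows "tens_ext (a + (2 + b)) (Suc a) phi (delta (p @ c @ q))
    = tens a (delta p) (tens 2 (phi (delta c)) (delta q))"
proof
  fix v :: "'i list"
  obtain x y where c: "c = [x, y]" using assms by (auto simp: length_2_conv)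
  show "tens_ext (a + (2 + b)) (Suc a) phi (delta (p @ c @ q)) v
    = tens a (delta p) (tens 2 (phi (delta c)) (delta q)) v"
  proof (cases "length v = a + (2 + b)")
    case True
    then obtain p' c' q' where v: "v = p' @ c' @ q'" "length p' = a" "length c' = 2" "length q' = b"
      by (rule split_mid)
    obtain x' y' where c': "c' = [x', y']" using v by (auto simp: length_2_conv)
    have nth: "(p @ c @ q) ! a = x" "(p @ c @ q) ! Suc a = y" "v ! a = x'" "v ! Suc a = y'"
      using assms v c c' by (auto simp: nth_append)
    define l where "l = p @ c @ q"
    have agree: "(\<forall>t<a + (2 + b). t \<noteq> a \<and> t \<noteq> Suc a \<longrightarrow> l ! t = v ! t) \<longleftrightarrow> p = p' \<and> q = q'"
      unfolding l_def v(1) c c' by (rule agree_off_mid[OF assms(1) v(2) assms(3) v(4)])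
    have "length l = a + (2 + b)" using assms by (simp add: l_def)
    then have "tens_ext (a + (2 + b)) (Suc a) phi (delta l) v
      = (if p = p' \<and> q = q' then phi (delta [x, y]) [x', y'] else 0)"
      unfolding tens_ext_lin lin_delta
      using agree True nth[folded l_def] by (simp only: diff_Suc_1 if_True simp_thms)
    moreover have "drop a v = c' @ q'" "take a v = p'" "take 2 (c' @ q') = c'" "drop 2 (c' @ q') = q'"
      using v by simp_all
    then have "tens a (delta p) (tens 2 (phi (delta c)) (delta q)) v
      = delta p p' * (phi (delta c) c' * delta q q')"
      by (simp only: tens_def)
    ultimately show ?thesis
      by (auto simp: delta_apply c c' l_def)
  next
    case False
    have "tens a (delta p) (tens 2 (phi (delta c)) (delta q)) \<in> Tn (a + (2 + b))"
      using assms by simp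
    then have "tens a (delta p) (tens 2 (phi (delta c)) (delta q)) v = 0"
      using False by (auto simp: Tn_def)
    then show ?thesis using False by (simp add: tens_ext_def)
  qed
qed

text \<open>\<open>tens_ext\<close> evaluates \<open>phi\<close> at basis lists only; linearity of
  \<open>phi\<close> extends this to the whole middle block. Later computations use this form
  instead of coordinates.\<close>

lemma tens_ext_mid:
  fixes phi :: "('i list \<Rightarrow> 'k::comm_ring_1) \<Rightarrow> 'i list \<Rightarrow> 'k"
  assumes phi: "klin 2 phi" and p: "p \<in> Tn a" and x: "x \<in> Tn 2" and q: "q \<in> Tn b"
  shows "tens_ext (a + (2 + b)) (Suc a) phi (tens a p (tens 2 x q)) = tens a p (tens 2 (phi x) q)"
proof -
  have cl: "phi x \<in> Tn 2" if "x \<in> Tn 2" for x using phi that by (simp add: klin_def)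
  have lphi: "linear_on (len 2) phi" using phi by (simp add: klin_iff)
  have 1: "tens_ext (a + (2 + b)) (Suc a) phi (tens a (delta p) (tens 2 (delta c) (delta q)))
      = tens a (delta p) (tens 2 (phi (delta c)) (delta q))"
    if "length p = a" "length c = 2" "length q = b" for p c q
    using tens_ext_delta[of p a c q b phi] that by (simp add: tens_delta cl)
  have 2: "tens_ext (a + (2 + b)) (Suc a) phi (tens a p (tens 2 (delta c) (delta q)))
      = tens a p (tens 2 (phi (delta c)) (delta q))" if "length c = 2" "length q = b" for c q
    by (rule linear_on_ext_Tn[OF _ _ _ p];
        (intro linear_on_intros linear_on_tens_ext[where n' = "a + (2 + b)"] 1 that)?)
      (use that in \<open>simp_all add: Tn_eq_fs[symmetric]\<close>)
  have 3: "tens_ext (a + (2 + b)) (Suc a) phi (tens a p (tens 2 x (delta q)))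
      = tens a p (tens 2 (phi x) (delta q))" if "length q = b" for q
    by (rule linear_on_ext_Tn[OF _ _ _ x];
        (intro linear_on_intros lphi linear_on_tens_ext[where n' = "a + (2 + b)"] 2 that)?)
      (use that p in \<open>simp_all add: Tn_eq_fs[symmetric]\<close>)
  show ?thesis
    by (rule linear_on_ext_Tn[OF _ _ _ q];
        (intro linear_on_intros linear_on_tens_ext[where n' = "a + (2 + b)"] 3)?)
      (use p x in \<open>simp_all add: Tn_eq_fs[symmetric]\<close>)
qed

lemma split_delta:
  assumes "length l = a + (2 + b)"
  obtains p c q where "length p = a" "length c = 2" "length q = b"
    "(delta l :: 'i list \<Rightarrow> 'k::comm_ring_1) = tens a (delta p) (tens 2 (delta c) (delta q))"
proof -
  obtain p c q where l: "l = p @ c @ q" "length p = a" "length c = 2" "length q = b"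
    using assms by (rule split_mid)
  show thesis by (rule that[OF l(2-4)]) (simp add: l tens_delta)
qed

text \<open>Positions are 1-based: \<open>a = i - 1\<close> factors precede the pair at
  \<open>i\<close>, \<open>i + 1\<close>, and \<open>b = n - i - 1\<close> follow it.\<close>

lemma pos_split:
  assumes "1 \<le> i" "i < n"
  obtains a b where "i = Suc a" "n = a + (2 + b)"
proof (rule that)
  show "i = Suc (i - 1)" "n = (i - 1) + (2 + (n - i - 1))" using assms by auto
qed

lemma tens_ext_closed [simp]:
  fixes phi :: "('i list \<Rightarrow> 'k::comm_ring_1) \<Rightarrow> 'i list \<Rightarrow> 'k"
  assumes phi: "klin 2 phi" and i: "1 \<le> i" "i < n" and x: "x \<in> Tn n"
  shows "tens_ext n i phi x \<in> Tn n"
proof -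
  obtain a b where ab: "i = Suc a" "n = a + (2 + b)" using i by (rule pos_split)
  have "tens_ext n i phi (delta l) \<in> Tn n" if l: "length l = n" for l
  proof -
    obtain p c q where pq: "length p = a" "length c = 2" "length q = b"
      and d: "(delta l :: 'i list \<Rightarrow> 'k) = tens a (delta p) (tens 2 (delta c) (delta q))"
      using l[unfolded ab] by (rule split_delta)
    show ?thesis using pq phi unfolding d ab
      by (simp add: tens_ext_mid klin_closed del: One_nat_def)
  qed
  then show ?thesis
    using x unfolding Tn_eq_fs tens_ext_lin by (intro lin_closed[where A = "len n"]) auto
qed

lemma linear_on_tens_ext' [simp]: "linear_on A (tens_ext n i phi)"
  by (simp add: tens_ext_lin[abs_def])

lemma tens_ext_left:
  fixes phi :: "('i list \<Rightarrow> 'k::comm_ring_1) \<Rightarrow> 'i list \<Rightarrow> 'k"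
  assumes phi: "klin 2 phi" and i: "1 \<le> i" "i < n" and p: "p \<in> Tn e" and x: "x \<in> Tn n"
  shows "tens_ext (e + n) (e + i) phi (tens e p x) = tens e p (tens_ext n i phi x)"
proof (rule linear_on_ext_Tn[OF _ _ _ x])
  show "linear_on (len n) (\<lambda>x. tens_ext (e + n) (e + i) phi (tens e p x))"
    by (intro linear_on_intros linear_on_tens_ext[where n' = "e + n"]) (use p in \<open>simp add: Tn_eq_fs[symmetric]\<close>)
  show "linear_on (len n) (\<lambda>x. tens e p (tens_ext n i phi x))"
    by (intro linear_on_intros linear_on_tens_ext')
  fix l :: "'i list" assume l: "length l = n"
  obtain a b where ab: "i = Suc a" "n = a + (2 + b)" using i by (rule pos_split)
  obtain p' c q where pq: "length p' = a" "length c = 2" "length q = b"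
    and d: "(delta l :: 'i list \<Rightarrow> 'k) = tens a (delta p') (tens 2 (delta c) (delta q))"
    using l[unfolded ab] by (rule split_delta)
  have eq: "e + (a + (2 + b)) = (e + a) + (2 + b)" "e + Suc a = Suc (e + a)" by simp_all
  have "tens_ext ((e + a) + (2 + b)) (Suc (e + a)) phi (tens (e + a) (tens e p (delta p')) (tens 2 (delta c) (delta q)))
    = tens (e + a) (tens e p (delta p')) (tens 2 (phi (delta c)) (delta q))"
    using pq p by (intro tens_ext_mid[OF phi]) auto
  then show "tens_ext (e + n) (e + i) phi (tens e p (delta l)) = tens e p (tens_ext n i phi (delta l))"
    using pq unfolding d ab eq tens_assoc by (subst tens_ext_mid[OF phi]) auto
qed

lemma tens_ext_right:
  fixes phi :: "('i list \<Rightarrow> 'k::comm_ring_1) \<Rightarrow> 'i list \<Rightarrow> 'k"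
  assumes phi: "klin 2 phi" and i: "1 \<le> i" "i < n" and p: "p \<in> Tn e" and x: "x \<in> Tn n"
  shows "tens_ext (n + e) i phi (tens n x p) = tens n (tens_ext n i phi x) p"
proof (rule linear_on_ext_Tn[OF _ _ _ x])
  show "linear_on (len n) (\<lambda>x. tens_ext (n + e) i phi (tens n x p))"
    by (intro linear_on_intros linear_on_tens_ext[where n' = "n + e"]) (use p in \<open>simp add: Tn_eq_fs[symmetric]\<close>)
  show "linear_on (len n) (\<lambda>x. tens n (tens_ext n i phi x) p)"
    by (intro linear_on_intros linear_on_tens_ext')
  fix l :: "'i list" assume l: "length l = n"
  obtain a b where ab: "i = Suc a" "n = a + (2 + b)" using i by (rule pos_split)
  obtain p' c q where pq: "length p' = a" "length c = 2" "length q = b"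
    and d: "(delta l :: 'i list \<Rightarrow> 'k) = tens a (delta p') (tens 2 (delta c) (delta q))"
    using l[unfolded ab] by (rule split_delta)
  have eq: "(a + (2 + b)) + e = a + (2 + (b + e))" by simp
  have "tens_ext (a + (2 + (b + e))) (Suc a) phi (tens a (delta p') (tens 2 (delta c) (tens b (delta q) p)))
    = tens a (delta p') (tens 2 (phi (delta c)) (tens b (delta q) p))"
    using pq p by (intro tens_ext_mid[OF phi]) auto
  then show "tens_ext (n + e) i phi (tens n (delta l) p) = tens n (tens_ext n i phi (delta l)) p"
    using pq unfolding d ab eq by (subst tens_ext_mid[OF phi]) (auto simp: eq[symmetric] tens_assoc)
qed

lemma tplace_mid:
  assumes Z: "Z \<in> Tn 2"
  shows "tplace u (a + (2 + b)) (Suc a) Z = tens a (tone u a) (tens 2 Z (tone u b))"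
proof
  fix v :: "'a list"
  show "tplace u (a + (2 + b)) (Suc a) Z v = tens a (tone u a) (tens 2 Z (tone u b)) v"
  proof (cases "length v = a + (2 + b)")
    case True
    then obtain p' c' q' where v: "v = p' @ c' @ q'" "length p' = a" "length c' = 2" "length q' = b"
      by (rule split_mid)
    obtain x' y' where c': "c' = [x', y']" using v by (auto simp: length_2_conv)
    have split: "{..<a + (2 + b)} - {a, Suc a} = {..<a} \<union> (\<lambda>t. a + (2 + t)) ` {..<b}"
    proof (intro equalityI subsetI)
      fix t assume "t \<in> {..<a + (2 + b)} - {a, Suc a}"
      then show "t \<in> {..<a} \<union> (\<lambda>t. a + (2 + t)) ` {..<b}"
        by (cases "t < a") (auto intro!: image_eqI[of _ _ "t - a - 2"])
    qed auto
    have "(\<Prod>t\<in>{..<a + (2 + b)} - {a, Suc a}. u (v!t)) = (\<Prod>t<a. u (v!t)) * (\<Prod>t<b. u (v!(a + (2 + t))))"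
      unfolding split by (subst prod.union_disjoint) (auto simp: prod.reindex inj_on_def)
    also have "\<dots> = (\<Prod>t<a. u (p'!t)) * (\<Prod>t<b. u (q'!t))"
      using v by (auto simp: nth_append intro!: arg_cong2[where f = "(*)"] prod.cong)
    finally show ?thesis using v c' True
      by (simp add: tplace_def tens_def tone_def nth_append mult_ac numeral_2_eq_2)
  next
    case False
    \<comment> \<open>A list of the wrong total length has a block of the wrong length, and the
      corresponding tensor factor vanishes there.\<close>
    then have "length (take a v) \<noteq> a \<or> length (take 2 (drop a v)) \<noteq> 2 \<or> length (drop 2 (drop a v)) \<noteq> b"
      by auto
    moreover have "Z (take 2 (drop a v)) = 0" if "length (take 2 (drop a v)) \<noteq> 2"
      using Z that by (auto simp: Tn_def simp del: length_take)
    ultimately have "tens a (tone u a) (tens 2 Z (tone u b)) v = 0"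
      by (elim disjE) (simp_all add: tens_def tone_def del: length_take length_drop)
    then show ?thesis using False by (simp add: tplace_def)
  qed
qed

context balg begin

lemma tplace_closed [simp]:
  assumes "1 \<le> i" "i < n" "Z \<in> Tn 2" shows "tplace u n i Z \<in> Tn n"
proof -
  obtain a b where ab: "i = Suc a" "n = a + (2 + b)" using assms(1,2) by (rule pos_split)
  show ?thesis using assms unfolding ab by (simp add: tplace_mid)
qed

lemma tplace_left:
  assumes "1 \<le> i" "i < n" "Z \<in> Tn 2"
  shows "tplace u (e + n) (e + i) Z = tens e (tone u e) (tplace u n i Z)"
proof -
  obtain a b where ab: "i = Suc a" "n = a + (2 + b)" using assms(1,2) by (rule pos_split)
  have eq: "e + (a + (2 + b)) = (e + a) + (2 + b)" "e + Suc a = Suc (e + a)" by simp_all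
  show ?thesis unfolding ab eq tplace_mid[OF assms(3)] tone_add tens_assoc ..
qed

lemma tplace_right:
  assumes "1 \<le> i" "i < n" "Z \<in> Tn 2"
  shows "tplace u (n + e) i Z = tens n (tplace u n i Z) (tone u e)"
proof -
  obtain a b where ab: "i = Suc a" "n = a + (2 + b)" using assms(1,2) by (rule pos_split)
  have eq: "(a + (2 + b)) + e = a + (2 + (b + e))" by simp
  show ?thesis unfolding ab eq tplace_mid[OF assms(3)] tone_add
    unfolding tens_assoc unfolding eq[symmetric] by (simp only: tens_assoc)
qed

end

section \<open>Transport of the conditions along tensor blocks\<close>

lemma tens_nil_left: "tens 0 (delta []) x = (x :: 'i list \<Rightarrow> 'k::comm_ring_1)"
  by (simp add: tens_def delta_apply)

lemma tens_nil_right: 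
  assumes "x \<in> Tn n" shows "tens n x (delta []) = (x :: 'i list \<Rightarrow> 'k::comm_ring_1)"
proof
  fix v show "tens n x (delta []) v = x v"
    using assms by (cases "length v \<le> n") (auto simp: tens_def delta_apply Tn_def)
qed

lemma tens_ext_2_1:
  assumes "klin 2 phi" "x \<in> Tn 2"
  shows "tens_ext 2 1 phi x = phi (x :: 'i list \<Rightarrow> 'k::comm_ring_1)"
  using tens_ext_mid[OF assms(1) _ assms(2), of "delta []" 0 "delta []" 0] assms klin_closed[OF assms]
  by (simp add: tens_nil_left tens_nil_right)

lemma tplace_2_1:
  assumes "Z \<in> Tn 2" shows "tplace u 2 1 Z = Z"
  using tplace_mid[OF assms, of u 0 0] assms by (simp add: tone_0 tens_nil_left tens_nil_right)

lemma tens_add_left: "tens a (x + x') y = tens a x y + tens a x' y"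
  by (auto simp: tens_def fun_eq_iff algebra_simps)

lemma tens_add_right: "tens a x (y + y') = tens a x y + tens a x y'"
  by (auto simp: tens_def fun_eq_iff algebra_simps)

lemma block_ext:
  fixes g h :: "('i list \<Rightarrow> 'k::comm_ring_1) \<Rightarrow> 'i list \<Rightarrow> 'k"
  assumes "linear_on (len (e + (k + b))) g" "linear_on (len (e + (k + b))) h"
    and gh: "\<And>p c q. p \<in> Tn e \<Longrightarrow> c \<in> Tn k \<Longrightarrow> q \<in> Tn b \<Longrightarrow>
      g (tens e p (tens k c q)) = h (tens e p (tens k c q))"
    and x: "x \<in> Tn (e + (k + b))"
  shows "g x = h x"
proof (rule linear_on_ext_Tn[OF assms(1,2) _ x])
  fix l :: "'i list" assume "length l = e + (k + b)"
  then obtain p c q where l: "l = p @ c @ q" "length p = e" "length c = k" "length q = b"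
    by (rule split_mid)
  have "(delta l :: 'i list \<Rightarrow> 'k) = tens e (delta p) (tens k (delta c) (delta q))"
    using l by (simp add: tens_delta)
  then show "g (delta l) = h (delta l)" using gh l by simp
qed

locale qw = balg m u for m :: "'i \<Rightarrow> 'i \<Rightarrow> 'i \<Rightarrow> 'k::comm_ring_1" and u :: "'i \<Rightarrow> 'k" +
  fixes R S :: "'i list \<Rightarrow> 'k" and rho sigma :: "('i list \<Rightarrow> 'k) \<Rightarrow> ('i list \<Rightarrow> 'k)"
  assumes RS [simp]: "R \<in> Tn 2" "S \<in> Tn 2"
    and klin [simp]: "klin 2 rho" "klin 2 sigma"
begin

abbreviation "sg n i \<equiv> tens_ext n i sigma"
abbreviation "rh n i \<equiv> tens_ext n i rho"
abbreviation "SS n i \<equiv> tplace u n i S"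
abbreviation "RR n i \<equiv> tplace u n i R"

text \<open>(C1)--(C4) restated at the positions \<open>i\<close>, \<open>i + 1\<close> of
  \<open>n\<close> factors. For \<open>n = 2\<close> these are the given conditions; the module
  needs them for \<open>n = d\<close>.\<close>

definition local_conds :: "nat \<Rightarrow> nat \<Rightarrow> bool" where
  "local_conds n i \<longleftrightarrow>
     (sg n i (tone u n) = tone u n \<and> rh n i (tone u n) = 0) \<and>
     (\<forall>a\<in>Tn n. \<forall>b\<in>Tn n.
        sg n i (tmul m n a b) = tmul m n (sg n i a) (sg n i b) \<and>
        rh n i (tmul m n a b) = tmul m n (sg n i a) (rh n i b) + tmul m n (rh n i a) b) \<and>
     (tmul m n (sg n i (SS n i)) (SS n i) + rh n i (SS n i) + sg n i (RR n i) = tmul m n (SS n i) (SS n i) + RR n i \<and>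
      rh n i (RR n i) + tmul m n (sg n i (SS n i)) (RR n i) = tmul m n (SS n i) (RR n i)) \<and>
     (\<forall>x\<in>Tn n.
        tmul m n (sg n i (sg n i x)) (SS n i) + rh n i (sg n i x) + sg n i (rh n i x) = tmul m n (SS n i) (sg n i x) \<and>
        tmul m n (sg n i (sg n i x)) (RR n i) + rh n i (rh n i x) = tmul m n (SS n i) (rh n i x) + tmul m n (RR n i) x)"

text \<open>(C5)--(C9) for one ordered pair of positions among \<open>n\<close> factors. The given
  conditions are the two orders of 1 and 2 for \<open>n = 3\<close>.\<close>

definition braid_conds :: "nat \<Rightarrow> nat \<Rightarrow> nat \<Rightarrow> bool" where
  "braid_conds n i j \<longleftrightarrow>
     (\<forall>x\<in>Tn n. sg n i (sg n j (sg n i x)) = sg n j (sg n i (sg n j x)) \<and>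
        rh n i (sg n j (sg n i x)) = sg n j (sg n i (rh n j x))) \<and>
     (\<forall>x\<in>Tn n. rh n i (sg n j (rh n i x))
        = tmul m n (sg n j (rh n i (sg n j x))) (SS n j) + rh n j (rh n i (sg n j x)) + sg n j (rh n i (rh n j x))) \<and>
     (\<forall>x\<in>Tn n. rh n i (rh n j (rh n i x)) + tmul m n (sg n i (rh n j (sg n i x))) (RR n i)
        = rh n j (rh n i (rh n j x)) + tmul m n (sg n j (rh n i (sg n j x))) (RR n j)) \<and>
     (SS n i = sg n j (sg n i (SS n j)) \<and> RR n i = sg n j (sg n i (RR n j)) \<and>
        rh n j (sg n i (SS n j)) = 0 \<and> rh n j (sg n i (RR n j)) = 0) \<and>
     (tmul m n (sg n j (rh n i (SS n j))) (SS n j) + rh n j (rh n i (SS n j)) + sg n j (rh n i (RR n j)) = 0 \<and>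
        rh n j (rh n i (RR n j)) + tmul m n (sg n j (rh n i (SS n j))) (RR n j) = 0)"

lemma local_conds_2: "local_conds 2 1 \<longleftrightarrow> cond_C1_C4 m u R S rho sigma"
  unfolding local_conds_def cond_C1_C4_def
  by (simp add: tens_ext_2_1 tplace_2_1 klin_closed klin_closed[OF klin(1)] klin_closed[OF klin(2)] del: One_nat_def)

lemma braid_conds_3: "braid_conds 3 1 2 \<and> braid_conds 3 2 1 \<longleftrightarrow> cond_C5_C9 m u R S rho sigma"
  unfolding braid_conds_def cond_C5_C9_def Let_def by simp

context
  fixes e k b n :: nat
  assumes n: "n = e + (k + b)"
begin

definition "blk p x q = tens e p (tens k x q)"

lemma blk_closed [simp]: "p \<in> Tn e \<Longrightarrow> x \<in> Tn k \<Longrightarrow> q \<in> Tn b \<Longrightarrow> blk p x q \<in> Tn n"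
  by (simp add: blk_def n)

lemma blk_ext [simp]:
  "klin 2 phi \<Longrightarrow> 1 \<le> i \<Longrightarrow> i < k \<Longrightarrow> p \<in> Tn e \<Longrightarrow> x \<in> Tn k \<Longrightarrow> q \<in> Tn b \<Longrightarrow>
   tens_ext n (e + i) phi (blk p x q) = blk p (tens_ext k i phi x) q"
  unfolding blk_def n by (simp add: tens_ext_left tens_ext_right)

lemma blk_place:
  "1 \<le> i \<Longrightarrow> i < k \<Longrightarrow> Z \<in> Tn 2 \<Longrightarrow> tplace u n (e + i) Z = blk (tone u e) (tplace u k i Z) (tone u b)"
  unfolding blk_def n by (simp add: tplace_left tplace_right)

lemma blk_mul [simp]:
  "p \<in> Tn e \<Longrightarrow> x \<in> Tn k \<Longrightarrow> q \<in> Tn b \<Longrightarrow> p' \<in> Tn e \<Longrightarrow> x' \<in> Tn k \<Longrightarrow> q' \<in> Tn b \<Longrightarrow>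
   tmul m n (blk p x q) (blk p' x' q') = blk (tmul m e p p') (tmul m k x x') (tmul m b q q')"
  unfolding blk_def n by (simp add: tmul_tens)

lemma blk_tone: "tone u n = blk (tone u e) (tone u k) (tone u b)"
  unfolding blk_def n by (simp add: tone_add)

lemma blk_add: "blk p (x + y) q = blk p x q + blk p y q"
  unfolding blk_def by (simp add: tens_add_left tens_add_right)

lemma blk_zero [simp]: "blk p 0 q = 0"
  unfolding blk_def by simp

text \<open>The coefficients of the unit are arbitrary, so \<open>x\<close> cannot be read off
  directly. Multiplication by a block with outer parts \<open>delta p\<close> and
  \<open>delta q\<close> replaces the outer units by basis lists, whose coefficient is 1.\<close>

lemma blk_inj:
  assumes "x \<in> Tn k" "y \<in> Tn k"
  shows "blk (tone u e) x (tone u b) = blk (tone u e) y (tone u b) \<longleftrightarrow> x = y"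
proof
  assume eq: "blk (tone u e) x (tone u b) = blk (tone u e) y (tone u b)"
  \<comment> \<open>Any lists of these lengths would serve.\<close>
  define p q :: "'i list" where "p = replicate e undefined" and "q = replicate b undefined"
  have pq: "length p = e" "length q = b" by (simp_all add: p_def q_def)
  have *: "blk (delta p) x (delta q) = blk (delta p) y (delta q)"
    using arg_cong[OF eq, of "tmul m n (blk (delta p) (tone u k) (delta q))"] pq assms by simp
  show "x = y"
  proof
    fix v show "x v = y v"
    proof (cases "length v = k")
      case True
      then show ?thesis using fun_cong[OF *, of "p @ v @ q"] pq by (simp add: blk_def tens_def delta_apply)
    next
      case False
      then have "x v = 0" "y v = 0" using assms by (auto simp: Tn_def)
      then show ?thesis by simp
    qed
  qed
qed simp

lemma blk_inj_0:
  assumes "x \<in> Tn k" shows "blk (tone u e) x (tone u b) = 0 \<longleftrightarrow> x = 0"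
  using blk_inj[OF assms, of 0] by simp

lemma linear_on_tens_ext_Tn:
  "linear_on A g \<Longrightarrow> (\<And>x. x \<in> fs A \<Longrightarrow> g x \<in> Tn n) \<Longrightarrow> linear_on A (\<lambda>x. tens_ext n i phi (g x))"
  by (rule linear_on_tens_ext)

text \<open>From \<open>k\<close> to \<open>n\<close> factors, because pure tensors span; from
  \<open>n\<close> to \<open>k\<close>, because \<open>x\<close> can be padded with units, which
  \<open>blk_inj\<close> cancels.\<close>

lemma blk_all_iff:
  fixes g h g' h' :: "('i list \<Rightarrow> 'k) \<Rightarrow> 'i list \<Rightarrow> 'k"
  assumes "linear_on (len n) g" "linear_on (len n) h"
    and "\<And>p x q. p \<in> Tn e \<Longrightarrow> x \<in> Tn k \<Longrightarrow> q \<in> Tn b \<Longrightarrow> g (blk p x q) = blk p (g' x) q"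
    and "\<And>p x q. p \<in> Tn e \<Longrightarrow> x \<in> Tn k \<Longrightarrow> q \<in> Tn b \<Longrightarrow> h (blk p x q) = blk p (h' x) q"
    and "\<And>x. x \<in> Tn k \<Longrightarrow> g' x \<in> Tn k" "\<And>x. x \<in> Tn k \<Longrightarrow> h' x \<in> Tn k"
  shows "(\<forall>x\<in>Tn n. g x = h x) \<longleftrightarrow> (\<forall>x\<in>Tn k. g' x = h' x)"
proof
  assume L: "\<forall>x\<in>Tn n. g x = h x"
  show "\<forall>x\<in>Tn k. g' x = h' x"
  proof
    fix x :: "'i list \<Rightarrow> 'k" assume x: "x \<in> Tn k"
    then have "g (blk (tone u e) x (tone u b)) = h (blk (tone u e) x (tone u b))" using L by simp
    then show "g' x = h' x" using assms(3-6) x blk_inj by simp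
  qed
next
  assume R: "\<forall>x\<in>Tn k. g' x = h' x"
  show "\<forall>x\<in>Tn n. g x = h x"
  proof
    fix x :: "'i list \<Rightarrow> 'k" assume x: "x \<in> Tn n"
    show "g x = h x"
      using block_ext[OF assms(1,2)[unfolded n] _ x[unfolded n]] assms(3,4) R by (simp add: blk_def)
  qed
qed

lemmas lin_rules = linear_on_id linear_on_plus linear_on_tmul_left linear_on_tmul_right linear_on_tens_ext_Tn

lemma local_conds_shift:
  assumes i: "1 \<le> i" "i < k"
  shows "local_conds n (e + i) \<longleftrightarrow> local_conds k i"
proof -
  have i': "1 \<le> e + i" "e + i < n" "Suc 0 \<le> e + i" "Suc 0 \<le> i" using i n by auto
  note [simp] = blk_place blk_tone i i' blk_inj blk_inj_0 
  have 1: "sg n (e + i) (tone u n) = tone u n \<longleftrightarrow> sg k i (tone u k) = tone u k"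
    "rh n (e + i) (tone u n) = 0 \<longleftrightarrow> rh k i (tone u k) = 0" by simp_all
  have 2: "tmul m n (sg n (e + i) (SS n (e + i))) (SS n (e + i)) + rh n (e + i) (SS n (e + i)) + sg n (e + i) (RR n (e + i))
      = tmul m n (SS n (e + i)) (SS n (e + i)) + RR n (e + i) \<longleftrightarrow>
      tmul m k (sg k i (SS k i)) (SS k i) + rh k i (SS k i) + sg k i (RR k i) = tmul m k (SS k i) (SS k i) + RR k i"
    "rh n (e + i) (RR n (e + i)) + tmul m n (sg n (e + i) (SS n (e + i))) (RR n (e + i)) = tmul m n (SS n (e + i)) (RR n (e + i)) \<longleftrightarrow>
      rh k i (RR k i) + tmul m k (sg k i (SS k i)) (RR k i) = tmul m k (SS k i) (RR k i)"
    by (simp_all add: blk_add[symmetric])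
  have 3: "(\<forall>x\<in>Tn n. tmul m n (sg n (e + i) (sg n (e + i) x)) (SS n (e + i)) + rh n (e + i) (sg n (e + i) x)
        + sg n (e + i) (rh n (e + i) x) = tmul m n (SS n (e + i)) (sg n (e + i) x)) \<longleftrightarrow>
      (\<forall>x\<in>Tn k. tmul m k (sg k i (sg k i x)) (SS k i) + rh k i (sg k i x) + sg k i (rh k i x) = tmul m k (SS k i) (sg k i x))"
    by (rule blk_all_iff; (intro lin_rules)?) (simp_all add: blk_add Tn_eq_fs[symmetric])
  have 4: "(\<forall>x\<in>Tn n. tmul m n (sg n (e + i) (sg n (e + i) x)) (RR n (e + i)) + rh n (e + i) (rh n (e + i) x)
        = tmul m n (SS n (e + i)) (rh n (e + i) x) + tmul m n (RR n (e + i)) x) \<longleftrightarrow>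
      (\<forall>x\<in>Tn k. tmul m k (sg k i (sg k i x)) (RR k i) + rh k i (rh k i x) = tmul m k (SS k i) (rh k i x) + tmul m k (RR k i) x)"
    by (rule blk_all_iff; (intro lin_rules)?) (simp_all add: blk_add Tn_eq_fs[symmetric])
  let ?P = "\<lambda>n i a b. sg n i (tmul m n a b) = tmul m n (sg n i a) (sg n i b) \<and>
        rh n i (tmul m n a b) = tmul m n (sg n i a) (rh n i b) + tmul m n (rh n i a) b"
  \<comment> \<open>(C2) is bilinear, so \<open>blk_all_iff\<close> does not cover it. Pure tensors
    are replaced by general elements in one argument and then in the other.\<close>
  have 5: "(\<forall>x\<in>Tn n. \<forall>y\<in>Tn n. ?P n (e + i) x y) \<longleftrightarrow> (\<forall>x\<in>Tn k. \<forall>y\<in>Tn k. ?P k i x y)"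
  proof
    assume L: "\<forall>x\<in>Tn n. \<forall>y\<in>Tn n. ?P n (e + i) x y"
    show "\<forall>x\<in>Tn k. \<forall>y\<in>Tn k. ?P k i x y"
    proof (intro ballI)
      fix x y :: "'i list \<Rightarrow> 'k" assume xy: "x \<in> Tn k" "y \<in> Tn k"
      then have "?P n (e + i) (blk (tone u e) x (tone u b)) (blk (tone u e) y (tone u b))"
        using L by (meson blk_closed tone_closed)
      then show "?P k i x y" using xy by (simp add: blk_add[symmetric])
    qed
  next
    assume Rt: "\<forall>x\<in>Tn k. \<forall>y\<in>Tn k. ?P k i x y"
    have b1: "sg n (e + i) (tmul m n x (blk p c q)) = tmul m n (sg n (e + i) x) (sg n (e + i) (blk p c q))"
      "rh n (e + i) (tmul m n x (blk p c q)) = tmul m n (sg n (e + i) x) (rh n (e + i) (blk p c q)) + tmul m n (rh n (e + i) x) (blk p c q)"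
      if x: "x \<in> Tn n" and pcq: "p \<in> Tn e" "c \<in> Tn k" "q \<in> Tn b" for x p c q
      by (rule block_ext[of e k b, folded n, folded blk_def, OF _ _ _ x]; (intro lin_rules)?;
         use pcq Rt in \<open>simp_all add: blk_add Tn_eq_fs[symmetric]\<close>)+
    have "sg n (e + i) (tmul m n x y) = tmul m n (sg n (e + i) x) (sg n (e + i) y)"
      "rh n (e + i) (tmul m n x y) = tmul m n (sg n (e + i) x) (rh n (e + i) y) + tmul m n (rh n (e + i) x) y"
      if x: "x \<in> Tn n" and y: "y \<in> Tn n" for x y
      by (rule block_ext[of e k b, folded n, folded blk_def, OF _ _ _ y]; (intro lin_rules b1 x)?;
         use x in \<open>simp_all add: Tn_eq_fs[symmetric]\<close>)+
    then show "\<forall>x\<in>Tn n. \<forall>y\<in>Tn n. ?P n (e + i) x y" by blast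
  qed
  show ?thesis using 1 2 3 4 5 unfolding local_conds_def by (simp only: ball_conj_distrib)
qed

lemma braid_conds_shift:
  assumes i: "1 \<le> i" "i < k" and j: "1 \<le> j" "j < k"
  shows "braid_conds n (e + i) (e + j) \<longleftrightarrow> braid_conds k i j"
proof -
  have i': "1 \<le> e + i" "e + i < n" "Suc 0 \<le> e + i" "Suc 0 \<le> i" using i n by auto
  have j': "1 \<le> e + j" "e + j < n" "Suc 0 \<le> e + j" "Suc 0 \<le> j" using j n by auto
  note [simp] = blk_place i i' j j' blk_inj blk_inj_0
  have 1: "(\<forall>x\<in>Tn n. sg n (e + i) (sg n (e + j) (sg n (e + i) x)) = sg n (e + j) (sg n (e + i) (sg n (e + j) x)))
      \<longleftrightarrow> (\<forall>x\<in>Tn k. sg k i (sg k j (sg k i x)) = sg k j (sg k i (sg k j x)))"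
    by (rule blk_all_iff; (intro lin_rules)?) (simp_all add: blk_add Tn_eq_fs[symmetric])
  have 2: "(\<forall>x\<in>Tn n. rh n (e + i) (sg n (e + j) (sg n (e + i) x)) = sg n (e + j) (sg n (e + i) (rh n (e + j) x)))
      \<longleftrightarrow> (\<forall>x\<in>Tn k. rh k i (sg k j (sg k i x)) = sg k j (sg k i (rh k j x)))"
    by (rule blk_all_iff; (intro lin_rules)?) (simp_all add: blk_add Tn_eq_fs[symmetric])
  have 3: "(\<forall>x\<in>Tn n. rh n (e + i) (sg n (e + j) (rh n (e + i) x))
        = tmul m n (sg n (e + j) (rh n (e + i) (sg n (e + j) x))) (SS n (e + j)) + rh n (e + j) (rh n (e + i) (sg n (e + j) x)) + sg n (e + j) (rh n (e + i) (rh n (e + j) x)))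
      \<longleftrightarrow> (\<forall>x\<in>Tn k. rh k i (sg k j (rh k i x))
        = tmul m k (sg k j (rh k i (sg k j x))) (SS k j) + rh k j (rh k i (sg k j x)) + sg k j (rh k i (rh k j x)))"
    by (rule blk_all_iff; (intro lin_rules)?) (simp_all add: blk_add Tn_eq_fs[symmetric])
  have 4: "(\<forall>x\<in>Tn n. rh n (e + i) (rh n (e + j) (rh n (e + i) x)) + tmul m n (sg n (e + i) (rh n (e + j) (sg n (e + i) x))) (RR n (e + i))
        = rh n (e + j) (rh n (e + i) (rh n (e + j) x)) + tmul m n (sg n (e + j) (rh n (e + i) (sg n (e + j) x))) (RR n (e + j)))
      \<longleftrightarrow> (\<forall>x\<in>Tn k. rh k i (rh k j (rh k i x)) + tmul m k (sg k i (rh k j (sg k i x))) (RR k i)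
        = rh k j (rh k i (rh k j x)) + tmul m k (sg k j (rh k i (sg k j x))) (RR k j))"
    by (rule blk_all_iff; (intro lin_rules)?) (simp_all add: blk_add Tn_eq_fs[symmetric])
  show ?thesis unfolding braid_conds_def ball_conj_distrib 1 2 3 4 by (simp add: blk_add[symmetric])
qed

end

end

section \<open>Reduced words in the symmetric group\<close>

declare One_nat_def [simp del]

abbreviation sp :: "nat \<Rightarrow> nat \<Rightarrow> nat" where
  "sp i \<equiv> Transposition.transpose i (Suc i)"

text \<open>Left descents: \<open>sp i \<circ> w\<close> is shorter than \<open>w\<close>.\<close>

definition desc :: "nat \<Rightarrow> (nat \<Rightarrow> nat) \<Rightarrow> bool" where
  "desc i w \<longleftrightarrow> inv w (Suc i) < inv w i"

lemma sp_sp [simp]: "sp i \<circ> (sp i \<circ> w) = w" "sp i (sp i a) = a"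
  by (simp_all add: fun_eq_iff)

lemma sp_braid: "sp i \<circ> (sp (Suc i) \<circ> (sp i \<circ> w)) = sp (Suc i) \<circ> (sp i \<circ> (sp (Suc i) \<circ> w))"
  by (auto simp: fun_eq_iff Transposition.transpose_def)

lemma sp_commute: "i + 2 \<le> j \<or> j + 2 \<le> i \<Longrightarrow> sp i \<circ> (sp j \<circ> w) = sp j \<circ> (sp i \<circ> w)"
  by (auto simp: fun_eq_iff Transposition.transpose_def)

context
  fixes d :: nat
begin

abbreviation perm :: "(nat \<Rightarrow> nat) \<Rightarrow> bool" where
  "perm w \<equiv> w permutes {1..d}"

definition inversions :: "(nat \<Rightarrow> nat) \<Rightarrow> (nat \<times> nat) set" where
  "inversions v = {(a, b). a \<in> {1..d} \<and> b \<in> {1..d} \<and> a < b \<and> v b < v a}"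

text \<open>The Coxeter length. Inversions are counted for \<open>inv w\<close> because multiplying
  \<open>w\<close> by \<open>sp i\<close> on the left exchanges two adjacent positions of
  \<open>inv w\<close>.\<close>

definition plen :: "(nat \<Rightarrow> nat) \<Rightarrow> nat" where
  "plen w = card (inversions (inv w))"

lemma perm_sp: "1 \<le> i \<Longrightarrow> i < d \<Longrightarrow> sp i permutes {1..d}"
  by (rule permutes_swap_id) auto

lemma perm_sp_comp [simp]: "1 \<le> i \<Longrightarrow> i < d \<Longrightarrow> perm w \<Longrightarrow> perm (sp i \<circ> w)"
  by (rule permutes_compose[OF _ perm_sp])

lemma perm_sp_iff: "1 \<le> i \<Longrightarrow> i < d \<Longrightarrow> perm (sp i \<circ> w) \<longleftrightarrow> perm w"
  by (metis perm_sp_comp sp_sp(1))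

lemma inv_sp_comp: 
  assumes "perm w" shows "inv (sp i \<circ> w) = inv w \<circ> sp i"
  using assms by (simp add: o_inv_distrib permutes_bij)

lemma inv_inj: "perm w \<Longrightarrow> inv w a = inv w b \<longleftrightarrow> a = b"
  by (metis permutes_inverses(1))

lemma desc_sp:
  assumes "perm w" shows "desc i (sp i \<circ> w) \<longleftrightarrow> \<not> desc i w"
proof -
  have "inv w i \<noteq> inv w (Suc i)" using inv_inj[OF assms] by simp
  then show ?thesis by (auto simp: desc_def inv_sp_comp[OF assms])
qed

lemma finite_inversions [simp]: "finite (inversions v)"
  by (rule finite_subset[of _ "{1..d} \<times> {1..d}"]) (auto simp: inversions_def)

text \<open>Applying \<open>sp i\<close> to both entries of a pair \<open>a < b\<close> keeps their
  order unless the pair is \<open>(i, Suc i)\<close>. So the old inversions correspond to the new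
  ones other than that pair, and the pair itself becomes an inversion.\<close>

lemma plen_up:
  assumes w: "perm w" and i: "1 \<le> i" "i < d" and nd: "\<not> desc i w"
  shows "plen (sp i \<circ> w) = Suc (plen w)"
proof -
  define v where "v = inv w"
  define f where "f = (\<lambda>(a, b). (sp i a, sp i b))"
  have lt: "v i < v (Suc i)"
    using nd inv_inj[OF w, of i "Suc i"] by (simp add: desc_def v_def)
  have spd: "sp i a \<in> {1..d} \<longleftrightarrow> a \<in> {1..d}" for a
    using i by (auto simp: Transposition.transpose_def)
  have mono: "sp i a < sp i b" if "a < b" "(a, b) \<noteq> (i, Suc i)" for a b
    using that by (auto simp: Transposition.transpose_def)
  have ff: "f (f p) = p" for p by (cases p) (simp add: f_def)
  have A: "f p \<in> inversions (v \<circ> sp i)" if p: "p \<in> inversions v" for p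
  proof -
    obtain a b where ab: "p = (a, b)" by (cases p)
    have "(a, b) \<noteq> (i, Suc i)" using p lt by (auto simp: inversions_def ab)
    then show ?thesis using p mono[of a b] spd by (auto simp: inversions_def ab f_def)
  qed
  have B: "f p \<in> inversions v" if p: "p \<in> inversions (v \<circ> sp i)" "p \<noteq> (i, Suc i)" for p
  proof -
    obtain a b where ab: "p = (a, b)" by (cases p)
    show ?thesis using p mono[of a b] spd by (auto simp: inversions_def ab f_def)
  qed
  have "inversions (v \<circ> sp i) = insert (i, Suc i) (f ` inversions v)"
  proof (intro equalityI subsetI)
    fix p assume p: "p \<in> inversions (v \<circ> sp i)"
    show "p \<in> insert (i, Suc i) (f ` inversions v)"
      using B[OF p] ff[of p] by (metis image_eqI insert_iff)
  next
    fix p assume "p \<in> insert (i, Suc i) (f ` inversions v)"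
    moreover have "(i, Suc i) \<in> inversions (v \<circ> sp i)"
      using i lt by (simp add: inversions_def)
    ultimately show "p \<in> inversions (v \<circ> sp i)"
      using A by blast
  qed
  moreover have "(i, Suc i) \<notin> f ` inversions v"
  proof
    assume "(i, Suc i) \<in> f ` inversions v"
    then have "f (i, Suc i) \<in> inversions v" by (metis ff imageE)
    then show False by (simp add: f_def inversions_def)
  qed
  moreover have "inj_on f (inversions v)" by (metis ff inj_onI)
  ultimately have "card (inversions (v \<circ> sp i)) = Suc (card (inversions v))"
    by (simp add: card_image)
  then show ?thesis by (simp add: plen_def inv_sp_comp[OF w] v_def)
qed

lemma plen_down:
  assumes "perm w" "1 \<le> i" "i < d" "desc i w"
  shows "plen w = Suc (plen (sp i \<circ> w))"
  using plen_up[of "sp i \<circ> w" i] assms by (simp add: desc_sp)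

lemma plen_id [simp]: "plen id = 0"
proof -
  have "inversions id = {}" by (auto simp: inversions_def)
  then show ?thesis by (simp add: plen_def)
qed

text \<open>Without descents \<open>inv w\<close> increases on \<open>{1..d}\<close>, so it moves no
  point downwards, and such a permutation is the identity.\<close>

lemma no_desc_id:
  assumes w: "perm w" and nd: "\<And>i. 1 \<le> i \<Longrightarrow> i < d \<Longrightarrow> \<not> desc i w"
  shows "w = id"
proof -
  have v: "inv w permutes {1..d}" using w by (rule permutes_inv)
  have "i \<le> inv w i" if "i \<in> {1..d}" for i
    using that
  proof (induction i)
    case (Suc i)
    show ?case
    proof (cases "i = 0")
      case True
      then show ?thesis using permutes_in_image[OF v, of 1] Suc by (auto simp: One_nat_def)
    next
      case False
      then have "inv w i < inv w (Suc i)"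
        using nd[of i] inv_inj[OF w, of i "Suc i"] Suc.prems by (simp add: desc_def)
      then show ?thesis using Suc False by simp
    qed
  qed simp
  then have "inv w = id" by (intro permutes_natset_ge[OF v]) auto
  then show ?thesis using w by (metis inv_id permutes_inv_inv)
qed

definition valid :: "nat list \<Rightarrow> bool" where
  "valid is \<longleftrightarrow> set is \<subseteq> {1..d-1}"

definition reduced :: "nat list \<Rightarrow> bool" where
  "reduced is \<longleftrightarrow> valid is \<and> length is = plen (sprod is)"

lemma sprod_simps [simp]: "sprod [] = id" "sprod (i # is) = sp i \<circ> sprod is"
  by (simp_all add: sprod_def)

lemma valid_simps [simp]: "valid []" "valid (i # is) \<longleftrightarrow> 1 \<le> i \<and> i < d \<and> valid is"
  by (auto simp: valid_def)

lemma perm_id [simp]: "perm id"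
  by (rule permutes_id)

lemma perm_sprod: "valid is \<Longrightarrow> perm (sprod is)"
  by (induction "is") auto

lemma plen_sprod: "valid is \<Longrightarrow> plen (sprod is) \<le> length is"
proof (induction "is")
  case (Cons i js)
  then show "plen (sprod (i # js)) \<le> length (i # js)" using plen_up[OF perm_sprod, of js i] plen_down[OF perm_sprod, of js i]
    by (cases "desc i (sprod js)") auto
qed simp

lemma reduced_Nil [simp]: "reduced []"
  by (simp add: reduced_def)

text \<open>A letter changes the length by one, while by \<open>plen_sprod\<close> the length never
  exceeds the number of letters. Equality for the longer word thus forces an ascent and equality for
  the shorter one.\<close>

lemma reduced_Cons:
  "reduced (i # is) \<longleftrightarrow> 1 \<le> i \<and> i < d \<and> reduced is \<and> \<not> desc i (sprod is)"
proof (cases "1 \<le> i \<and> i < d \<and> valid is")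
  case True
  then show ?thesis
    using plen_up[OF perm_sprod, of "is" i] plen_down[OF perm_sprod, of "is" i] plen_sprod[of "is"]
    by (cases "desc i (sprod is)") (auto simp: reduced_def)
qed (auto simp: reduced_def)

lemma reduced_exists: "perm w \<Longrightarrow> \<exists>is. reduced is \<and> sprod is = w"
proof (induction "plen w" arbitrary: w rule: less_induct)
  case less
  show ?case
  proof (cases "w = id")
    case True then show ?thesis by (intro exI[of _ "[]"]) simp
  next
    case False
    then obtain i where i: "1 \<le> i" "i < d" "desc i w" using no_desc_id less.prems by blast
    then obtain js where "reduced js" "sprod js = sp i \<circ> w"
      using less.hyps[of "sp i \<circ> w"] less.prems plen_down[of w i] by auto
    then show ?thesis using i less.prems
      by (intro exI[of _ "i # js"]) (simp add: reduced_Cons desc_sp)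
  qed
qed

lemma reduced_expr_iff:
  assumes w: "perm w" shows "reduced_expr d w is \<longleftrightarrow> reduced is \<and> sprod is = w"
proof
  assume r: "reduced_expr d w is"
  obtain js where js: "reduced js" "sprod js = w" using reduced_exists[OF w] by blast
  then have "length is \<le> length js" using r by (auto simp: reduced_expr_def reduced_def valid_def)
  then show "reduced is \<and> sprod is = w"
    using r js plen_sprod[of "is"] by (auto simp: reduced_expr_def reduced_def valid_def)
next
  assume r: "reduced is \<and> sprod is = w"
  have "length is \<le> length js" if "set js \<subseteq> {1..d-1}" "sprod js = w" for js
    using plen_sprod[of js] that r by (simp add: reduced_def valid_def)
  then show "reduced_expr d w is"
    using r by (simp add: reduced_expr_def reduced_def valid_def)
qed

lemma rexp: 
  assumes w: "perm w" shows "reduced (rexp d w)" "sprod (rexp d w) = w"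
proof -
  have "reduced_expr d w (rexp d w)"
    unfolding rexp_def by (rule someI_ex) (simp add: reduced_expr_iff[OF w] reduced_exists[OF w])
  then show "reduced (rexp d w)" "sprod (rexp d w) = w" by (simp_all add: reduced_expr_iff[OF w])
qed

text \<open>Matsumoto's theorem, for any equivalence \<open>Q\<close> that respects prefixing a
  letter and the two kinds of braid moves. If the words start with \<open>i\<close> and
  \<open>j\<close>, both letters are descents of the product, so it has reduced words starting with
  either form of the longest element of the subgroup generated by \<open>sp i\<close> and
  \<open>sp j\<close>. The induction hypothesis links each given word to one of these forms, and a
  braid move links the forms.\<close>

lemma reduced_unique_upto:
  fixes Q :: "nat list \<Rightarrow> nat list \<Rightarrow> bool"
  assumes refl: "\<And>xs. valid xs \<Longrightarrow> Q xs xs"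
    and sym: "\<And>xs ys. Q xs ys \<Longrightarrow> Q ys xs"
    and trans: "\<And>xs ys zs. Q xs ys \<Longrightarrow> Q ys zs \<Longrightarrow> Q xs zs"
    and cons: "\<And>i xs ys. 1 \<le> i \<Longrightarrow> i < d \<Longrightarrow> Q xs ys \<Longrightarrow> Q (i # xs) (i # ys)"
    and braid: "\<And>i xs. 1 \<le> i \<Longrightarrow> Suc i < d \<Longrightarrow> valid xs \<Longrightarrow>
      Q (i # Suc i # i # xs) (Suc i # i # Suc i # xs)"
    and far: "\<And>i j xs. 1 \<le> i \<Longrightarrow> i < d \<Longrightarrow> 1 \<le> j \<Longrightarrow> j < d \<Longrightarrow> i + 2 \<le> j \<or> j + 2 \<le> i \<Longrightarrow> valid xs \<Longrightarrow>
      Q (i # j # xs) (j # i # xs)"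
  shows "reduced xs \<Longrightarrow> reduced ys \<Longrightarrow> sprod xs = sprod ys \<Longrightarrow> Q xs ys"
proof (induction "length xs" arbitrary: xs ys rule: less_induct)
  case less
  have len: "length xs = length ys" using less.prems by (simp add: reduced_def)
  show ?case
  proof (cases xs)
    case Nil
    then show ?thesis using len refl[of "[]"] by simp
  next
    case xs: (Cons i xs')
    then obtain j ys' where ys: "ys = j # ys'" using len by (cases ys) auto
    let ?w = "sprod xs"
    have i: "1 \<le> i" "i < d" "reduced xs'" "\<not> desc i (sprod xs')" using less.prems(1) by (auto simp: xs reduced_Cons)
    have j: "1 \<le> j" "j < d" "reduced ys'" "\<not> desc j (sprod ys')" using less.prems(2) by (auto simp: ys reduced_Cons)
    have p: "perm (sprod xs')" "perm (sprod ys')" "perm ?w" 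
      using i j less.prems by (auto simp: reduced_def intro!: perm_sprod)
    have w1: "sprod xs' = sp i \<circ> ?w" by (simp add: xs)
    have w2: "sprod ys' = sp j \<circ> ?w" by (simp only: less.prems(3) ys sprod_simps sp_sp)
    have di1: "desc i ?w" using desc_sp[OF p(1), of i] i by (simp add: xs)
    have di2: "desc j ?w" using desc_sp[OF p(2), of j] j less.prems(3) by (simp add: ys)
    have IH: "Q xs' zs" if "reduced zs" "sprod zs = sprod xs'" for zs
      using less.hyps[of xs' zs] that i by (simp add: xs)
    have IH': "Q ys' zs" if "reduced zs" "sprod zs = sprod ys'" for zs
      using less.hyps[of ys' zs] that j len by (simp add: xs ys)
    consider "i = j" | "i + 2 \<le> j \<or> j + 2 \<le> i" | "j = Suc i" | "i = Suc j" by linarith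
    then show ?thesis
    proof cases
      case 1
      have "sprod ys' = sprod xs'" using w1 w2 1 by (simp only:)
      then show ?thesis using cons[OF i(1,2) IH[OF j(3)]] 1 by (simp add: xs ys)
    next
      case 2
      \<comment> \<open>What is left of the product once both commuting letters are removed.\<close>
      let ?z = "sp j \<circ> (sp i \<circ> ?w)"
      obtain zs where zs: "reduced zs" "sprod zs = ?z" using reduced_exists[of ?z] i j p by auto
      have pz: "perm (sp i \<circ> ?w)" "perm (sp j \<circ> ?w)" using i j p by auto
      have eq: "?z = sp i \<circ> (sp j \<circ> ?w)" by (rule sp_commute[OF 2, symmetric])
      have "desc j (sp i \<circ> ?w)" "desc i (sp j \<circ> ?w)"
        using di1 di2 2 p by (auto simp: desc_def inv_sp_comp Transposition.transpose_def)
      then have r: "reduced (j # zs)" "reduced (i # zs)"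
        using i j zs desc_sp[OF pz(1), of j] desc_sp[OF pz(2), of i] eq by (simp_all add: reduced_Cons)
      have "Q xs' (j # zs)" using IH r zs w1 w2 by simp
      then have "Q xs (i # j # zs)" using cons i xs by simp
      moreover have "Q (i # j # zs) (j # i # zs)" using far i j 2 zs by (simp add: reduced_def)
      moreover have "Q ys' (i # zs)" using IH' r zs w1 w2 eq by simp
      then have "Q ys (j # i # zs)" using cons j ys by simp
      ultimately show ?thesis by (rule trans[OF _ trans[OF _ sym]])
    next
      case 3
      \<comment> \<open>What is left of the product once the longest element, of length 3, is
        removed.\<close>
      let ?z = "sp i \<circ> (sp j \<circ> (sp i \<circ> ?w))"
      obtain zs where zs: "reduced zs" "sprod zs = ?z" using reduced_exists[of ?z] i j p by auto
      have pz: "perm (sp i \<circ> ?w)" "perm (sp j \<circ> ?w)" 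
        "perm (sp j \<circ> (sp i \<circ> ?w))" "perm (sp i \<circ> (sp j \<circ> ?w))" using i j p by auto
      have eq: "?z = sp j \<circ> (sp i \<circ> (sp j \<circ> ?w))" unfolding 3 by (rule sp_braid)
      have "desc j (sp i \<circ> ?w)" "desc i (sp j \<circ> ?w)" "desc i (sp j \<circ> (sp i \<circ> ?w))" "desc j (sp i \<circ> (sp j \<circ> ?w))"
        using di1 di2 3 p pz by (auto simp: desc_def inv_sp_comp Transposition.transpose_def)
      moreover have zi: "sp i \<circ> sprod zs = sp j \<circ> (sp i \<circ> ?w)"
        by (simp only: zs sp_sp)
      moreover have zj: "sp j \<circ> sprod zs = sp i \<circ> (sp j \<circ> ?w)"
        by (simp only: zs eq sp_sp)
      \<comment> \<open>Prefixing \<open>i\<close> or \<open>j\<close> to \<open>zs\<close> gives a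
        product that has this letter as a descent, so \<open>sprod zs\<close> itself does
        not.\<close>
      moreover have "\<not> desc i (sprod zs)" "\<not> desc j (sprod zs)"
        using calculation desc_sp[OF pz(3), of i] desc_sp[OF pz(4), of j] zs eq by (simp_all only: not_True_eq_False not_False_eq_True)
      ultimately have r: "reduced (i # zs)" "reduced (j # zs)" "reduced (j # i # zs)" "reduced (i # j # zs)"
        using i j zs(1) desc_sp[OF pz(1), of j] desc_sp[OF pz(2), of i] by (simp_all add: reduced_Cons)
      have "Q xs' (j # i # zs)" by (rule IH[OF r(3)]) (simp only: sprod_simps zi w1 sp_sp)
      then have "Q xs (i # j # i # zs)" using cons i xs by simp
      moreover have "Q (i # j # i # zs) (j # i # j # zs)" using braid[of i zs] i j 3 zs by (simp add: reduced_def)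
      moreover have "Q ys' (i # j # zs)" by (rule IH'[OF r(4)]) (simp only: sprod_simps zj w2 sp_sp)
      then have "Q ys (j # i # j # zs)" using cons j ys by simp
      ultimately show ?thesis by (rule trans[OF _ trans[OF _ sym]])
    next
      case 4
      let ?z = "sp j \<circ> (sp i \<circ> (sp j \<circ> ?w))"
      obtain zs where zs: "reduced zs" "sprod zs = ?z" using reduced_exists[of ?z] i j p by auto
      have pz: "perm (sp i \<circ> ?w)" "perm (sp j \<circ> ?w)" 
        "perm (sp j \<circ> (sp i \<circ> ?w))" "perm (sp i \<circ> (sp j \<circ> ?w))" using i j p by auto
      have eq: "?z = sp i \<circ> (sp j \<circ> (sp i \<circ> ?w))" unfolding 4 by (rule sp_braid)
      have "desc j (sp i \<circ> ?w)" "desc i (sp j \<circ> ?w)" "desc i (sp j \<circ> (sp i \<circ> ?w))" "desc j (sp i \<circ> (sp j \<circ> ?w))"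
        using di1 di2 4 p pz by (auto simp: desc_def inv_sp_comp Transposition.transpose_def)
      moreover have zi: "sp i \<circ> sprod zs = sp j \<circ> (sp i \<circ> ?w)"
        by (simp only: zs eq sp_sp)
      moreover have zj: "sp j \<circ> sprod zs = sp i \<circ> (sp j \<circ> ?w)"
        by (simp only: zs sp_sp)
      moreover have "\<not> desc i (sprod zs)" "\<not> desc j (sprod zs)"
        using calculation desc_sp[OF pz(3), of i] desc_sp[OF pz(4), of j] zs eq by (simp_all only: not_True_eq_False not_False_eq_True)
      ultimately have r: "reduced (i # zs)" "reduced (j # zs)" "reduced (j # i # zs)" "reduced (i # j # zs)"
        using i j zs(1) desc_sp[OF pz(1), of j] desc_sp[OF pz(2), of i] by (simp_all add: reduced_Cons)
      have "Q xs' (j # i # zs)" by (rule IH[OF r(3)]) (simp only: sprod_simps zi w1 sp_sp)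
      then have "Q xs (i # j # i # zs)" using cons i xs by simp
      moreover have "Q (i # j # i # zs) (j # i # j # zs)" using sym[OF braid[of j zs]] i j 4 zs by (simp add: reduced_def)
      moreover have "Q ys' (i # j # zs)" by (rule IH'[OF r(4)]) (simp only: sprod_simps zj w2 sp_sp)
      then have "Q ys (j # i # j # zs)" using cons j ys by simp
      ultimately show ?thesis by (rule trans[OF _ trans[OF _ sym]])
    qed
  qed
qed

end

section \<open>The free algebra and the defining ideal\<close>

lemma fmul_Nil: "fmul p q [] = p [] * q []"
  by (simp add: fmul_def)

lemma fmul_Cons: "fmul p q (x # w) = p [] * q (x # w) + fmul (\<lambda>v. p (x # v)) q w"
proof -
  have "{..length (x # w)} = insert 0 (Suc ` {..length w})"
    by (auto simp: atMost_Suc_eq_insert_0)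
  then show ?thesis by (simp add: fmul_def sum.reindex)
qed

lemma fmul_add_left: "fmul (p + p') q = fmul p q + fmul p' q"
  by (auto simp: fmul_def fun_eq_iff algebra_simps sum.distrib)

lemma fmul_add_right: "fmul p (q + q') = fmul p q + fmul p q'"
  by (auto simp: fmul_def fun_eq_iff algebra_simps sum.distrib)

lemma fmul_diff_left: "fmul (p - p') q = fmul p q - fmul p' q"
  by (auto simp: fmul_def fun_eq_iff algebra_simps sum_subtractf)

lemma fmul_diff_right: "fmul p (q - q') = fmul p q - fmul p q'"
  by (auto simp: fmul_def fun_eq_iff algebra_simps sum_subtractf)

lemma fmul_scal_left: "fmul (scal c p) q = scal c (fmul p q)"
  by (auto simp: fmul_def fun_eq_iff scal_apply algebra_simps sum_distrib_left)

lemma fmul_scal_right: "fmul p (scal c q) = scal c (fmul p q)"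
  by (auto simp: fmul_def fun_eq_iff scal_apply algebra_simps sum_distrib_left)

lemma fmul_zero [simp]: "fmul 0 q = 0" "fmul p 0 = 0"
  by (auto simp: fmul_def fun_eq_iff)

text \<open>Instead of exchanging double sums, the proof removes the first letter of
  \<open>w\<close>; the induction hypothesis is then applied to \<open>p\<close> shifted by that
  letter, whence the generalization over \<open>p\<close>.\<close>

lemma fmul_assoc: "fmul (fmul p q) r = fmul p (fmul q r)"
proof
  fix w show "fmul (fmul p q) r w = fmul p (fmul q r) w"
  proof (induction w arbitrary: p)
    case Nil
    show "fmul (fmul p q) r [] = fmul p (fmul q r) []" by (simp add: fmul_Nil mult.assoc)
  next
    case (Cons x w)
    have "(\<lambda>v. fmul p q (x # v)) = scal (p []) (\<lambda>v. q (x # v)) + fmul (\<lambda>v. p (x # v)) q"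
      by (auto simp: fmul_Cons scal_apply fun_eq_iff)
    then have "fmul (\<lambda>v. fmul p q (x # v)) r w
      = p [] * fmul (\<lambda>v. q (x # v)) r w + fmul (\<lambda>v. p (x # v)) (fmul q r) w"
      by (simp add: fmul_add_left fmul_scal_left scal_apply Cons.IH)
    then show "fmul (fmul p q) r (x # w) = fmul p (fmul q r) (x # w)"
      by (simp add: fmul_Cons fmul_Nil algebra_simps)
  qed
qed

lemma fmul_wd_left:
  "fmul (wd a) p w = (if take (length a) w = a then p (drop (length a) w) else (0::'k::comm_ring_1))"
proof -
  have "wd a (take k w) * p (drop k w)
      = (if k = length a then (if take (length a) w = a then p (drop (length a) w) else 0) else 0)"
    if "k \<le> length w" for k
    using that by (auto simp: wd_def delta_apply)
  then have "fmul (wd a) p w = (\<Sum>k\<le>length w. (if k = length a then (if take (length a) w = a then p (drop (length a) w) else 0) else 0))"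
    unfolding fmul_def by (intro sum.cong) auto
  then show ?thesis by (auto simp: sum.delta)
qed

lemma fmul_wd [simp]: "fmul (wd a) (wd b) = (wd (a @ b) :: 'g list \<Rightarrow> 'k::comm_ring_1)"
proof
  fix w
  have "w = a @ b \<longleftrightarrow> take (length a) w = a \<and> drop (length a) w = b"
    by (metis append_eq_conv_conj append_take_drop_id)
  then show "fmul (wd a) (wd b) w = (wd (a @ b) w :: 'k)"
    by (simp add: fmul_wd_left) (simp add: wd_def delta_apply)
qed

lemma fmul_1_left [simp]: "fmul (wd []) p = (p :: 'g list \<Rightarrow> 'k::comm_ring_1)"
  by (rule ext) (simp add: fmul_wd_left)

lemma fmul_1_right [simp]: "fmul p (wd []) = (p :: 'g list \<Rightarrow> 'k::comm_ring_1)"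
proof
  fix w
  have "fmul p (wd []) w = (\<Sum>k\<le>length w. if k = length w then p w else 0)"
    unfolding fmul_def by (intro sum.cong) (auto simp: wd_def delta_apply)
  then show "fmul p (wd []) w = p w" by (simp add: sum.delta)
qed

abbreviation words :: "nat \<Rightarrow> 'i gen list set" where
  "words d \<equiv> {w. \<forall>g\<in>set w. validg d g}"

lemma FA_eq_fs: "FA d = fs (words d)"
  by (auto simp: FA_def fs_def supp_def)

lemma wd_FA [simp]: "(wd w :: 'i gen list \<Rightarrow> 'k::comm_ring_1) \<in> FA d \<longleftrightarrow> (\<forall>g\<in>set w. validg d g)"
  by (simp add: FA_eq_fs wd_def)

lemma FA_simps [simp]:
  fixes p q :: "'i gen list \<Rightarrow> 'k::comm_ring_1"
  shows "0 \<in> FA d" "p \<in> FA d \<Longrightarrow> q \<in> FA d \<Longrightarrow> p + q \<in> FA d"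
    "p \<in> FA d \<Longrightarrow> q \<in> FA d \<Longrightarrow> p - q \<in> FA d" "p \<in> FA d \<Longrightarrow> scal c p \<in> FA d"
  by (simp_all add: FA_eq_fs)

lemma FA_sum: "(\<And>i. i \<in> I \<Longrightarrow> f i \<in> FA d) \<Longrightarrow> (\<Sum>i\<in>I. f i :: 'i gen list \<Rightarrow> 'k::comm_ring_1) \<in> FA d"
  by (simp add: FA_eq_fs)

lemma FA_induct [consumes 1, case_names zero add word]:
  fixes p :: "'i gen list \<Rightarrow> 'k::comm_ring_1"
  assumes "p \<in> FA d" "P 0"
    and "\<And>p q. p \<in> FA d \<Longrightarrow> q \<in> FA d \<Longrightarrow> P p \<Longrightarrow> P q \<Longrightarrow> P (p + q)"
    and "\<And>c w. \<forall>g\<in>set w. validg d g \<Longrightarrow> P (scal c (wd w))"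
  shows "P p"
  by (rule fs_induct[of p "words d" P]) (use assms in \<open>auto simp: FA_eq_fs wd_def\<close>)

lemma fmul_FA [simp]:
  fixes p q :: "'i gen list \<Rightarrow> 'k::comm_ring_1"
  assumes "p \<in> FA d" "q \<in> FA d" shows "fmul p q \<in> FA d"
  using assms(1)
proof (induction rule: FA_induct)
  case zero show "fmul 0 q \<in> FA d" by simp
next
  case (add p p')
  then show "fmul (p + p') q \<in> FA d" by (simp add: fmul_add_left)
next
  case (word c w)
  have "fmul (wd w) q \<in> FA d"
    using assms(2)
  proof (induction rule: FA_induct)
    case zero show "fmul (wd w) 0 \<in> FA d" by simp
  next
    case (add p p')
    then show "fmul (wd w) (p + p') \<in> FA d" by (simp add: fmul_add_right)
  next
    case (word c' w')
    with \<open>\<forall>g\<in>set w. validg d g\<close> have "(wd (w @ w') :: 'i gen list \<Rightarrow> 'k) \<in> FA d"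
      by auto
    then show "fmul (wd w) (scal c' (wd w')) \<in> FA d"
      by (simp only: fmul_scal_right fmul_wd FA_simps)
  qed
  then show "fmul (scal c (wd w)) q \<in> FA d" by (simp add: fmul_scal_left)
qed

lemma emb_simps [simp]:
  "emb x [GB l] = x l" "(\<nexists>l. w = [GB l]) \<Longrightarrow> emb x w = 0"
  by (auto simp: emb_def split: list.split gen.split)

lemma emb_ext:
  assumes "\<And>l. p [GB l] = x l" "\<And>w. (\<nexists>l. w = [GB l]) \<Longrightarrow> p w = 0"
  shows "emb x = p"
proof
  fix w show "emb x w = p w"
    by (cases "\<exists>l. w = [GB l]") (use assms in \<open>auto\<close>)
qed

lemma emb_delta: "emb (delta l) = (wd [GB l] :: 'i gen list \<Rightarrow> 'k::comm_ring_1)"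
  by (rule emb_ext) (auto simp: wd_def delta_apply)

lemma emb_zero [simp]: "emb 0 = (0 :: 'i gen list \<Rightarrow> 'k::comm_ring_1)"
  by (rule emb_ext) auto

lemma emb_add: "emb (x + y) = (emb x + emb y :: 'i gen list \<Rightarrow> 'k::comm_ring_1)"
  by (rule emb_ext) auto

lemma emb_scal: "emb (scal c x) = (scal c (emb x) :: 'i gen list \<Rightarrow> 'k::comm_ring_1)"
  by (rule emb_ext) (auto simp: scal_apply)

lemma emb_FA [simp]:
  fixes x :: "'i list \<Rightarrow> 'k::comm_ring_1"
  assumes "x \<in> Tn d" shows "emb x \<in> FA d"
  unfolding FA_eq_fs
proof (rule fs_subI)
  show "finite ((\<lambda>l. [GB l]) ` supp x)" using assms by (simp add: Tn_def)
  show "supp (emb x) \<subseteq> (\<lambda>l. [GB l]) ` supp x"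
  proof
    fix w assume "w \<in> supp (emb x)"
    then have "emb x w \<noteq> 0" by (simp add: supp_def)
    then obtain l where "w = [GB l]" using emb_simps(2)[of w x] by blast
    then show "w \<in> (\<lambda>l. [GB l]) ` supp x" using \<open>emb x w \<noteq> 0\<close> by (auto simp: supp_def)
  qed
  show "(\<lambda>l. [GB l]) ` supp x \<subseteq> words d" using assms by (auto simp: Tn_def supp_def validg_def)
qed

lemma Hg_FA [simp]: "1 \<le> i \<Longrightarrow> i < d \<Longrightarrow> (Hg i :: 'i gen list \<Rightarrow> 'k::comm_ring_1) \<in> FA d"
  by (simp add: Hg_def validg_def)

definition hword :: "nat list \<Rightarrow> 'i gen list \<Rightarrow> 'k::comm_ring_1" where
  "hword is = wd (map GH is)"

lemma hword_Nil: "hword [] = wd []"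
  by (simp add: hword_def)

lemma hword_Cons: "hword (i # is) = fmul (Hg i) (hword is)"
  by (simp add: hword_def Hg_def)

lemma hword_FA [simp]: "valid d is \<Longrightarrow> (hword is :: 'i gen list \<Rightarrow> 'k::comm_ring_1) \<in> FA d"
  by (auto simp: hword_def valid_def validg_def)

locale qwd = qw m u R S rho sigma
  for m :: "'i \<Rightarrow> 'i \<Rightarrow> 'i \<Rightarrow> 'k::comm_ring_1" and u R S rho sigma +
  fixes d :: nat
  assumes d2: "2 \<le> d"
begin

abbreviation "J \<equiv> wideal d (wrels m u d R S rho sigma)"

abbreviation "mul \<equiv> tmul m d"
abbreviation "\<sigma> \<equiv> sg d"
abbreviation "\<rho> \<equiv> rh d"
abbreviation "Sp \<equiv> SS d"
abbreviation "Rp \<equiv> RR d"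

abbreviation pos :: "nat \<Rightarrow> bool" where
  "pos i \<equiv> 1 \<le> i \<and> i < d"

definition cong :: "('i gen list \<Rightarrow> 'k) \<Rightarrow> ('i gen list \<Rightarrow> 'k) \<Rightarrow> bool" where
  "cong p q \<longleftrightarrow> p - q \<in> J"

lemma J_minus: "p \<in> J \<Longrightarrow> - p \<in> J"
  using wideal.scal[of p _ _ "-1"] by (simp add: scal_m1)

lemma J_diff: "p \<in> J \<Longrightarrow> q \<in> J \<Longrightarrow> p - q \<in> J"
  using wideal.add[of p _ _ "- q"] J_minus by simp

lemma J_sum: "(\<And>i. i \<in> I \<Longrightarrow> f i \<in> J) \<Longrightarrow> (\<Sum>i\<in>I. f i) \<in> J"
proof (induction I rule: infinite_finite_induct)
  case (insert i I)
  then have "f i + (\<Sum>i\<in>I. f i) \<in> J" by (intro wideal.add) auto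
  then show "(\<Sum>i\<in>insert i I. f i) \<in> J" using insert by simp
next
  case empty show "(\<Sum>i\<in>{}. f i) \<in> J" by (simp add: wideal.zero)
next
  case (infinite I) then show "(\<Sum>i\<in>I. f i) \<in> J" by (simp add: wideal.zero)
qed

text \<open>\<open>wideal\<close> is closed by definition under multiplication by words
  only.\<close>

lemma J_mul_left:
  assumes q: "q \<in> J" and p: "p \<in> FA d" shows "fmul p q \<in> J"
  using p
proof (induction rule: FA_induct)
  case zero show "fmul 0 q \<in> J" by (simp add: wideal.zero)
next
  case (add p p')
  then show "fmul (p + p') q \<in> J" by (simp add: fmul_add_left wideal.add)
next
  case (word c w)
  then show "fmul (scal c (wd w)) q \<in> J" using q by (simp add: fmul_scal_left wideal.scal wideal.lmul)
qed

lemma J_mul_right: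
  assumes q: "q \<in> J" and p: "p \<in> FA d" shows "fmul q p \<in> J"
  using p
proof (induction rule: FA_induct)
  case zero show "fmul q 0 \<in> J" by (simp add: wideal.zero)
next
  case (add p p')
  then show "fmul q (p + p') \<in> J" by (simp add: fmul_add_right wideal.add)
next
  case (word c w)
  then show "fmul q (scal c (wd w)) \<in> J" using q by (simp add: fmul_scal_right wideal.scal wideal.rmul)
qed

lemma cong_refl [simp]: "cong p p"
  by (simp add: cong_def wideal.zero)

lemma cong_sym: "cong p q \<Longrightarrow> cong q p"
  unfolding cong_def using J_minus[of "p - q"] by simp

lemma cong_trans [trans]: "cong p q \<Longrightarrow> cong q r \<Longrightarrow> cong p r"
  unfolding cong_def using wideal.add[of "p - q" d _ "q - r"] by simp

lemma cong_eq_trans [trans]: "p = q \<Longrightarrow> cong q r \<Longrightarrow> cong p r" "cong p q \<Longrightarrow> q = r \<Longrightarrow> cong p r"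
  by simp_all

lemma cong_add: "cong p q \<Longrightarrow> cong p' q' \<Longrightarrow> cong (p + p') (q + q')"
  unfolding cong_def using wideal.add[of "p - q" d _ "p' - q'"] by (simp add: algebra_simps)

lemma cong_scal: "cong p q \<Longrightarrow> cong (scal c p) (scal c q)"
  unfolding cong_def using wideal.scal[of "p - q" d _ c] by (simp add: scal_diff)

lemma cong_sum: "(\<And>i. i \<in> I \<Longrightarrow> cong (f i) (g i)) \<Longrightarrow> cong (\<Sum>i\<in>I. f i) (\<Sum>i\<in>I. g i)"
  unfolding cong_def sum_subtractf[symmetric] by (rule J_sum)

lemma cong_left: "cong p q \<Longrightarrow> r \<in> FA d \<Longrightarrow> cong (fmul r p) (fmul r q)"
  unfolding cong_def using J_mul_left[of "p - q" r] by (simp add: fmul_diff_right)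

lemma cong_right: "cong p q \<Longrightarrow> r \<in> FA d \<Longrightarrow> cong (fmul p r) (fmul q r)"
  unfolding cong_def using J_mul_right[of "p - q" r] by (simp add: fmul_diff_left)

lemma cong_one: "cong (emb (tone u d)) (wd [])"
  unfolding cong_def by (rule wideal.gen) (simp add: wrels_def)

lemma cong_emb_mul: "x \<in> Tn d \<Longrightarrow> y \<in> Tn d \<Longrightarrow> cong (fmul (emb x) (emb y)) (emb (mul x y))"
  unfolding cong_def by (rule wideal.gen) (auto simp: wrels_def)

lemma cong_braid:
  assumes "1 \<le> k" "Suc k < d"
  shows "cong (fmul (Hg k) (fmul (Hg (Suc k)) (Hg k))) (fmul (Hg (Suc k)) (fmul (Hg k) (Hg (Suc k))))"
proof -
  have "k \<le> d - 2" using assms by simp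
  then show ?thesis unfolding cong_def wrels_def Suc_eq_plus1 using assms by (intro wideal.gen) blast
qed

lemma cong_far:
  assumes "pos i" "pos j" "i + 2 \<le> j \<or> j + 2 \<le> i"
  shows "cong (fmul (Hg i) (Hg j)) (fmul (Hg j) (Hg i))"
proof -
  have "i \<le> d - 1" "j \<le> d - 1" using assms by auto
  then show ?thesis unfolding cong_def wrels_def using assms by (intro wideal.gen) blast
qed

lemma cong_quad:
  assumes "pos i"
  shows "cong (fmul (Hg i) (Hg i)) (fmul (emb (Sp i)) (Hg i) + emb (Rp i))"
proof -
  have "i \<le> d - 1" using assms by auto
  then have "fmul (Hg i) (Hg i) - fmul (emb (Sp i)) (Hg i) - emb (Rp i) \<in> J"
    using assms unfolding wrels_def by (intro wideal.gen) blast
  then show ?thesis by (simp add: cong_def algebra_simps)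
qed

lemma cong_wreath:
  assumes "pos i" "b \<in> Tn d"
  shows "cong (fmul (Hg i) (emb b)) (fmul (emb (\<sigma> i b)) (Hg i) + emb (\<rho> i b))"
proof -
  have "i \<le> d - 1" using assms by auto
  then have "fmul (Hg i) (emb b) - fmul (emb (\<sigma> i b)) (Hg i) - emb (\<rho> i b) \<in> J"
    using assms unfolding wrels_def by (intro wideal.gen) blast
  then show ?thesis by (simp add: cong_def algebra_simps)
qed

text \<open>Modulo the ideal the arbitrary choice made in \<open>rexp\<close> is immaterial, so
  \<open>Hg i\<close> can be absorbed into \<open>Hw d w\<close> at an ascent.\<close>

lemma hword_cong:
  assumes "reduced d xs" "reduced d ys" "sprod xs = sprod ys"
  shows "cong (hword xs) (hword ys)"
  using _ _ _ _ _ _ assms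
proof (rule reduced_unique_upto)
  show "cong (hword xs) (hword xs)" for xs by simp
  show "cong (hword xs) (hword ys) \<Longrightarrow> cong (hword ys) (hword xs)" for xs ys by (rule cong_sym)
  show "cong (hword xs) (hword ys) \<Longrightarrow> cong (hword ys) (hword zs) \<Longrightarrow> cong (hword xs) (hword zs)" for xs ys zs
    by (rule cong_trans)
  show "1 \<le> i \<Longrightarrow> i < d \<Longrightarrow> cong (hword xs) (hword ys) \<Longrightarrow> cong (hword (i # xs)) (hword (i # ys))" for i xs ys
    by (simp add: hword_Cons cong_left)
  show "1 \<le> i \<Longrightarrow> Suc i < d \<Longrightarrow> valid d xs \<Longrightarrow>
    cong (hword (i # Suc i # i # xs)) (hword (Suc i # i # Suc i # xs))" for i xs
    using cong_right[OF cong_braid, of i "hword xs"] by (simp add: hword_Cons fmul_assoc)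
  show "1 \<le> i \<Longrightarrow> i < d \<Longrightarrow> 1 \<le> j \<Longrightarrow> j < d \<Longrightarrow> i + 2 \<le> j \<or> j + 2 \<le> i \<Longrightarrow> valid d xs \<Longrightarrow>
    cong (hword (i # j # xs)) (hword (j # i # xs))" for i j xs
    using cong_right[OF cong_far, of i j "hword xs"] by (simp add: hword_Cons fmul_assoc)
qed

lemma Hw_hword: "Hw d w = hword (rexp d w)"
  by (simp add: Hw_def hword_def)

lemma Hw_FA [simp]: "perm d w \<Longrightarrow> (Hw d w :: 'i gen list \<Rightarrow> 'k) \<in> FA d"
  using rexp(1)[of w d] by (simp add: Hw_hword reduced_def)

lemma Hw_id: "Hw d id = (wd [] :: 'i gen list \<Rightarrow> 'k)"
  using rexp[of id d] by (simp add: Hw_hword reduced_def hword_Nil)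

lemma Hg_Hw_up:
  assumes "perm d w" "pos i" "\<not> desc i w"
  shows "cong (fmul (Hg i) (Hw d w)) (Hw d (sp i \<circ> w))"
  unfolding Hw_hword hword_Cons[symmetric]
  using assms rexp[of w d] rexp[of "sp i \<circ> w" d] by (intro hword_cong) (simp_all add: reduced_Cons)

text \<open>At a descent \<open>Hw d w\<close> is congruent to \<open>Hg i\<close> times a shorter
  element, which exposes the square of \<open>Hg i\<close>.\<close>

lemma Hg_Hw_down:
  assumes "perm d w" "pos i" "desc i w"
  shows "cong (fmul (Hg i) (Hw d w)) (fmul (emb (Sp i)) (Hw d w) + fmul (emb (Rp i)) (Hw d (sp i \<circ> w)))"
proof -
  let ?v = "sp i \<circ> w"
  have v: "perm d ?v" "\<not> desc i ?v" using assms by (simp_all add: desc_sp)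
  have cl: "(Hg i :: 'i gen list \<Rightarrow> 'k) \<in> FA d" "(Hw d ?v :: 'i gen list \<Rightarrow> 'k) \<in> FA d" "Sp i \<in> Tn d" "Rp i \<in> Tn d" using assms v by simp_all
  have w: "cong (Hw d w) (fmul (Hg i) (Hw d ?v))"
    using cong_sym[OF Hg_Hw_up[OF v(1) assms(2) v(2)]] by simp
  then have "cong (fmul (Hg i) (Hw d w)) (fmul (Hg i) (fmul (Hg i) (Hw d ?v)))"
    using cl by (intro cong_left) auto
  also have "\<dots> = fmul (fmul (Hg i) (Hg i)) (Hw d ?v)" by (simp add: fmul_assoc)
  also have "cong \<dots> (fmul (fmul (emb (Sp i)) (Hg i) + emb (Rp i)) (Hw d ?v))"
    using cl assms(2) by (intro cong_right cong_quad) auto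
  also have "\<dots> = fmul (emb (Sp i)) (fmul (Hg i) (Hw d ?v)) + fmul (emb (Rp i)) (Hw d ?v)"
    by (simp add: fmul_add_left fmul_assoc)
  also have "cong \<dots> (fmul (emb (Sp i)) (Hw d w) + fmul (emb (Rp i)) (Hw d ?v))"
    using cl cong_sym[OF w] by (intro cong_add cong_left) auto
  finally show ?thesis .
qed

end

section \<open>The module of normal forms\<close>

context qwd begin

text \<open>In particular \<open>local_conds\<close> does not depend on the position or on the
  number of factors: knowing it at one place gives it everywhere.\<close>

lemma cond_C1_C4_local:
  assumes "1 \<le> i" "i < n" shows "cond_C1_C4 m u R S rho sigma \<longleftrightarrow> local_conds n i"
proof -
  have "n = (i - 1) + (2 + (n - i - 1))" using assms by simp
  from local_conds_shift[OF this, of 1] assms show ?thesis by (simp add: local_conds_2)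
qed

lemma braid_conds_iff:
  assumes "1 \<le> i" "Suc i < n"
  shows "cond_C5_C9 m u R S rho sigma \<longleftrightarrow> braid_conds n i (Suc i) \<and> braid_conds n (Suc i) i"
proof -
  have n: "n = (i - 1) + (3 + (n - i - 2))" using assms by simp
  from braid_conds_shift[OF n, of 1 2] braid_conds_shift[OF n, of 2 1] assms
  show ?thesis by (simp add: braid_conds_3[symmetric])
qed

lemma ext_add [simp]: "x \<in> Tn d \<Longrightarrow> y \<in> Tn d \<Longrightarrow> tens_ext d i phi (x + y) = tens_ext d i phi x + tens_ext d i phi y"
  using linear_onD(1)[OF linear_on_tens_ext'[of "len d"]] by (simp add: Tn_eq_fs)

lemma ext_scal: "x \<in> Tn d \<Longrightarrow> tens_ext d i phi (scal c x) = scal c (tens_ext d i phi x)"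
  using linear_onD(2)[OF linear_on_tens_ext'[of "len d"]] by (simp add: Tn_eq_fs)

lemma ext_zero [simp]: "tens_ext d i phi 0 = 0"
  using linear_on_zero[OF linear_on_tens_ext'[of "len d"]] .

lemma ext_far_less:
  fixes phi psi :: "('i list \<Rightarrow> 'k) \<Rightarrow> 'i list \<Rightarrow> 'k"
  assumes "klin 2 phi" "klin 2 psi" "pos i" "pos j" "i + 2 \<le> j" "x \<in> Tn d"
  shows "tens_ext d i phi (tens_ext d j psi x) = tens_ext d j psi (tens_ext d i phi x)"
proof -
  \<comment> \<open>The cut after position \<open>i + 1\<close> puts the two operators into
    different blocks.\<close>
  define k n j' where "k = Suc i" and "n = d - k" and "j' = j - k"
  have eq: "d = k + n" "j = k + j'" and j': "1 \<le> j'" "j' < n" and i: "1 \<le> i" "i < k"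
    using assms by (auto simp: k_def n_def j'_def)
  have 1: "tens_ext (k + n) i phi (tens_ext (k + n) (k + j') psi (tens k p q))
      = tens_ext (k + n) (k + j') psi (tens_ext (k + n) i phi (tens k p q))"
    if "p \<in> Tn k" "q \<in> Tn n" for p q
    using that assms(1,2) i j' by (simp add: tens_ext_left tens_ext_right)
  have kj: "1 \<le> k + j'" "k + j' < k + n" using j' by auto
  show ?thesis
  proof (rule linear_on_ext_Tn[OF _ _ _ assms(6)])
    show "linear_on (len d) (\<lambda>x. tens_ext d i phi (tens_ext d j psi x))"
      "linear_on (len d) (\<lambda>x. tens_ext d j psi (tens_ext d i phi x))"
      using assms by (auto intro!: linear_on_tens_ext[where n' = d] linear_on_id simp: Tn_eq_fs[symmetric])
    fix l :: "'i list" assume l: "length l = d"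
    have "(delta l :: 'i list \<Rightarrow> 'k) = tens k (delta (take k l)) (delta (drop k l))"
      using l eq by (simp add: tens_delta)
    then show "tens_ext d i phi (tens_ext d j psi (delta l)) = tens_ext d j psi (tens_ext d i phi (delta l))"
      using l eq 1[of "delta (take k l)" "delta (drop k l)"] by simp
  qed
qed

lemma ext_far:
  fixes phi psi :: "('i list \<Rightarrow> 'k) \<Rightarrow> 'i list \<Rightarrow> 'k"
  assumes "klin 2 phi" "klin 2 psi" "pos i" "pos j" "i + 2 \<le> j \<or> j + 2 \<le> i" "x \<in> Tn d"
  shows "tens_ext d i phi (tens_ext d j psi x) = tens_ext d j psi (tens_ext d i phi x)"
  using assms ext_far_less[of phi psi i j x] ext_far_less[of psi phi j i x] by auto

text \<open>At the positions \<open>j\<close>, \<open>j + 1\<close> the placed element consists of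
  units, so (C1) decides.\<close>

lemma place_far:
  assumes C: "cond_C1_C4 m u R S rho sigma"
    and "pos i" "pos j" "i + 2 \<le> j \<or> j + 2 \<le> i" and Z: "Z \<in> Tn 2"
  shows "\<sigma> j (tplace u d i Z) = tplace u d i Z \<and> \<rho> j (tplace u d i Z) = 0"
proof (cases "i + 2 \<le> j")
  case True
  define k n j' where "k = Suc i" and "n = d - k" and "j' = j - k"
  have eq: "d = k + n" "j = k + j'" and j': "1 \<le> j'" "j' < n" and i: "1 \<le> i" "i < k"
    using assms True by (auto simp: k_def n_def j'_def)
  have "sg n j' (tone u n) = tone u n" "rh n j' (tone u n) = 0"
    using C j' unfolding cond_C1_C4_local[OF j'] local_conds_def by auto
  then show ?thesis unfolding eq tplace_right[OF i Z]
    using i j' Z by (simp add: tens_ext_left)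
next
  case False
  define k n i' where "k = Suc j" and "n = d - k" and "i' = i - k"
  have eq: "d = k + n" "i = k + i'" and i': "1 \<le> i'" "i' < n" and j: "1 \<le> j" "j < k"
    using assms False by (auto simp: k_def n_def i'_def)
  have "sg k j (tone u k) = tone u k" "rh k j (tone u k) = 0"
    using C j unfolding cond_C1_C4_local[OF j] local_conds_def by auto
  then show ?thesis unfolding eq tplace_left[OF i' Z]
    using i' j Z by (simp add: tens_ext_right)
qed

text \<open>The value 0 outside the symmetric group makes the coefficient family unique, so that
  equality in \<open>MM\<close> is equality of functions.\<close>

definition MM :: "((nat \<Rightarrow> nat) \<Rightarrow> 'i list \<Rightarrow> 'k) set" where
  "MM = {F. (\<forall>w. F w \<in> Tn d) \<and> (\<forall>w. \<not> perm d w \<longrightarrow> F w = 0)}"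

definition E :: "(nat \<Rightarrow> nat) \<Rightarrow> ('i list \<Rightarrow> 'k) \<Rightarrow> (nat \<Rightarrow> nat) \<Rightarrow> 'i list \<Rightarrow> 'k" where
  "E w x = (\<lambda>v. if v = w then x else 0)"

definition smul :: "('i list \<Rightarrow> 'k) \<Rightarrow> ((nat \<Rightarrow> nat) \<Rightarrow> 'i list \<Rightarrow> 'k) \<Rightarrow> (nat \<Rightarrow> nat) \<Rightarrow> 'i list \<Rightarrow> 'k" where
  "smul b F = (\<lambda>w. mul b (F w))"

text \<open>
  \<open>F\<close> stands for \<open>\<Sum>\<^sub>w F\<^sub>w H\<^sub>w\<close>.  The wreath relation turns \<open>H\<^sub>i F\<^sub>w H\<^sub>w\<close> into
  \<open>\<sigma>\<^sub>i(F\<^sub>w) H\<^sub>i H\<^sub>w + \<rho>\<^sub>i(F\<^sub>w) H\<^sub>w\<close>, and \<open>H\<^sub>i H\<^sub>w\<close> is \<open>H\<close> of \<open>sp i \<circ> w\<close> if \<open>w\<close> has no descent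
  at \<open>i\<close>, and is reduced by the quadratic relation otherwise.
\<close>

definition T :: "nat \<Rightarrow> ((nat \<Rightarrow> nat) \<Rightarrow> 'i list \<Rightarrow> 'k) \<Rightarrow> (nat \<Rightarrow> nat) \<Rightarrow> 'i list \<Rightarrow> 'k" where
  "T i F = (\<lambda>w. \<rho> i (F w) + (if desc i w then \<sigma> i (F (sp i \<circ> w)) + mul (\<sigma> i (F w)) (Sp i)
     else mul (\<sigma> i (F (sp i \<circ> w))) (Rp i)))"

lemma MM_D: "F \<in> MM \<Longrightarrow> F w \<in> Tn d" "F \<in> MM \<Longrightarrow> \<not> perm d w \<Longrightarrow> F w = 0"
  by (simp_all add: MM_def)

lemma MM_add [simp]: "F \<in> MM \<Longrightarrow> G \<in> MM \<Longrightarrow> F + G \<in> MM"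
  by (simp add: MM_def)

lemma MM_diff [simp]: "F \<in> MM \<Longrightarrow> G \<in> MM \<Longrightarrow> F - G \<in> MM"
  by (simp add: MM_def)

lemma MM_zero [simp]: "0 \<in> MM"
  by (simp add: MM_def)

lemma MM_sum [simp]: "(\<And>i. i \<in> I \<Longrightarrow> f i \<in> MM) \<Longrightarrow> (\<Sum>i\<in>I. f i) \<in> MM"
  by (induction I rule: infinite_finite_induct) (auto simp: MM_def sum_apply)

lemma E_MM [simp]: "perm d w \<Longrightarrow> x \<in> Tn d \<Longrightarrow> E w x \<in> MM"
  by (auto simp: MM_def E_def)

lemma smul_MM [simp]: "b \<in> Tn d \<Longrightarrow> F \<in> MM \<Longrightarrow> smul b F \<in> MM"
  by (simp add: MM_def smul_def)

lemma T_MM [simp]: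
  assumes "pos i" "F \<in> MM" shows "T i F \<in> MM"
proof -
  have "F (sp i \<circ> w) = 0" if "\<not> perm d w" for w
    using that assms perm_sp_iff[of i d w] by (simp add: MM_def)
  then show ?thesis using assms MM_D[OF assms(2)] by (auto simp: MM_def T_def)
qed

lemma T_add [simp]: "pos i \<Longrightarrow> F \<in> MM \<Longrightarrow> G \<in> MM \<Longrightarrow> T i (F + G) = T i F + T i G"
  by (rule ext) (simp add: T_def tmul_add_left MM_D(1) algebra_simps)

lemma smul_add_right [simp]: "F \<in> MM \<Longrightarrow> G \<in> MM \<Longrightarrow> smul b (F + G) = smul b F + smul b G"
  by (rule ext) (simp add: smul_def tmul_add_right MM_D(1))

lemma smul_add_left: "b \<in> Tn d \<Longrightarrow> c \<in> Tn d \<Longrightarrow> smul (b + c) F = smul b F + smul c F"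
  by (rule ext) (simp add: smul_def tmul_add_left)

lemma smul_smul [simp]: "a \<in> Tn d \<Longrightarrow> b \<in> Tn d \<Longrightarrow> F \<in> MM \<Longrightarrow> smul a (smul b F) = smul (mul a b) F"
  by (rule ext) (simp add: smul_def tmul_assoc MM_D(1))

lemma smul_zero [simp]: "smul 0 F = 0" "smul b 0 = 0"
  by (rule ext, simp add: smul_def)+

lemma smul_one [simp]: "F \<in> MM \<Longrightarrow> smul (tone u d) F = F"
  by (rule ext) (simp add: smul_def MM_D(1))

lemma T_zero [simp]: "T i 0 = 0"
  by (rule ext) (simp add: T_def)

lemma smul_E: "smul b (E w x) = E w (mul b x)"
  by (rule ext) (simp add: smul_def E_def)

lemma E_add: "E w (x + y) = E w x + E w y"
  by (rule ext) (simp add: E_def)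

lemma E_zero [simp]: "E w 0 = 0"
  by (rule ext) (simp add: E_def)

lemma sp_comp_eq_iff: "sp i \<circ> v = w \<longleftrightarrow> v = sp i \<circ> w"
  by (metis sp_sp(1))


text \<open>\<open>T\<close> is defined by collecting the coefficient at each target; this lemma and
  the next one show the operator from the source.\<close>

lemma T_E_up:
  assumes "perm d w" "x \<in> Tn d" "pos i" "\<not> desc i w"
  shows "T i (E w x) = E w (\<rho> i x) + E (sp i \<circ> w) (\<sigma> i x)"
proof
  fix v
  have "desc i (sp i \<circ> w)" using assms desc_sp by simp
  then have "w \<noteq> sp i \<circ> w" using assms(4) by metis
  then show "T i (E w x) v = (E w (\<rho> i x) + E (sp i \<circ> w) (\<sigma> i x)) v"
    using \<open>desc i (sp i \<circ> w)\<close> assms(4) by (auto simp: T_def E_def sp_comp_eq_iff)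
qed

lemma T_E_down:
  assumes "perm d w" "x \<in> Tn d" "pos i" "desc i w"
  shows "T i (E w x) = E w (\<rho> i x + mul (\<sigma> i x) (Sp i)) + E (sp i \<circ> w) (mul (\<sigma> i x) (Rp i))"
proof
  fix v
  have "\<not> desc i (sp i \<circ> w)" using assms desc_sp by simp
  then have "w \<noteq> sp i \<circ> w" using assms(4) by metis
  then show "T i (E w x) v = (E w (\<rho> i x + mul (\<sigma> i x) (Sp i)) + E (sp i \<circ> w) (mul (\<sigma> i x) (Rp i))) v"
    using \<open>\<not> desc i (sp i \<circ> w)\<close> assms(4) by (auto simp: T_def E_def sp_comp_eq_iff)
qed

lemma finite_perm [simp]: "finite {w. perm d w}"
  by (simp add: finite_permutations)

lemma MM_expand:
  assumes "F \<in> MM" shows "F = (\<Sum>w | perm d w. E w (F w))"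
proof
  fix v
  have "(\<Sum>w | perm d w. E w (F w) v) = (\<Sum>w | perm d w. if w = v then F v else 0)"
    by (rule sum.cong) (auto simp: E_def)
  also have "\<dots> = F v" using MM_D(2)[OF assms, of v] by (simp add: sum.delta')
  finally show "F v = (\<Sum>w | perm d w. E w (F w)) v" by (simp add: sum_apply)
qed

lemma MM_induct [consumes 1, case_names zero add E]:
  assumes F: "F \<in> MM" and zero: "P 0"
    and add: "\<And>F G. F \<in> MM \<Longrightarrow> G \<in> MM \<Longrightarrow> P F \<Longrightarrow> P G \<Longrightarrow> P (F + G)"
    and E: "\<And>w x. perm d w \<Longrightarrow> x \<in> Tn d \<Longrightarrow> P (E w x)"
  shows "P F"
proof -
  have "P (\<Sum>w\<in>I. E w (F w))" if "finite I" "I \<subseteq> {w. perm d w}" for I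
    using that
  proof (induction I)
    case empty show "P (\<Sum>w\<in>{}. E w (F w))" using zero by simp
  next
    case (insert w I)
    then have "P (E w (F w) + (\<Sum>w\<in>I. E w (F w)))"
      using F by (intro add E) (auto intro!: MM_sum simp: MM_D(1)[OF F])
    then show "P (\<Sum>w\<in>insert w I. E w (F w))" using insert by simp
  qed
  from this[of "{w. perm d w}"] show ?thesis using MM_expand[OF F] by simp
qed

section \<open>The wreath and quadratic relations as operator identities\<close>

definition wreath_op :: "nat \<Rightarrow> bool" where
  "wreath_op i \<longleftrightarrow> (\<forall>b\<in>Tn d. \<forall>F\<in>MM. T i (smul b F) = smul (\<sigma> i b) (T i F) + smul (\<rho> i b) F)"

definition quad_op :: "nat \<Rightarrow> bool" where
  "quad_op i \<longleftrightarrow> (\<forall>F\<in>MM. T i (T i F) = smul (Sp i) (T i F) + smul (Rp i) F)"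

lemma wreathD: "wreath_op i \<Longrightarrow> b \<in> Tn d \<Longrightarrow> F \<in> MM \<Longrightarrow> T i (smul b F) = smul (\<sigma> i b) (T i F) + smul (\<rho> i b) F"
  by (simp add: wreath_op_def)

lemma quadD: "quad_op i \<Longrightarrow> F \<in> MM \<Longrightarrow> T i (T i F) = smul (Sp i) (T i F) + smul (Rp i) F"
  by (simp add: quad_op_def)

lemma T_T_smul:
  assumes "pos i" "pos j" "wreath_op i" "wreath_op j" "b \<in> Tn d" "F \<in> MM"
  shows "T j (T i (smul b F)) = smul (\<sigma> j (\<sigma> i b)) (T j (T i F)) + smul (\<rho> j (\<sigma> i b)) (T i F)
    + smul (\<sigma> j (\<rho> i b)) (T j F) + smul (\<rho> j (\<rho> i b)) F"
  using assms by (simp add: wreathD add.assoc)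

text \<open>Together with the same expansion for \<open>i\<close> and \<open>j\<close> exchanged,
  this displays both sides of the braid relation at a multiple of \<open>F\<close>. The conditions
  (C5)--(C7), for both orders of the pair, pair off the six coefficients.\<close>

lemma T_T_T_smul:
  assumes "pos i" "pos j" "wreath_op i" "wreath_op j" "quad_op i" "b \<in> Tn d" "F \<in> MM"
  shows "T i (T j (T i (smul b F))) = smul (\<sigma> i (\<sigma> j (\<sigma> i b))) (T i (T j (T i F)))
    + smul (\<rho> i (\<sigma> j (\<sigma> i b))) (T j (T i F)) + smul (\<sigma> i (\<sigma> j (\<rho> i b))) (T i (T j F))
    + smul (mul (\<sigma> i (\<rho> j (\<sigma> i b))) (Sp i) + \<rho> i (\<rho> j (\<sigma> i b)) + \<sigma> i (\<rho> j (\<rho> i b))) (T i F)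
    + smul (\<rho> i (\<sigma> j (\<rho> i b))) (T j F)
    + smul (\<rho> i (\<rho> j (\<rho> i b)) + mul (\<sigma> i (\<rho> j (\<sigma> i b))) (Rp i)) F"
  using assms by (simp add: wreathD quadD smul_add_left algebra_simps)

text \<open>The square of \<open>T j\<close> is reduced first, and its coefficients are then moved
  to the front. They become the expressions occurring in (C8) and (C9).\<close>

lemma T_T_T_T:
  assumes "pos i" "pos j" "wreath_op i" "wreath_op j" "quad_op j" "F \<in> MM"
  shows "T j (T i (T j (T j F))) = smul (\<sigma> j (\<sigma> i (Sp j))) (T j (T i (T j F)))
    + smul (\<rho> j (\<sigma> i (Sp j))) (T i (T j F))
    + smul (mul (\<sigma> j (\<rho> i (Sp j))) (Sp j) + \<rho> j (\<rho> i (Sp j)) + \<sigma> j (\<rho> i (Rp j))) (T j F)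
    + smul (\<sigma> j (\<sigma> i (Rp j))) (T j (T i F)) + smul (\<rho> j (\<sigma> i (Rp j))) (T i F)
    + smul (\<rho> j (\<rho> i (Rp j)) + mul (\<sigma> j (\<rho> i (Sp j))) (Rp j)) F"
  using assms by (simp add: wreathD quadD smul_add_left algebra_simps)

text \<open>This is (C2) coefficient by coefficient: in \<open>T\<close> the elements
  \<open>Sp i\<close> and \<open>Rp i\<close> multiply from the right and leave the left factor
  \<open>b\<close> alone.\<close>

lemma wreath_op_of_conds:
  assumes C: "local_conds d i" and i: "pos i" shows "wreath_op i"
  unfolding wreath_op_def
proof (intro ballI, rule ext)
  fix b :: "'i list \<Rightarrow> 'k" and F w assume b: "b \<in> Tn d" and F: "F \<in> MM"
  have s: "\<sigma> i (mul x y) = mul (\<sigma> i x) (\<sigma> i y)"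
    and r: "\<rho> i (mul x y) = mul (\<sigma> i x) (\<rho> i y) + mul (\<rho> i x) y"
    if "x \<in> Tn d" "y \<in> Tn d" for x y
    using C that by (auto simp: local_conds_def)
  show "T i (smul b F) w = (smul (\<sigma> i b) (T i F) + smul (\<rho> i b) F) w"
    using b MM_D(1)[OF F] i by (simp add: T_def smul_def s r tmul_add_right tmul_assoc algebra_simps)
qed

lemma quad_op_of_conds:
  assumes C: "local_conds d i" and i: "pos i" shows "quad_op i"
  unfolding quad_op_def
proof (intro ballI, rule ext)
  fix F w assume F: "F \<in> MM"
  let ?S = "Sp i" and ?R = "Rp i"
  note [simp] = i tmul_assoc tmul_add_left tmul_add_right
  have cl [simp]: "?S \<in> Tn d" "?R \<in> Tn d" by simp_all
  have s [simp]: "\<sigma> i (mul x y) = mul (\<sigma> i x) (\<sigma> i y)"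
    and r [simp]: "\<rho> i (mul x y) = mul (\<sigma> i x) (\<rho> i y) + mul (\<rho> i x) y"
    if "x \<in> Tn d" "y \<in> Tn d" for x y
    using C that by (auto simp: local_conds_def)
  have c3: "mul (\<sigma> i ?S) ?S + \<rho> i ?S + \<sigma> i ?R = mul ?S ?S + ?R"
    and c3': "\<rho> i ?R + mul (\<sigma> i ?S) ?R = mul ?S ?R" using C by (auto simp: local_conds_def)
  have c4: "mul (\<sigma> i (\<sigma> i x)) ?S + \<rho> i (\<sigma> i x) + \<sigma> i (\<rho> i x) = mul ?S (\<sigma> i x)"
    and c4': "mul (\<sigma> i (\<sigma> i x)) ?R + \<rho> i (\<rho> i x) = mul ?S (\<rho> i x) + mul ?R x"
    if "x \<in> Tn d" for x
    using C that by (auto simp: local_conds_def)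
  \<comment> \<open>The two coefficients of \<open>F\<close> on which either side at
    \<open>w\<close> depends.\<close>
  define x y where "x = F w" and "y = F (sp i \<circ> w)"
  have xy [simp]: "x \<in> Tn d" "y \<in> Tn d" using F by (simp_all add: x_def y_def MM_D(1))
  have T0: "T i G v = \<rho> i (G v) + mul (\<sigma> i (G (sp i \<circ> v))) ?R" if "\<not> desc i v" for G v
    using that by (simp add: T_def)
  have T1: "T i G v = \<rho> i (G v) + (\<sigma> i (G (sp i \<circ> v)) + mul (\<sigma> i (G v)) ?S)" if "desc i v" for G v
    using that by (simp add: T_def)
  have ap: "(smul ?S (T i F) + smul ?R F) w = smul ?S (T i F) w + smul ?R F w"
    by (rule plus_fun_apply)
  show "T i (T i F) w = (smul ?S (T i F) + smul ?R F) w"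
  proof (cases "perm d w")
    case False
    have "T i (T i F) w = 0" "(smul ?S (T i F) + smul ?R F) w = 0"
      using F i False MM_D(2)[of "T i (T i F)" w] MM_D(2)[of "smul ?S (T i F) + smul ?R F" w]
      by (simp_all del: plus_fun_apply)
    then show ?thesis by simp
  next
    case perm: True
    show ?thesis
    proof (cases "desc i w")
      case True
      then have nd: "\<not> desc i (sp i \<circ> w)" using desc_sp[OF perm] by simp
      \<comment> \<open>The difference is regrouped into the defects of the second-order conditions:
        (C4) at \<open>y\<close> and at \<open>x\<close>, (C4) at \<open>x\<close> multiplied by
        \<open>?S\<close> on the right, and the first part of (C3) multiplied by
        \<open>\<sigma> i (\<sigma> i x)\<close> on the left.\<close>
      have "T i (T i F) w - (smul ?S (T i F) + smul ?R F) w
        = (mul (\<sigma> i (\<sigma> i y)) ?S + \<rho> i (\<sigma> i y) + \<sigma> i (\<rho> i y) - mul ?S (\<sigma> i y))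
        + (mul (\<sigma> i (\<sigma> i x)) ?R + \<rho> i (\<rho> i x) - (mul ?S (\<rho> i x) + mul ?R x))
        + (mul (mul (\<sigma> i (\<sigma> i x)) ?S + \<rho> i (\<sigma> i x) + \<sigma> i (\<rho> i x)) ?S - mul (mul ?S (\<sigma> i x)) ?S)
        + (mul (\<sigma> i (\<sigma> i x)) (mul (\<sigma> i ?S) ?S + \<rho> i ?S + \<sigma> i ?R) - mul (\<sigma> i (\<sigma> i x)) (mul ?S ?S + ?R))"
        unfolding ap smul_def 
        by (simp add: T1[OF True] T0[OF nd] x_def[symmetric] y_def[symmetric] algebra_simps)
      also have "\<dots> = 0" unfolding c3 c4[OF xy(1)] c4[OF xy(2)] c4'[OF xy(1)] by simp
      finally show ?thesis by simp
    next
      case False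
      then have dd: "desc i (sp i \<circ> w)" using desc_sp[OF perm] by simp
      \<comment> \<open>Here the defects are the second part of (C4) at \<open>x\<close>, its first
        part at \<open>y\<close> multiplied by \<open>?R\<close>, and the second part of
        (C3).\<close>
      have "T i (T i F) w - (smul ?S (T i F) + smul ?R F) w
        = (mul (\<sigma> i (\<sigma> i x)) ?R + \<rho> i (\<rho> i x) - (mul ?S (\<rho> i x) + mul ?R x))
        + (mul (mul (\<sigma> i (\<sigma> i y)) ?S + \<rho> i (\<sigma> i y) + \<sigma> i (\<rho> i y)) ?R - mul (mul ?S (\<sigma> i y)) ?R)
        + (mul (\<sigma> i (\<sigma> i y)) (\<rho> i ?R + mul (\<sigma> i ?S) ?R) - mul (\<sigma> i (\<sigma> i y)) (mul ?S ?R))"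
        unfolding ap smul_def 
        by (simp add: T0[OF False] T1[OF dd] x_def[symmetric] y_def[symmetric] algebra_simps)
      also have "\<dots> = 0" unfolding c3' c4[OF xy(2)] c4'[OF xy(1)] by simp
      finally show ?thesis by simp
    qed
  qed
qed

end

section \<open>The braid relations on the module\<close>

context qwd begin

abbreviation "one \<equiv> tone u d"

lemma local_conds_one: "local_conds d i \<Longrightarrow> \<sigma> i one = one \<and> \<rho> i one = 0"
  by (simp add: local_conds_def)

lemma T_E_one:
  assumes "local_conds d i" "perm d w" "pos i" "\<not> desc i w"
  shows "T i (E w one) = E (sp i \<circ> w) one"
  using T_E_up[OF assms(2) tone_closed assms(3,4)] local_conds_one[OF assms(1)] by simp

text \<open>Removing descents that lie in \<open>I\<close> shortens \<open>w\<close> until none is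
  left. Each removed letter is put back by \<open>T i\<close>, which by (C1) sends
  \<open>E v one\<close> to \<open>E (sp i \<circ> v) one\<close> at an ascent.\<close>

lemma MM_generate:
  assumes F: "F \<in> MM" and I: "\<And>i. i \<in> I \<Longrightarrow> pos i" "\<And>i. i \<in> I \<Longrightarrow> local_conds d i"
    and zero: "P 0"
    and add: "\<And>F G. F \<in> MM \<Longrightarrow> G \<in> MM \<Longrightarrow> P F \<Longrightarrow> P G \<Longrightarrow> P (F + G)"
    and smul: "\<And>b F. b \<in> Tn d \<Longrightarrow> F \<in> MM \<Longrightarrow> P F \<Longrightarrow> P (smul b F)"
    and T: "\<And>i F. i \<in> I \<Longrightarrow> F \<in> MM \<Longrightarrow> P F \<Longrightarrow> P (T i F)"
    and base: "\<And>w. perm d w \<Longrightarrow> (\<And>i. i \<in> I \<Longrightarrow> \<not> desc i w) \<Longrightarrow> P (E w one)"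
  shows "P F"
proof -
  have one: "P (E w one)" if "perm d w" for w
    using that
  proof (induction "plen d w" arbitrary: w rule: less_induct)
    case less
    show ?case
    proof (cases "\<exists>i\<in>I. desc i w")
      case True
      then obtain i where i: "i \<in> I" "desc i w" by blast
      let ?v = "sp i \<circ> w"
      have v: "perm d ?v" "\<not> desc i ?v" using less.prems I(1)[OF i(1)] i(2) by (simp_all add: desc_sp)
      have "P (T i (E ?v one))"
        using less.hyps[of ?v] plen_down[OF less.prems _ _ i(2)] I(1)[OF i(1)] v by (intro T[OF i(1)]) simp_all
      then show ?thesis using T_E_one[OF I(2)[OF i(1)] v(1) I(1)[OF i(1)] v(2)] by simp
    next
      case False then show ?thesis using base[OF less.prems] by blast
    qed
  qed
  have E: "P (E w x)" if "perm d w" "x \<in> Tn d" for w x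
    using smul[OF that(2) _ one[OF that(1)]] that by (simp add: smul_E)
  show ?thesis by (rule MM_induct[where P = P, OF F zero add E])
qed

definition braid_at :: "nat \<Rightarrow> nat \<Rightarrow> ((nat \<Rightarrow> nat) \<Rightarrow> 'i list \<Rightarrow> 'k) \<Rightarrow> bool" where
  "braid_at i j F \<longleftrightarrow> T i (T j (T i F)) = T j (T i (T j F))"

lemma braid_at_sym: "braid_at i j F \<longleftrightarrow> braid_at j i F"
  by (auto simp: braid_at_def)

lemma braid_at_smul:
  assumes p: "pos i" "pos j" and op: "wreath_op i" "wreath_op j" "quad_op i" "quad_op j"
    and C: "braid_conds d i j" "braid_conds d j i"
    and b: "b \<in> Tn d" and F: "F \<in> MM" and br: "braid_at i j F"
  shows "braid_at i j (smul b F)"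
proof -
  have e1: "\<sigma> i (\<sigma> j (\<sigma> i b)) = \<sigma> j (\<sigma> i (\<sigma> j b))" 
    and e2: "\<rho> i (\<sigma> j (\<sigma> i b)) = \<sigma> j (\<sigma> i (\<rho> j b))"
    and e3: "\<rho> j (\<sigma> i (\<sigma> j b)) = \<sigma> i (\<sigma> j (\<rho> i b))"
    and e4: "\<rho> i (\<sigma> j (\<rho> i b)) = mul (\<sigma> j (\<rho> i (\<sigma> j b))) (Sp j) + \<rho> j (\<rho> i (\<sigma> j b)) + \<sigma> j (\<rho> i (\<rho> j b))"
    and e5: "\<rho> j (\<sigma> i (\<rho> j b)) = mul (\<sigma> i (\<rho> j (\<sigma> i b))) (Sp i) + \<rho> i (\<rho> j (\<sigma> i b)) + \<sigma> i (\<rho> j (\<rho> i b))"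
    and e6: "\<rho> i (\<rho> j (\<rho> i b)) + mul (\<sigma> i (\<rho> j (\<sigma> i b))) (Rp i)
      = \<rho> j (\<rho> i (\<rho> j b)) + mul (\<sigma> j (\<rho> i (\<sigma> j b))) (Rp j)"
    using C b unfolding braid_conds_def by blast+
  show ?thesis
    unfolding braid_at_def T_T_T_smul[OF p op(1,2,3) b F] T_T_T_smul[OF p(2,1) op(2,1,4) b F]
      e1 e2 e3 e4 e5 e6 br[unfolded braid_at_def]
    by (simp only: add_ac)
qed

text \<open>The hypothesis at \<open>F\<close> brings two equal operators together on one side,
  where the quadratic relation for \<open>T i\<close> applies. On the other side the square of
  \<open>T j\<close> is reduced, and (C8) and (C9) say that its coefficients turn into
  \<open>Sp i\<close> and \<open>Rp i\<close> while the rest vanishes.\<close>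

lemma braid_at_T:
  assumes p: "pos i" "pos j" and op: "wreath_op i" "wreath_op j" "quad_op i" "quad_op j"
    and C: "braid_conds d i j" and F: "F \<in> MM" and br: "braid_at i j F"
  shows "braid_at i j (T j F)"
proof -
  have c: "\<sigma> j (\<sigma> i (Sp j)) = Sp i" "\<sigma> j (\<sigma> i (Rp j)) = Rp i" 
    "\<rho> j (\<sigma> i (Sp j)) = 0" "\<rho> j (\<sigma> i (Rp j)) = 0"
    "mul (\<sigma> j (\<rho> i (Sp j))) (Sp j) + \<rho> j (\<rho> i (Sp j)) + \<sigma> j (\<rho> i (Rp j)) = 0"
    "\<rho> j (\<rho> i (Rp j)) + mul (\<sigma> j (\<rho> i (Sp j))) (Rp j) = 0"
    using C unfolding braid_conds_def by simp_all
  have G: "T j (T i F) \<in> MM" using p F by simp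
  have "T i (T j (T i (T j F))) = T i (T i (T j (T i F)))" using br by (simp add: braid_at_def)
  also have "\<dots> = smul (Sp i) (T j (T i (T j F))) + smul (Rp i) (T j (T i F))"
    using quadD[OF op(3) G] br by (simp add: braid_at_def)
  also have "\<dots> = T j (T i (T j (T j F)))"
    unfolding T_T_T_T[OF p op(1,2,4) F] c by simp
  finally show ?thesis by (simp add: braid_at_def)
qed

text \<open>Without these two descents \<open>inv w\<close> increases along \<open>i\<close>,
  \<open>i + 1\<close>, \<open>i + 2\<close>. Hence each partial product in either form of the braid
  relation goes up, and the operators only move the basis vector.\<close>

lemma adjacent_up:
  assumes "perm d w" "\<not> desc i w" "\<not> desc (Suc i) w"
  shows "\<not> desc (Suc i) (sp i \<circ> w)" "\<not> desc i (sp (Suc i) \<circ> (sp i \<circ> w))"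
    "\<not> desc i (sp (Suc i) \<circ> w)" "\<not> desc (Suc i) (sp i \<circ> (sp (Suc i) \<circ> w))"
proof -
  have s: "inv (sp k \<circ> v) a = inv v (sp k a)" if "bij v" for k v a
    using that by (simp add: o_inv_distrib)
  have b: "bij w" "bij (sp k)" for k using assms permutes_bij by auto
  then have bb: "bij (sp k \<circ> w)" for k by (metis bij_comp)
  show "\<not> desc (Suc i) (sp i \<circ> w)" "\<not> desc i (sp (Suc i) \<circ> (sp i \<circ> w))"
    "\<not> desc i (sp (Suc i) \<circ> w)" "\<not> desc (Suc i) (sp i \<circ> (sp (Suc i) \<circ> w))"
    using assms(2,3) by (auto simp: desc_def s b bb Transposition.transpose_def)
qed

lemma braid_op_of_conds:
  assumes C: "cond_C1_C4 m u R S rho sigma" "cond_C5_C9 m u R S rho sigma"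
    and i: "1 \<le> i" "Suc i < d" and F: "F \<in> MM"
  shows "braid_at i (Suc i) F"
proof -
  let ?j = "Suc i"
  have p: "pos i" "pos ?j" using i by auto
  have L: "local_conds d i" "local_conds d ?j" using C(1) p cond_C1_C4_local by auto
  have op: "wreath_op i" "wreath_op ?j" "quad_op i" "quad_op ?j"
    using L p by (auto intro: wreath_op_of_conds quad_op_of_conds)
  have B: "braid_conds d i ?j" "braid_conds d ?j i" using braid_conds_iff[of i d] i C(2) by auto
  show ?thesis
    using F
  proof (rule MM_generate[where I = "{i, ?j}"])
    show "pos k" "local_conds d k" if "k \<in> {i, ?j}" for k using that p L by auto
    show "braid_at i ?j 0" by (simp add: braid_at_def)
    show "braid_at i ?j (F + G)" if "F \<in> MM" "G \<in> MM" "braid_at i ?j F" "braid_at i ?j G" for F G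
      using that p by (simp add: braid_at_def)
    show "braid_at i ?j (smul b F)" if "b \<in> Tn d" "F \<in> MM" "braid_at i ?j F" for b F
      by (rule braid_at_smul[OF p op B that])
    show "braid_at i ?j (T k F)" if "k \<in> {i, ?j}" "F \<in> MM" "braid_at i ?j F" for k F
      using braid_at_T[OF p op B(1) that(2,3)]
        braid_at_T[OF p(2,1) op(2,1,4,3) B(2) that(2)] that by (auto simp: braid_at_sym[of ?j])
    show "braid_at i ?j (E w one)" if w: "perm d w" "\<And>k. k \<in> {i, ?j} \<Longrightarrow> \<not> desc k w" for w
    proof -
      have nd: "\<not> desc i w" "\<not> desc ?j w" using w by auto
      note up = adjacent_up[OF w(1) nd]
      show ?thesis unfolding braid_at_def
        using T_E_one[OF L(1)] T_E_one[OF L(2)] p nd up w(1) sp_braid[of i w] by simp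
    qed
  qed
qed

lemma far_up:
  assumes "perm d w" "\<not> desc j w" "i + 2 \<le> j \<or> j + 2 \<le> i"
  shows "\<not> desc j (sp i \<circ> w)"
  using assms by (auto simp: desc_def inv_sp_comp Transposition.transpose_def)

definition commute_at :: "nat \<Rightarrow> nat \<Rightarrow> ((nat \<Rightarrow> nat) \<Rightarrow> 'i list \<Rightarrow> 'k) \<Rightarrow> bool" where
  "commute_at i j F \<longleftrightarrow> T i (T j F) = T j (T i F)"

text \<open>\<open>\<sigma> j\<close> fixes and \<open>\<rho> j\<close> kills the coefficients of
  the quadratic relation for \<open>T i\<close>, so \<open>T j\<close> passes through them.\<close>

lemma commute_at_T:
  assumes p: "pos i" "pos j" and op: "wreath_op j" "quad_op i"
    and fix_j: "\<sigma> j (Sp i) = Sp i \<and> \<rho> j (Sp i) = 0" "\<sigma> j (Rp i) = Rp i \<and> \<rho> j (Rp i) = 0"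
    and F: "F \<in> MM" and c: "commute_at i j F"
  shows "commute_at i j (T i F)"
proof -
  have "T j (T i (T i F)) = smul (Sp i) (T j (T i F)) + smul (Rp i) (T j F)"
    using p F fix_j by (simp add: quadD[OF op(2)] wreathD[OF op(1)])
  also have "\<dots> = T i (T i (T j F))"
    unfolding quadD[OF op(2) T_MM[OF p(2) F]] using c by (simp add: commute_at_def)
  finally show ?thesis using c by (simp add: commute_at_def)
qed

lemma commute_op_of_conds:
  assumes C: "cond_C1_C4 m u R S rho sigma"
    and p: "pos i" "pos j" "i + 2 \<le> j \<or> j + 2 \<le> i" and F: "F \<in> MM"
  shows "commute_at i j F"
proof -
  have L: "local_conds d i" "local_conds d j" using C(1) p cond_C1_C4_local by auto
  have op: "wreath_op i" "wreath_op j" "quad_op i" "quad_op j"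
    using L p by (auto intro: wreath_op_of_conds quad_op_of_conds)
  have p': "j + 2 \<le> i \<or> i + 2 \<le> j" using p by auto
  have comm: "commute_at i j F \<longleftrightarrow> commute_at j i F" for F by (auto simp: commute_at_def)
  show ?thesis
    using F
  proof (rule MM_generate[where I = "{i, j}"])
    show "pos k" "local_conds d k" if "k \<in> {i, j}" for k using that p L by auto
    show "commute_at i j 0" by (simp add: commute_at_def)
    show "commute_at i j (F + G)" if "F \<in> MM" "G \<in> MM" "commute_at i j F" "commute_at i j G" for F G
      using that p by (simp add: commute_at_def)
    show "commute_at i j (smul b F)" if b: "b \<in> Tn d" and F: "F \<in> MM" and c: "commute_at i j F" for b F
    proof -
      have e: "\<sigma> i (\<sigma> j b) = \<sigma> j (\<sigma> i b)" "\<sigma> i (\<rho> j b) = \<rho> j (\<sigma> i b)" 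
        "\<rho> i (\<sigma> j b) = \<sigma> j (\<rho> i b)" "\<rho> i (\<rho> j b) = \<rho> j (\<rho> i b)"
        using p b by (auto intro!: ext_far)
      show ?thesis
        unfolding commute_at_def T_T_smul[OF p(1,2) op(1,2) b F] T_T_smul[OF p(2,1) op(2,1) b F]
          e c[unfolded commute_at_def] by (simp only: add_ac)
    qed
    show "commute_at i j (T k F)" if "k \<in> {i, j}" "F \<in> MM" "commute_at i j F" for k F
      using that commute_at_T[OF p(1,2) op(2,3) _ _ that(2,3)] commute_at_T[OF p(2,1) op(1,4) _ _ that(2)]
        place_far[OF C p(1,2) p(3)] place_far[OF C p(2,1) p'] by (auto simp: comm)
    show "commute_at i j (E w one)" if w: "perm d w" "\<And>k. k \<in> {i, j} \<Longrightarrow> \<not> desc k w" for w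
    proof -
      have nd: "\<not> desc i w" "\<not> desc j w" using w by auto
      have up: "\<not> desc j (sp i \<circ> w)" "\<not> desc i (sp j \<circ> w)"
        using far_up[OF w(1) nd(2) p(3)] far_up[OF w(1) nd(1) p'] by auto
      have "T i (T j (E w one)) = E (sp i \<circ> (sp j \<circ> w)) one" "T j (T i (E w one)) = E (sp j \<circ> (sp i \<circ> w)) one"
        using T_E_one[OF L(1)] T_E_one[OF L(2)] p nd up w(1) by simp_all
      then show ?thesis unfolding commute_at_def using sp_commute[OF p(3), of w] by simp
    qed
  qed
qed

section \<open>Recovering the conditions from the operator identities\<close>

definition unit_op :: "nat \<Rightarrow> bool" where
  "unit_op i \<longleftrightarrow> \<sigma> i one = one \<and> \<rho> i one = 0"

lemma E_eq_iff2:
  assumes "v \<noteq> w" shows "E v a + E w b = E v a' + E w b' \<longleftrightarrow> a = a' \<and> b = b'"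
proof
  assume e: "E v a + E w b = E v a' + E w b'"
  from fun_cong[OF e, of v] fun_cong[OF e, of w] assms show "a = a' \<and> b = b'"
    by (simp add: E_def)
qed simp

lemma sp_neq_id: "sp i \<noteq> id"
  by (metis id_apply n_not_Suc_n transpose_apply_first)

lemma not_desc_id: "\<not> desc i id"
  by (simp add: desc_def)

text \<open>\<open>F\<close> and \<open>G = T i F\<close> are independent over the tensor power.
  Evaluating in two ways \<open>T i\<close> at the product \<open>a b F\<close> gives (C2), the cube
  of \<open>T i\<close> at \<open>F\<close> gives (C3), and the square of \<open>T i\<close> at
  \<open>x F\<close> gives (C4).\<close>

lemma local_conds_of_ops:
  assumes i: "pos i" and un: "unit_op i" and W: "wreath_op i" and Q: "quad_op i"
  shows "local_conds d i"
proof -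
  define F where "F = E id one"
  define G where "G = E (sp i) one"
  have FG [simp]: "F \<in> MM" "G \<in> MM" using i by (simp_all add: F_def G_def perm_sp)
  have TF: "T i F = G"
    using T_E_up[OF perm_id tone_closed i not_desc_id] un by (simp add: F_def G_def unit_op_def)
  have TG: "T i G = smul (Sp i) G + smul (Rp i) F" using quadD[OF Q FG(1)] by (simp add: TF)
  have indep: "a = a' \<and> b = b'" if "smul a G + smul b F = smul a' G + smul b' F" "a \<in> Tn d" "b \<in> Tn d" "a' \<in> Tn d" "b' \<in> Tn d" for a b a' b'
    using that E_eq_iff2[OF sp_neq_id[of i], of a b a' b'] by (simp add: F_def G_def smul_E)
  have C2: "\<sigma> i (mul a b) = mul (\<sigma> i a) (\<sigma> i b) \<and> \<rho> i (mul a b) = mul (\<sigma> i a) (\<rho> i b) + mul (\<rho> i a) b"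
    if ab: "a \<in> Tn d" "b \<in> Tn d" for a b
  proof (rule indep)
    have "smul (\<sigma> i (mul a b)) G + smul (\<rho> i (mul a b)) F = T i (smul a (smul b F))"
      using ab i by (simp add: wreathD[OF W] TF)
    also have "\<dots> = smul (\<sigma> i a) (T i (smul b F)) + smul (\<rho> i a) (smul b F)"
      using ab i by (intro wreathD[OF W]) simp_all
    also have "\<dots> = smul (mul (\<sigma> i a) (\<sigma> i b)) G + smul (mul (\<sigma> i a) (\<rho> i b) + mul (\<rho> i a) b) F"
      using ab i by (simp add: wreathD[OF W] TF smul_add_left add.assoc)
    finally show "smul (\<sigma> i (mul a b)) G + smul (\<rho> i (mul a b)) F
      = smul (mul (\<sigma> i a) (\<sigma> i b)) G + smul (mul (\<sigma> i a) (\<rho> i b) + mul (\<rho> i a) b) F" .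
  qed (use ab i in simp_all)
  have C3: "mul (\<sigma> i (Sp i)) (Sp i) + \<rho> i (Sp i) + \<sigma> i (Rp i) = mul (Sp i) (Sp i) + Rp i \<and>
      \<rho> i (Rp i) + mul (\<sigma> i (Sp i)) (Rp i) = mul (Sp i) (Rp i)"
  proof (rule indep)
    have "smul (mul (\<sigma> i (Sp i)) (Sp i) + \<rho> i (Sp i) + \<sigma> i (Rp i)) G
        + smul (\<rho> i (Rp i) + mul (\<sigma> i (Sp i)) (Rp i)) F = T i (T i G)"
      using i by (simp add: TG TF wreathD[OF W] smul_add_left algebra_simps)
    also have "\<dots> = smul (mul (Sp i) (Sp i) + Rp i) G + smul (mul (Sp i) (Rp i)) F"
      using i by (subst quadD[OF Q FG(2)]) (simp add: TG smul_add_left algebra_simps)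
    finally show "smul (mul (\<sigma> i (Sp i)) (Sp i) + \<rho> i (Sp i) + \<sigma> i (Rp i)) G
        + smul (\<rho> i (Rp i) + mul (\<sigma> i (Sp i)) (Rp i)) F
      = smul (mul (Sp i) (Sp i) + Rp i) G + smul (mul (Sp i) (Rp i)) F" .
  qed (use i in simp_all)
  have C4: "mul (\<sigma> i (\<sigma> i x)) (Sp i) + \<rho> i (\<sigma> i x) + \<sigma> i (\<rho> i x) = mul (Sp i) (\<sigma> i x) \<and>
      mul (\<sigma> i (\<sigma> i x)) (Rp i) + \<rho> i (\<rho> i x) = mul (Sp i) (\<rho> i x) + mul (Rp i) x"
    if x: "x \<in> Tn d" for x
  proof (rule indep)
    have "smul (mul (\<sigma> i (\<sigma> i x)) (Sp i) + \<rho> i (\<sigma> i x) + \<sigma> i (\<rho> i x)) G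
        + smul (mul (\<sigma> i (\<sigma> i x)) (Rp i) + \<rho> i (\<rho> i x)) F = T i (T i (smul x F))"
      using i x by (simp add: TG TF wreathD[OF W] smul_add_left algebra_simps)
    also have "\<dots> = smul (mul (Sp i) (\<sigma> i x)) G + smul (mul (Sp i) (\<rho> i x) + mul (Rp i) x) F"
      using i x by (subst quadD[OF Q]) (simp_all add: TF wreathD[OF W] smul_add_left algebra_simps)
    finally show "smul (mul (\<sigma> i (\<sigma> i x)) (Sp i) + \<rho> i (\<sigma> i x) + \<sigma> i (\<rho> i x)) G
        + smul (mul (\<sigma> i (\<sigma> i x)) (Rp i) + \<rho> i (\<rho> i x)) F
      = smul (mul (Sp i) (\<sigma> i x)) G + smul (mul (Sp i) (\<rho> i x) + mul (Rp i) x) F" .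
  qed (use i x in simp_all)
  show ?thesis unfolding local_conds_def using un C2 C3 C4 by (auto simp: unit_op_def)
qed

lemma E_indep6:
  assumes "distinct [w1, w2, w3, w4, w5, w6]"
    and e: "E w1 a1 + E w2 a2 + E w3 a3 + E w4 a4 + E w5 a5 + E w6 a6
      = E w1 b1 + E w2 b2 + E w3 b3 + E w4 b4 + E w5 b5 + E w6 b6"
  shows "a1 = b1 \<and> a2 = b2 \<and> a3 = b3 \<and> a4 = b4 \<and> a5 = b5 \<and> a6 = b6"
  using assms(1) fun_cong[OF e, of w1] fun_cong[OF e, of w2] fun_cong[OF e, of w3]
    fun_cong[OF e, of w4] fun_cong[OF e, of w5] fun_cong[OF e, of w6]
  by (simp add: E_def)

lemma distinct_S3:
  assumes "j = Suc i \<or> i = Suc j"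
  shows "distinct [sp i \<circ> (sp j \<circ> sp i), sp j \<circ> sp i, sp i \<circ> sp j, sp i, sp j, id]"
proof -
  let ?l = "[sp i \<circ> (sp j \<circ> sp i), sp j \<circ> sp i, sp i \<circ> sp j, sp i, sp j, id]"
  \<comment> \<open>The values at the three points involved already distinguish the six
    permutations.\<close>
  let ?g = "\<lambda>f. (f (min i j), f (Suc (min i j)), f (Suc (Suc (min i j))))"
  have "distinct (map ?g ?l)"
    using assms by (elim disjE) (simp_all add: Transposition.transpose_def)
  then show ?thesis by (simp only: distinct_map)
qed

text \<open>The six vectors obtained from \<open>F\<close> by the partial products of the braid
  relation belong to distinct permutations and are independent. The braid relation at
  \<open>smul b F\<close> then yields (C5)--(C7), and at \<open>T j F\<close> it yields (C8) and
  (C9).\<close>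

lemma braid_conds_of_ops:
  assumes ij: "j = Suc i \<or> i = Suc j" and p: "pos i" "pos j"
    and L: "local_conds d i" "local_conds d j"
    and br: "\<And>F. F \<in> MM \<Longrightarrow> braid_at i j F"
  shows "braid_conds d i j"
proof -
  have op: "wreath_op i" "wreath_op j" "quad_op i" "quad_op j"
    using L p by (auto intro: wreath_op_of_conds quad_op_of_conds)
  define F where "F = E id one"
  have F [simp]: "F \<in> MM" by (simp add: F_def)
  have nd: "\<not> desc i id" "\<not> desc j id" by (rule not_desc_id)+
  have up: "\<not> desc j (sp i \<circ> id)" "\<not> desc i (sp j \<circ> (sp i \<circ> id))"
    "\<not> desc i (sp j \<circ> id)" "\<not> desc j (sp i \<circ> (sp j \<circ> id))"
    using ij adjacent_up[OF perm_id nd(1)] adjacent_up[OF perm_id nd(2)] nd by (auto simp del: comp_id)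
  note TE = T_E_one[OF L(1)] T_E_one[OF L(2)]
  have t: "T i F = E (sp i) one" "T j F = E (sp j) one" 
    "T j (T i F) = E (sp j \<circ> sp i) one" "T i (T j F) = E (sp i \<circ> sp j) one"
    "T i (T j (T i F)) = E (sp i \<circ> (sp j \<circ> sp i)) one"
    "T j (T i (T j F)) = E (sp i \<circ> (sp j \<circ> sp i)) one"
  proof -
    show 1: "T i F = E (sp i) one" "T j F = E (sp j) one" 
      "T j (T i F) = E (sp j \<circ> sp i) one" "T i (T j F) = E (sp i \<circ> sp j) one"
      "T i (T j (T i F)) = E (sp i \<circ> (sp j \<circ> sp i)) one"
      using TE p nd up perm_sp[of i d] perm_sp[of j d] by (simp_all add: F_def)
    show "T j (T i (T j F)) = E (sp i \<circ> (sp j \<circ> sp i)) one"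
      using br[OF F] 1(5) by (simp add: braid_at_def)
  qed
  have indep: "a1 = b1 \<and> a2 = b2 \<and> a3 = b3 \<and> a4 = b4 \<and> a5 = b5 \<and> a6 = b6"
    if "smul a1 (T i (T j (T i F))) + smul a2 (T j (T i F)) + smul a3 (T i (T j F)) + smul a4 (T i F) + smul a5 (T j F) + smul a6 F
      = smul b1 (T i (T j (T i F))) + smul b2 (T j (T i F)) + smul b3 (T i (T j F)) + smul b4 (T i F) + smul b5 (T j F) + smul b6 F"
      "a1 \<in> Tn d" "a2 \<in> Tn d" "a3 \<in> Tn d" "a4 \<in> Tn d" "a5 \<in> Tn d" "a6 \<in> Tn d"
      "b1 \<in> Tn d" "b2 \<in> Tn d" "b3 \<in> Tn d" "b4 \<in> Tn d" "b5 \<in> Tn d" "b6 \<in> Tn d"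
    for a1 a2 a3 a4 a5 a6 b1 b2 b3 b4 b5 b6
  proof -
    have e: "smul b F = E id b" if "b \<in> Tn d" for b using that by (simp add: F_def smul_E)
    show ?thesis using that(1) unfolding t(5,6) unfolding t(3,4) unfolding t(1,2) smul_E using that(2-)
      by (intro E_indep6[OF distinct_S3[OF ij]]) (simp add: e)
  qed
  have 1: "\<sigma> i (\<sigma> j (\<sigma> i b)) = \<sigma> j (\<sigma> i (\<sigma> j b)) \<and>
      \<rho> i (\<sigma> j (\<sigma> i b)) = \<sigma> j (\<sigma> i (\<rho> j b)) \<and>
      \<sigma> i (\<sigma> j (\<rho> i b)) = \<rho> j (\<sigma> i (\<sigma> j b)) \<and>
      mul (\<sigma> i (\<rho> j (\<sigma> i b))) (Sp i) + \<rho> i (\<rho> j (\<sigma> i b)) + \<sigma> i (\<rho> j (\<rho> i b)) = \<rho> j (\<sigma> i (\<rho> j b)) \<and>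
      \<rho> i (\<sigma> j (\<rho> i b)) = mul (\<sigma> j (\<rho> i (\<sigma> j b))) (Sp j) + \<rho> j (\<rho> i (\<sigma> j b)) + \<sigma> j (\<rho> i (\<rho> j b)) \<and>
      \<rho> i (\<rho> j (\<rho> i b)) + mul (\<sigma> i (\<rho> j (\<sigma> i b))) (Rp i) = \<rho> j (\<rho> i (\<rho> j b)) + mul (\<sigma> j (\<rho> i (\<sigma> j b))) (Rp j)"
    if b: "b \<in> Tn d" for b
  proof (rule indep, goal_cases)
    case 1
    have F2: "T j (T i (T j F)) = T i (T j (T i F))" by (simp only: t(5) t(6))
    have "T i (T j (T i (smul b F))) = T j (T i (T j (smul b F)))"
      using br[of "smul b F"] b by (simp add: braid_at_def)
    then show ?case
      unfolding T_T_T_smul[OF p op(1,2,3) b F] T_T_T_smul[OF p(2,1) op(2,1,4) b F] F2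
      by (simp only: add_ac)
  qed (use p b in simp_all)
  have 2: "\<sigma> j (\<sigma> i (Sp j)) = Sp i \<and> \<sigma> j (\<sigma> i (Rp j)) = Rp i \<and> \<rho> j (\<sigma> i (Sp j)) = 0 \<and>
      \<rho> j (\<sigma> i (Rp j)) = 0 \<and>
      mul (\<sigma> j (\<rho> i (Sp j))) (Sp j) + \<rho> j (\<rho> i (Sp j)) + \<sigma> j (\<rho> i (Rp j)) = 0 \<and>
      \<rho> j (\<rho> i (Rp j)) + mul (\<sigma> j (\<rho> i (Sp j))) (Rp j) = 0"
  proof (rule indep, goal_cases)
    case 1
    have F2: "T j (T i (T j F)) = T i (T j (T i F))" by (simp only: t(5) t(6))
    have "T j (T i (T j (T j F))) = T i (T j (T i (T j F)))"
      using br[of "T j F"] p by (simp add: braid_at_def)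
    also have "\<dots> = T i (T i (T j (T i F)))" by (simp add: F2)
    also have "\<dots> = smul (Sp i) (T i (T j (T i F))) + smul (Rp i) (T j (T i F))"
      using p by (intro quadD[OF op(3)]) simp
    finally show ?case
      unfolding T_T_T_T[OF p op(1,2,4) F] F2 by (simp add: add_ac)
  qed (use p in simp_all)
  show ?thesis unfolding braid_conds_def using 1 2 by auto
qed

end

section \<open>Normal forms modulo the ideal\<close>

context qwd begin

text \<open>\<open>scal\<close> handles functions with values in \<open>'k\<close>, whereas a family
  in \<open>MM\<close> has values in the tensor power.\<close>

definition mscal :: "'k \<Rightarrow> ((nat \<Rightarrow> nat) \<Rightarrow> 'i list \<Rightarrow> 'k) \<Rightarrow> (nat \<Rightarrow> nat) \<Rightarrow> 'i list \<Rightarrow> 'k" where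
  "mscal c F = (\<lambda>w. scal c (F w))"

definition act1 :: "'i gen \<Rightarrow> ((nat \<Rightarrow> nat) \<Rightarrow> 'i list \<Rightarrow> 'k) \<Rightarrow> (nat \<Rightarrow> nat) \<Rightarrow> 'i list \<Rightarrow> 'k" where
  "act1 g F = (case g of GB l \<Rightarrow> smul (delta l) F | GH i \<Rightarrow> T i F)"

definition actw :: "'i gen list \<Rightarrow> ((nat \<Rightarrow> nat) \<Rightarrow> 'i list \<Rightarrow> 'k) \<Rightarrow> (nat \<Rightarrow> nat) \<Rightarrow> 'i list \<Rightarrow> 'k" where
  "actw w F = foldr act1 w F"

text \<open>The free algebra always acts; that this action descends to the quotient is what the
  conditions express.\<close>

definition actp :: "('i gen list \<Rightarrow> 'k) \<Rightarrow> ((nat \<Rightarrow> nat) \<Rightarrow> 'i list \<Rightarrow> 'k) \<Rightarrow> (nat \<Rightarrow> nat) \<Rightarrow> 'i list \<Rightarrow> 'k" where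
  "actp p F = (\<lambda>v. lin (\<lambda>w. actw w F v) p)"

lemma actw_simps [simp]: "actw [] F = F" "actw (g # w) F = act1 g (actw w F)"
  by (simp_all add: actw_def)

lemma actw_append: "actw (w @ w') F = actw w (actw w' F)"
  by (simp add: actw_def)

lemma validg_simps [simp]: "validg d (GB l) \<longleftrightarrow> length l = d" "validg d (GH i) \<longleftrightarrow> pos i"
  using d2 by (auto simp: validg_def)

lemma act1_MM [simp]: "validg d g \<Longrightarrow> F \<in> MM \<Longrightarrow> act1 g F \<in> MM"
  by (cases g) (simp_all add: act1_def)

lemma actw_MM [simp]:
  assumes "\<forall>g\<in>set w. validg d g" "F \<in> MM" shows "actw w F \<in> MM"
  using assms(1) by (induction w) (simp_all add: assms(2))

lemma mscal_MM [simp]: "F \<in> MM \<Longrightarrow> mscal c F \<in> MM"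
  by (simp add: MM_def mscal_def)

lemma mscal_zero [simp]: "mscal c 0 = 0"
  by (rule ext) (simp add: mscal_def)

lemma T_mscal: "pos i \<Longrightarrow> F \<in> MM \<Longrightarrow> T i (mscal c F) = mscal c (T i F)"
  by (rule ext) (simp add: T_def mscal_def ext_scal MM_D(1) tmul_scal_left scal_add)

lemma smul_mscal: "F \<in> MM \<Longrightarrow> smul b (mscal c F) = mscal c (smul b F)"
  by (rule ext) (simp add: smul_def mscal_def MM_D(1) tmul_scal_right)

lemma smul_scal: "b \<in> Tn d \<Longrightarrow> smul (scal c b) F = mscal c (smul b F)"
  by (rule ext) (simp add: smul_def mscal_def tmul_scal_left)

lemma act1_add: "validg d g \<Longrightarrow> F \<in> MM \<Longrightarrow> G \<in> MM \<Longrightarrow> act1 g (F + G) = act1 g F + act1 g G"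
  by (cases g) (simp_all add: act1_def)

lemma act1_mscal: "validg d g \<Longrightarrow> F \<in> MM \<Longrightarrow> act1 g (mscal c F) = mscal c (act1 g F)"
  by (cases g) (simp_all add: act1_def T_mscal smul_mscal)

lemma actw_add:
  assumes "\<forall>g\<in>set w. validg d g" "F \<in> MM" "G \<in> MM"
  shows "actw w (F + G) = actw w F + actw w G"
  using assms(1)
proof (induction w)
  case Nil show "actw [] (F + G) = actw [] F + actw [] G" by (simp only: actw_simps)
next
  case (Cons g w)
  have "actw w (F + G) = actw w F + actw w G" by (rule Cons.IH) (use Cons.prems in simp)
  then show "actw (g # w) (F + G) = actw (g # w) F + actw (g # w) G"
    using assms Cons.prems by (simp add: act1_add)
qed

lemma actw_mscal:
  assumes "\<forall>g\<in>set w. validg d g" "F \<in> MM"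
  shows "actw w (mscal c F) = mscal c (actw w F)"
  using assms(1) by (induction w) (simp_all add: act1_mscal assms)

lemma actp_zero [simp]: "actp 0 F = 0"
  by (rule ext) (simp add: actp_def)

lemma actp_add: "p \<in> FA d \<Longrightarrow> q \<in> FA d \<Longrightarrow> actp (p + q) F = actp p F + actp q F"
  by (rule ext) (simp add: actp_def FA_eq_fs lin_add[of _ "words d"])

lemma actp_scal: "p \<in> FA d \<Longrightarrow> actp (scal c p) F = mscal c (actp p F)"
  by (rule ext) (simp add: actp_def mscal_def FA_eq_fs lin_scal[of _ "words d"])

lemma actp_wd [simp]: "actp (wd w) F = actw w F"
  by (rule ext) (simp add: actp_def wd_def)

lemma actp_diff: "p \<in> FA d \<Longrightarrow> q \<in> FA d \<Longrightarrow> actp (p - q) F = actp p F - actp q F"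
  using actp_add[of "p - q" q F] by (simp add: algebra_simps)

lemma actp_MM [simp]:
  assumes "p \<in> FA d" "F \<in> MM" shows "actp p F \<in> MM"
  using assms(1)
proof (induction rule: FA_induct)
  case zero show "actp 0 F \<in> MM" by simp
next
  case (add p q) then show "actp (p + q) F \<in> MM" by (simp add: actp_add)
next
  case (word c w) then show "actp (scal c (wd w)) F \<in> MM" using assms(2) by (simp add: actp_scal)
qed

lemma actp_word_mul:
  assumes w: "\<forall>g\<in>set w. validg d g" and q: "q \<in> FA d" and F: "F \<in> MM"
  shows "actp (fmul (wd w) q) F = actw w (actp q F)"
  using q
proof (induction rule: FA_induct)
  case zero
  show "actp (fmul (wd w) 0) F = actw w (actp 0 F)"
    using actw_mscal[OF w MM_zero, of 0] by (simp add: mscal_def zero_fun_def[symmetric])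
next
  case (add p q)
  then show "actp (fmul (wd w) (p + q)) F = actw w (actp (p + q) F)"
    using w F by (simp add: fmul_add_right actp_add actw_add)
next
  case (word c w')
  then have "(wd (w @ w') :: 'i gen list \<Rightarrow> 'k) \<in> FA d" using w by auto
  then show "actp (fmul (wd w) (scal c (wd w'))) F = actw w (actp (scal c (wd w')) F)"
    using w word F by (simp add: fmul_scal_right actp_scal actw_mscal actw_append)
qed

lemma actp_mul:
  assumes p: "p \<in> FA d" and q: "q \<in> FA d" and F: "F \<in> MM"
  shows "actp (fmul p q) F = actp p (actp q F)"
  using p
proof (induction rule: FA_induct)
  case zero
  show "actp (fmul 0 q) F = actp 0 (actp q F)" by simp
next
  case (add p p')
  then show "actp (fmul (p + p') q) F = actp (p + p') (actp q F)"
    using q F by (simp add: fmul_add_left actp_add)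
next
  case (word c w)
  then show "actp (fmul (scal c (wd w)) q) F = actp (scal c (wd w)) (actp q F)"
    using q F by (simp add: fmul_scal_left actp_scal actp_word_mul)
qed

lemma actp_emb:
  assumes "x \<in> Tn d" shows "actp (emb x) F = smul x F"
  using assms unfolding Tn_eq_fs
proof (induction rule: fs_induct)
  case zero show "actp (emb 0) F = smul 0 F" by simp
next
  case (add x y) then show "actp (emb (x + y)) F = smul (x + y) F"
    by (simp add: Tn_eq_fs[symmetric] emb_add actp_add smul_add_left)
next
  case (delta c l) then show "actp (emb (scal c (delta l))) F = smul (scal c (delta l)) F"
    by (simp add: emb_scal emb_delta actp_scal smul_scal act1_def)
qed

lemma actp_Hg [simp]: "actp (Hg i) F = T i F"
  by (simp add: Hg_def act1_def)

section \<open>Normal forms mapped into the quotient\<close>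

definition Phi :: "((nat \<Rightarrow> nat) \<Rightarrow> 'i list \<Rightarrow> 'k) \<Rightarrow> 'i gen list \<Rightarrow> 'k" where
  "Phi F = (\<Sum>w | perm d w. fmul (emb (F w)) (Hw d w))"

lemma Phi_zero [simp]: "Phi 0 = 0"
  by (simp add: Phi_def)

lemma Phi_add: "Phi (F + G) = Phi F + Phi G"
  by (simp add: Phi_def emb_add fmul_add_left sum.distrib)

lemma Phi_diff: "Phi (F - G) = Phi F - Phi G"
  using Phi_add[of "F - G" G] by (simp add: algebra_simps)

lemma Phi_mscal: "Phi (mscal c F) = scal c (Phi F)"
  by (simp add: Phi_def mscal_def emb_scal fmul_scal_left scal_sum)

lemma Phi_E: 
  assumes "perm d w" shows "Phi (E w x) = fmul (emb x) (Hw d w)"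
proof -
  have "Phi (E w x) = (\<Sum>v | perm d v. if v = w then fmul (emb x) (Hw d w) else 0)"
    unfolding Phi_def by (rule sum.cong) (auto simp: E_def)
  then show ?thesis using assms by (simp add: sum.delta)
qed

lemma Phi_FA [simp]: "F \<in> MM \<Longrightarrow> Phi F \<in> FA d"
  unfolding Phi_def by (auto intro!: FA_sum fmul_FA emb_FA simp: MM_D(1))

lemma Phi_sum: "Phi (\<Sum>i\<in>I. f i) = (\<Sum>i\<in>I. Phi (f i))"
proof (induction I rule: infinite_finite_induct)
  case (insert i I)
  then show "Phi (\<Sum>i\<in>insert i I. f i) = (\<Sum>i\<in>insert i I. Phi (f i))" by (simp add: Phi_add)
next
  case empty show "Phi (\<Sum>i\<in>{}. f i) = (\<Sum>i\<in>{}. Phi (f i))" by simp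
next
  case (infinite I) then show "Phi (\<Sum>i\<in>I. f i) = (\<Sum>i\<in>I. Phi (f i))" by simp
qed

lemma cong_T:
  assumes i: "pos i" and F: "F \<in> MM"
  shows "cong (fmul (Hg i) (Phi F)) (Phi (T i F))"
  using F
proof (induction rule: MM_induct)
  case zero show "cong (fmul (Hg i) (Phi 0)) (Phi (T i 0))" by simp
next
  case (add F G)
  then show "cong (fmul (Hg i) (Phi (F + G))) (Phi (T i (F + G)))"
    using i by (simp add: Phi_add fmul_add_right cong_add)
next
  case (E w x)
  let ?v = "sp i \<circ> w"
  have v: "perm d ?v" using E i by simp
  have "cong (fmul (Hg i) (Phi (E w x))) (fmul (fmul (Hg i) (emb x)) (Hw d w))"
    using E by (simp add: Phi_E fmul_assoc)
  also have "cong \<dots> (fmul (fmul (emb (\<sigma> i x)) (Hg i) + emb (\<rho> i x)) (Hw d w))"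
    using E i by (intro cong_right cong_wreath) simp_all
  also have "\<dots> = fmul (emb (\<sigma> i x)) (fmul (Hg i) (Hw d w)) + fmul (emb (\<rho> i x)) (Hw d w)"
    by (simp add: fmul_add_left fmul_assoc)
  also have "cong \<dots> (Phi (T i (E w x)))"
  proof (cases "desc i w")
    case False
    have "cong (fmul (emb (\<sigma> i x)) (fmul (Hg i) (Hw d w))) (fmul (emb (\<sigma> i x)) (Hw d ?v))"
      using E i False by (intro cong_left Hg_Hw_up) simp_all
    then have "cong (fmul (emb (\<sigma> i x)) (fmul (Hg i) (Hw d w)) + fmul (emb (\<rho> i x)) (Hw d w))
      (fmul (emb (\<sigma> i x)) (Hw d ?v) + fmul (emb (\<rho> i x)) (Hw d w))"
      by (intro cong_add) simp_all
    also have "\<dots> = Phi (T i (E w x))"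
      unfolding T_E_up[OF E i False] Phi_add using E v by (simp add: Phi_E)
    finally show ?thesis .
  next
    case True
    have "cong (fmul (emb (\<sigma> i x)) (fmul (Hg i) (Hw d w)))
      (fmul (emb (\<sigma> i x)) (fmul (emb (Sp i)) (Hw d w) + fmul (emb (Rp i)) (Hw d ?v)))"
      using E i True by (intro cong_left Hg_Hw_down) simp_all
    also have "\<dots> = fmul (fmul (emb (\<sigma> i x)) (emb (Sp i))) (Hw d w) + fmul (fmul (emb (\<sigma> i x)) (emb (Rp i))) (Hw d ?v)"
      by (simp add: fmul_add_right fmul_assoc)
    also have "cong \<dots> (fmul (emb (mul (\<sigma> i x) (Sp i))) (Hw d w) + fmul (emb (mul (\<sigma> i x) (Rp i))) (Hw d ?v))"
      using E i v by (intro cong_add cong_right cong_emb_mul) simp_all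
    finally have "cong (fmul (emb (\<sigma> i x)) (fmul (Hg i) (Hw d w)) + fmul (emb (\<rho> i x)) (Hw d w))
      (fmul (emb (mul (\<sigma> i x) (Sp i))) (Hw d w) + fmul (emb (mul (\<sigma> i x) (Rp i))) (Hw d ?v) + fmul (emb (\<rho> i x)) (Hw d w))"
      by (intro cong_add) simp_all
    also have "\<dots> = Phi (T i (E w x))"
      unfolding T_E_down[OF E i True] Phi_add using E v by (simp add: Phi_E emb_add fmul_add_left add_ac)
    finally show ?thesis .
  qed
  finally show "cong (fmul (Hg i) (Phi (E w x))) (Phi (T i (E w x)))" .
qed

lemma cong_smul:
  assumes b: "b \<in> Tn d" and F: "F \<in> MM"
  shows "cong (fmul (emb b) (Phi F)) (Phi (smul b F))"
  using F
proof (induction rule: MM_induct)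
  case zero show "cong (fmul (emb b) (Phi 0)) (Phi (smul b 0))" by simp
next
  case (add F G)
  then show "cong (fmul (emb b) (Phi (F + G))) (Phi (smul b (F + G)))"
    by (simp add: Phi_add fmul_add_right cong_add)
next
  case (E w x)
  then show "cong (fmul (emb b) (Phi (E w x))) (Phi (smul b (E w x)))"
    using cong_right[OF cong_emb_mul[OF b E(2)] Hw_FA[OF E(1)]] by (simp add: Phi_E smul_E fmul_assoc)
qed

lemma cong_actw:
  assumes w: "\<forall>g\<in>set w. validg d g" and F: "F \<in> MM"
  shows "cong (fmul (wd w) (Phi F)) (Phi (actw w F))"
  using w
proof (induction w)
  case Nil
  show "cong (fmul (wd []) (Phi F)) (Phi (actw [] F))" by simp
next
  case (Cons g w)
  have g: "cong (fmul (wd [g]) (Phi G)) (Phi (act1 g G))" if "G \<in> MM" for G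
    using Cons.prems that cong_T[of _ G] cong_smul[of _ G]
    by (cases g) (auto simp: act1_def emb_delta[symmetric] Hg_def[symmetric])
  have "fmul (wd (g # w)) (Phi F) = fmul (wd [g]) (fmul (wd w) (Phi F))"
    by (simp add: fmul_assoc[symmetric])
  also have "cong \<dots> (fmul (wd [g]) (Phi (actw w F)))"
    using Cons by (intro cong_left) simp_all
  also have "cong \<dots> (Phi (act1 g (actw w F)))"
    using Cons F by (intro g) simp
  finally show "cong (fmul (wd (g # w)) (Phi F)) (Phi (actw (g # w) F))" by simp
qed

lemma cong_actp:
  assumes p: "p \<in> FA d" and F: "F \<in> MM"
  shows "cong (fmul p (Phi F)) (Phi (actp p F))"
  using p
proof (induction rule: FA_induct)
  case zero show "cong (fmul 0 (Phi F)) (Phi (actp 0 F))" by simp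
next
  case (add p q)
  then show "cong (fmul (p + q) (Phi F)) (Phi (actp (p + q) F))"
    by (simp add: fmul_add_left actp_add Phi_add cong_add)
next
  case (word c w)
  then show "cong (fmul (scal c (wd w)) (Phi F)) (Phi (actp (scal c (wd w)) F))"
    using cong_actw[OF word F] by (simp add: fmul_scal_left actp_scal Phi_mscal cong_scal)
qed

lemma Phi_one: "cong (Phi (E id one)) (wd [])"
  using cong_one by (simp add: Phi_E Hw_id)

text \<open>\<open>p\<close> is \<open>p\<close> times the unit, and the unit has the normal form
  \<open>E id one\<close>.\<close>

lemma Phi_spans:
  assumes p: "p \<in> FA d" shows "cong p (Phi (actp p (E id one)))"
proof -
  have "cong (fmul p (wd [])) (fmul p (Phi (E id one)))"
    using p Phi_one by (intro cong_left cong_sym[OF Phi_one])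
  also have "cong \<dots> (Phi (actp p (E id one)))"
    using p by (intro cong_actp) simp_all
  finally show ?thesis by simp
qed

text \<open>The pivot of the theorem: the conditions and both basis properties are each shown
  equivalent to it.\<close>

definition Phi_inj :: bool where
  "Phi_inj \<longleftrightarrow> (\<forall>F\<in>MM. Phi F \<in> J \<longrightarrow> F = 0)"

lemma wrels_FA: "r \<in> wrels m u d R S rho sigma \<Longrightarrow> r \<in> FA d"
  using d2 unfolding wrels_def by (auto intro!: FA_simps(3) fmul_FA)

lemma J_FA: "p \<in> J \<Longrightarrow> p \<in> FA d"
proof (induction rule: wideal.induct)
  case zero show "0 \<in> FA d" by simp
next
  case (gen r) then show "r \<in> FA d" by (rule wrels_FA)
next
  case (add p q) then show "p + q \<in> FA d" by simp
next
  case (scal p c) then show "scal c p \<in> FA d" by simp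
next
  case (lmul p w) then show "fmul (wd w) p \<in> FA d" by simp
next
  case (rmul p w) then show "fmul p (wd w) \<in> FA d" by simp
qed

text \<open>\<open>fmul p (Phi F)\<close> lies in the ideal and is congruent to
  \<open>Phi (actp p F)\<close>, so injectivity kills \<open>actp p F\<close>.\<close>

lemma J_acts_zero:
  assumes "Phi_inj" "p \<in> J" "F \<in> MM" shows "actp p F = 0"
proof -
  have p: "p \<in> FA d" using assms J_FA by simp
  have "cong (fmul p (Phi F)) (Phi (actp p F))" using p assms by (intro cong_actp)
  moreover have "fmul p (Phi F) \<in> J" using assms by (intro J_mul_right) simp_all
  ultimately have "Phi (actp p F) \<in> J"
    using J_diff[of "fmul p (Phi F)" "fmul p (Phi F) - Phi (actp p F)"] by (simp add: cong_def)
  then show ?thesis using assms p by (simp add: Phi_inj_def)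
qed

lemma cong_act_eq:
  assumes "Phi_inj" "cong p q" "p \<in> FA d" "q \<in> FA d" "F \<in> MM"
  shows "actp p F = actp q F"
  using J_acts_zero[of "p - q" F] assms by (simp add: cong_def actp_diff)

lemma conds_of_Phi_inj:
  assumes inj: Phi_inj
  shows "cond_C1_C4 m u R S rho sigma \<and> (3 \<le> d \<longrightarrow> cond_C5_C9 m u R S rho sigma)"
proof -
  have W: "wreath_op i" if i: "pos i" for i
    unfolding wreath_op_def
  proof (intro ballI)
    fix b :: "'i list \<Rightarrow> 'k" and F assume "b \<in> Tn d" "F \<in> MM"
    then show "T i (smul b F) = smul (\<sigma> i b) (T i F) + smul (\<rho> i b) F"
      using cong_act_eq[OF inj cong_wreath[OF i], of b F] i
      by (simp add: actp_mul actp_add actp_emb)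
  qed
  have Q: "quad_op i" if i: "pos i" for i
    unfolding quad_op_def
  proof (intro ballI)
    fix F assume "F \<in> MM"
    then show "T i (T i F) = smul (Sp i) (T i F) + smul (Rp i) F"
      using cong_act_eq[OF inj cong_quad[OF i], of F] i
      by (simp add: actp_mul actp_add actp_emb)
  qed
  \<comment> \<open>Modulo the ideal, \<open>Hg i\<close> has the normal form
    \<open>E (sp i) one\<close>, and as \<open>Hg i\<close> times the unit it also has the normal
    form \<open>T i (E id one)\<close>. Injectivity equates them, and comparing coefficients gives
    (C1).\<close>
  have U: "unit_op i" if i: "pos i" for i
  proof -
    have sp: "perm d (sp i)" using i perm_sp by simp
    have "cong (Phi (E (sp i) one)) (fmul (emb one) (fmul (Hg i) (Hw d id)))"
      using sp cong_left[OF cong_sym[OF Hg_Hw_up[OF perm_id i not_desc_id]], of "emb one"]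
      by (simp add: Phi_E)
    also have "\<dots> = fmul (emb one) (Hg i)" by (simp add: Hw_id)
    also have "cong \<dots> (fmul (wd []) (Hg i))" using i by (intro cong_right cong_one) simp_all
    also have "\<dots> = fmul (Hg i) (wd [])" by simp
    also have "cong \<dots> (fmul (Hg i) (Phi (E id one)))" using i by (intro cong_left cong_sym[OF Phi_one]) simp_all
    also have "cong \<dots> (Phi (T i (E id one)))" using i by (intro cong_T) simp_all
    finally have "E (sp i) one - T i (E id one) = 0"
      using inj i sp unfolding Phi_inj_def cong_def Phi_diff[symmetric] by (meson E_MM MM_diff T_MM perm_id tone_closed)
    then have "E (sp i) (\<sigma> i one) + E id (\<rho> i one) = E (sp i) one + E id 0"
      using T_E_up[OF perm_id tone_closed i not_desc_id] by (simp add: algebra_simps)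
    then show ?thesis using E_eq_iff2[OF sp_neq_id[of i], of "\<sigma> i one" "\<rho> i one" one 0]
      by (simp add: unit_op_def del: E_zero)
  qed
  have L: "local_conds d i" if "pos i" for i
    using that by (intro local_conds_of_ops U W Q)
  have p1: "pos 1" using d2 by simp
  have C14: "cond_C1_C4 m u R S rho sigma" using L[OF p1] cond_C1_C4_local[of 1 d] p1 by simp
  moreover have "cond_C5_C9 m u R S rho sigma" if d3: "3 \<le> d"
  proof -
    have p: "pos 1" "pos (Suc 1)" using d3 by auto
    have br: "braid_at 1 (Suc 1) F" if "F \<in> MM" for F
      unfolding braid_at_def using cong_act_eq[OF inj cong_braid[of 1], of F] d3 that p
      by (simp add: actp_mul)
    have br': "braid_at (Suc 1) 1 F" if "F \<in> MM" for F
      using br[OF that] braid_at_sym by blast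
    have "braid_conds d 1 (Suc 1)"
      by (rule braid_conds_of_ops[OF _ p L[OF p(1)] L[OF p(2)] br]) simp_all
    moreover have "braid_conds d (Suc 1) 1"
      by (rule braid_conds_of_ops[OF _ p(2,1) L[OF p(2)] L[OF p(1)] br']) simp_all
    ultimately show ?thesis using braid_conds_iff[of 1 d] d3 by simp
  qed
  ultimately show ?thesis by blast
qed

lemma J_acts_zero_of_conds:
  assumes C: "cond_C1_C4 m u R S rho sigma" "3 \<le> d \<longrightarrow> cond_C5_C9 m u R S rho sigma"
    and p: "p \<in> J" and F: "F \<in> MM"
  shows "actp p F = 0"
proof -
  have L: "local_conds d i" if "pos i" for i using that C(1) cond_C1_C4_local by auto
  have W: "wreath_op i" "quad_op i" if "pos i" for i
    using that L by (auto intro: wreath_op_of_conds quad_op_of_conds)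
  have gen': "actp r F = 0" if r: "r \<in> wrels m u d R S rho sigma" and F: "F \<in> MM" for r F
  proof -
    consider "r = emb one - wd []"
      | x y where "r = fmul (emb x) (emb y) - emb (mul x y)" "x \<in> Tn d" "y \<in> Tn d"
      | k where "r = fmul (Hg k) (fmul (Hg (k+1)) (Hg k)) - fmul (Hg (k+1)) (fmul (Hg k) (Hg (k+1)))"
          "1 \<le> k" "k \<le> d - 2"
      | i j where "r = fmul (Hg i) (Hg j) - fmul (Hg j) (Hg i)" "1 \<le> i" "i \<le> d - 1" "1 \<le> j" "j \<le> d - 1"
          "i + 2 \<le> j \<or> j + 2 \<le> i"
      | i where "r = fmul (Hg i) (Hg i) - fmul (emb (Sp i)) (Hg i) - emb (Rp i)" "1 \<le> i" "i \<le> d - 1"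
      | i b where "r = fmul (Hg i) (emb b) - fmul (emb (\<sigma> i b)) (Hg i) - emb (\<rho> i b)"
          "1 \<le> i" "i \<le> d - 1" "b \<in> Tn d"
      using r unfolding wrels_def by blast
    then show ?thesis
    proof cases
      case 1 then show ?thesis using F by (simp add: actp_diff actp_emb)
    next
      case 2 then show ?thesis using F by (simp add: actp_diff actp_mul actp_emb)
    next
      case (3 k)
      then have k: "1 \<le> k" "Suc k < d" using d2 by auto
      then have "braid_at k (Suc k) F" using C F by (intro braid_op_of_conds) simp_all
      then show ?thesis using 3 k F by (simp add: actp_diff actp_mul braid_at_def Suc_eq_plus1[symmetric] del: Suc_eq_plus1)
    next
      case (4 i j)
      then have ij: "pos i" "pos j" using d2 by auto
      then have "commute_at i j F" using C F 4 by (intro commute_op_of_conds) simp_all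
      then show ?thesis using 4 ij F by (simp add: actp_diff actp_mul commute_at_def)
    next
      case (5 i)
      then have i: "pos i" using d2 by auto
      then show ?thesis using 5 F quadD[OF W(2)[of i] F] by (simp add: actp_diff actp_mul actp_emb)
    next
      case (6 i b)
      then have i: "pos i" using d2 by auto
      then show ?thesis using 6 F wreathD[OF W(1)[of i], of b F] by (simp add: actp_diff actp_mul actp_emb)
    qed
  qed
  have aw0: "actw w 0 = 0" if "\<forall>g\<in>set w. validg d g" for w
    using actw_mscal[OF that MM_zero, of 0] by (simp add: mscal_def zero_fun_def[symmetric])
  \<comment> \<open>The invariant runs over all vectors because under \<open>rmul\<close> the vector
    \<open>F\<close> is replaced by \<open>actw w F\<close>.\<close>
  define K where "K q \<longleftrightarrow> q \<in> FA d \<and> (\<forall>F\<in>MM. actp q F = 0)" for q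
  have "K p"
    using p
  proof (induction rule: wideal.induct)
    case zero show "K 0" by (simp add: K_def)
  next
    case (gen r) then show "K r" using wrels_FA gen' by (simp add: K_def)
  next
    case (add p q) then show "K (p + q)" by (simp add: K_def actp_add)
  next
    case (scal p c) then show "K (scal c p)" by (simp add: K_def actp_scal)
  next
    case (lmul p w) then show "K (fmul (wd w) p)" by (simp add: K_def actp_mul aw0)
  next
    case (rmul p w) then show "K (fmul p (wd w))" by (simp add: K_def actp_mul)
  qed
  then show ?thesis using F by (simp add: K_def)
qed

lemma actw_GH: "actw (map GH is) F = foldr T is F"
  by (induction "is") (simp_all add: act1_def)

text \<open>Along a reduced word every step is an ascent, so \<open>T_E_one\<close> applies
  throughout.\<close>

lemma foldr_T_one:
  assumes L: "\<And>i. pos i \<Longrightarrow> local_conds d i"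
  shows "reduced d is \<Longrightarrow> foldr T is (E id one) = E (sprod is) one"
proof (induction "is")
  case Nil show "foldr T [] (E id one) = E (sprod []) one" by simp
next
  case (Cons i js)
  have "foldr T js (E id one) = E (sprod js) one"
    by (rule Cons.IH) (use Cons.prems in \<open>simp add: reduced_Cons\<close>)
  moreover have "perm d (sprod js)" using Cons.prems by (auto simp: reduced_Cons reduced_def intro!: perm_sprod)
  ultimately show "foldr T (i # js) (E id one) = E (sprod (i # js)) one"
    using Cons.prems T_E_one[OF L, of i "sprod js"] by (simp add: reduced_Cons)
qed

lemma Phi_inj_of_conds:
  assumes C: "cond_C1_C4 m u R S rho sigma" "3 \<le> d \<longrightarrow> cond_C5_C9 m u R S rho sigma"
  shows Phi_inj
  unfolding Phi_inj_def
proof (intro ballI impI)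
  fix F assume F: "F \<in> MM" and J: "Phi F \<in> J"
  have L: "local_conds d i" if "pos i" for i using that C(1) cond_C1_C4_local by auto
  define e where "e = E id one"
  have e: "e \<in> MM" by (simp add: e_def)
  \<comment> \<open>Acting on \<open>e\<close> is a left inverse of \<open>Phi\<close>, and it kills
    the ideal.\<close>
  have "actp (Phi F) e = F"
    using F
  proof (induction rule: MM_induct)
    case zero show "actp (Phi 0) e = 0" by simp
  next
    case (add F G)
    then show "actp (Phi (F + G)) e = F + G" by (simp add: Phi_add actp_add)
  next
    case (E w x)
    have "actp (Hw d w) e = E w one"
      using foldr_T_one[OF L rexp(1)[OF E(1)]] rexp(2)[OF E(1)] by (simp add: e_def Hw_def actw_GH)
    then show "actp (Phi (E w x)) e = E w x"
      using E e by (simp add: Phi_E actp_mul actp_emb smul_E)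
  qed
  then show "F = 0" using J_acts_zero_of_conds[OF C J, of e] e by simp
qed

end

section \<open>Bases and the opposite normal form\<close>

lemma linear_on_expand:
  assumes "linear_on A g" "x \<in> fs A"
  shows "g x = (\<Sum>a\<in>supp x. scal (x a) (g (delta a)))"
proof -
  have A: "a \<in> A" if "a \<in> supp x" for a using assms(2) that by (auto simp: fs_def)
  have "g x = g (\<Sum>a\<in>supp x. scal (x a) (delta a))"
    using fs_expand[OF assms(2) fs_finite[OF assms(2)] order_refl] by simp
  also have "\<dots> = (\<Sum>a\<in>supp x. g (scal (x a) (delta a)))"
    using A by (intro linear_on_sum[OF assms(1)]) simp
  also have "\<dots> = (\<Sum>a\<in>supp x. scal (x a) (g (delta a)))"
    using A by (intro sum.cong refl linear_onD(2)[OF assms(1)]) simp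
  finally show ?thesis .
qed

context qwd begin

lemma comb_eq:
  assumes g: "\<And>w. perm d w \<Longrightarrow> linear_on (len d) (g w)" and F: "F \<in> MM"
    and c: "\<And>l w. (l, w) \<in> idx d \<Longrightarrow> c (l, w) = F w l"
  shows "finite {x \<in> idx d. c x \<noteq> 0}"
    and "(\<Sum>x\<in>{x \<in> idx d. c x \<noteq> 0}. scal (c x) ((\<lambda>(l, w). g w (delta l)) x)) = (\<Sum>w | perm d w. g w (F w))"
proof -
  have len: "length l = d" if "F w l \<noteq> 0" for w l using MM_D(1)[OF F, of w] that by (auto simp: Tn_def)
  have fin: "finite (supp (F w))" for w using MM_D(1)[OF F, of w] by (simp add: Tn_def)
  have eq: "{x \<in> idx d. c x \<noteq> 0} = (\<lambda>(w, l). (l, w)) ` (SIGMA w:{w. perm d w}. supp (F w))"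
  proof (intro equalityI subsetI)
    fix x assume x: "x \<in> {x \<in> idx d. c x \<noteq> 0}"
    obtain l w where lw: "x = (l, w)" by (cases x)
    have "perm d w" "F w l \<noteq> 0" using x c[of l w] by (auto simp: lw idx_def)
    then show "x \<in> (\<lambda>(w, l). (l, w)) ` (SIGMA w:{w. perm d w}. supp (F w))"
      by (intro image_eqI[of _ _ "(w, l)"]) (simp_all add: lw supp_def)
  next
    fix x assume "x \<in> (\<lambda>(w, l). (l, w)) ` (SIGMA w:{w. perm d w}. supp (F w))"
    then obtain w l where lw: "x = (l, w)" "perm d w" "F w l \<noteq> 0" by (auto simp: supp_def)
    then have "(l, w) \<in> idx d" using len by (simp add: idx_def)
    then show "x \<in> {x \<in> idx d. c x \<noteq> 0}" using lw c by simp
  qed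
  have finS: "finite (SIGMA w:{w. perm d w}. supp (F w))" using fin by (intro finite_SigmaI) simp_all
  then show "finite {x \<in> idx d. c x \<noteq> 0}" unfolding eq by (rule finite_imageI)
  have inj: "inj_on (\<lambda>(w, l). (l, w)) X" for X :: "((nat \<Rightarrow> nat) \<times> 'i list) set" by (auto simp: inj_on_def)
  have "(\<Sum>x\<in>{x \<in> idx d. c x \<noteq> 0}. scal (c x) ((\<lambda>(l, w). g w (delta l)) x))
    = (\<Sum>(w, l)\<in>(SIGMA w:{w. perm d w}. supp (F w)). scal (F w l) (g w (delta l)))"
    unfolding eq sum.reindex[OF inj] using c len
    by (intro sum.cong) (auto simp: idx_def supp_def)
  also have "\<dots> = (\<Sum>w | perm d w. \<Sum>l\<in>supp (F w). scal (F w l) (g w (delta l)))"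
    using fin by (subst sum.Sigma) simp_all
  also have "\<dots> = (\<Sum>w | perm d w. g w (F w))"
    using MM_D(1)[OF F] by (intro sum.cong refl linear_on_expand[OF g, symmetric]) (simp_all add: Tn_eq_fs)
  finally show "(\<Sum>x\<in>{x \<in> idx d. c x \<noteq> 0}. scal (c x) ((\<lambda>(l, w). g w (delta l)) x)) = (\<Sum>w | perm d w. g w (F w))" .
qed

text \<open>Finitely supported coefficient functions on \<open>idx d\<close> are the same as
  elements of \<open>MM\<close>. The parameter \<open>g\<close> allows for both orders of the
  factors in the basis elements.\<close>

lemma basis_mod_iff:
  assumes g: "\<And>w. perm d w \<Longrightarrow> linear_on (len d) (g w)"
  shows "basis_mod (\<lambda>(l, w). g w (delta l)) (idx d) A J \<longleftrightarrow>
    (\<forall>F\<in>MM. (\<Sum>w | perm d w. g w (F w)) \<in> J \<longrightarrow> F = 0) \<and>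
    (\<forall>p\<in>A. \<exists>F\<in>MM. p - (\<Sum>w | perm d w. g w (F w)) \<in> J)"
    (is "?L \<longleftrightarrow> ?R1 \<and> ?R2")
proof -
  have ce: "finite {x \<in> idx d. c x \<noteq> 0}"
    "(\<Sum>x\<in>{x \<in> idx d. c x \<noteq> 0}. scal (c x) ((\<lambda>(l, w). g w (delta l)) x)) = (\<Sum>w | perm d w. g w (F w))"
    if "F \<in> MM" "\<And>l w. (l, w) \<in> idx d \<Longrightarrow> c (l, w) = F w l" for F c
    by (rule comb_eq(1)[of g F c], fact g, fact that(1), fact that(2))
      (rule comb_eq(2)[of g F c], fact g, fact that(1), fact that(2))
  \<comment> \<open>\<open>c\<close> is unconstrained outside \<open>idx d\<close>; replacing it by
    0 there puts the family into \<open>MM\<close>.\<close>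
  define mk where "mk c = (\<lambda>w l. if (l, w) \<in> idx d then c (l, w) else 0)" for c :: "'i list \<times> (nat \<Rightarrow> nat) \<Rightarrow> 'k"
  have mk: "mk c \<in> MM" if "finite {x \<in> idx d. c x \<noteq> 0}" for c
  proof -
    have "mk c w \<in> Tn d" for w
      unfolding Tn_eq_fs
    proof (rule fs_subI)
      show "finite (fst ` {x \<in> idx d. c x \<noteq> 0})" using that by simp
      show "supp (mk c w) \<subseteq> fst ` {x \<in> idx d. c x \<noteq> 0}"
        by (force simp: mk_def supp_def image_iff split: if_splits)
      show "fst ` {x \<in> idx d. c x \<noteq> 0} \<subseteq> len d" by (auto simp: idx_def)
    qed
    moreover have "mk c w = 0" if "\<not> perm d w" for w
      using that by (auto simp: mk_def idx_def fun_eq_iff)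
    ultimately show ?thesis by (simp add: MM_def)
  qed
  have mkc: "(l, w) \<in> idx d \<Longrightarrow> c (l, w) = mk c w l" for c l w by (simp add: mk_def)
  have mkce: "(\<Sum>x\<in>{x \<in> idx d. c x \<noteq> 0}. scal (c x) ((\<lambda>(l, w). g w (delta l)) x))
      = (\<Sum>w | perm d w. g w (mk c w))" if "finite {x \<in> idx d. c x \<noteq> 0}" for c
    by (rule ce(2)[OF mk[OF that]], rule mkc)
  define un where "un F = (\<lambda>(l, w). F w l)" for F :: "(nat \<Rightarrow> nat) \<Rightarrow> 'i list \<Rightarrow> 'k"
  have un: "un F (l, w) = F w l" for F l w by (simp add: un_def)
  have un0: "F = 0" if F: "F \<in> MM" and 0: "\<forall>x\<in>idx d. un F x = 0" for F
  proof (rule ext)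
    fix w
    show "F w = 0 w"
    proof (cases "perm d w")
      case True
      have "F w l = 0" for l
        using 0 True MM_D(1)[OF F, of w] by (cases "length l = d") (auto simp: un_def idx_def Tn_def)
      then show ?thesis by (simp add: fun_eq_iff)
    next
      case False then show ?thesis using MM_D(2)[OF F] by simp
    qed
  qed
  let ?f = "\<lambda>(l, w). g w (delta l)"
  show ?thesis
  proof
    assume L: ?L
    have ?R1
    proof (intro ballI impI)
      fix F assume F: "F \<in> MM" and J: "(\<Sum>w | perm d w. g w (F w)) \<in> J"
      have "(\<Sum>x\<in>{x \<in> idx d. un F x \<noteq> 0}. scal (un F x) (?f x)) \<in> J"
        unfolding ce(2)[OF F un] by (rule J)
      then have "\<forall>x\<in>idx d. un F x = 0"
        using conjunct1[OF L[unfolded basis_mod_def], rule_format, of "un F"] ce(1)[OF F un] by blast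
      then show "F = 0" by (rule un0[OF F])
    qed
    moreover have ?R2
    proof
      fix p assume "p \<in> A"
      then obtain c where c: "finite {x \<in> idx d. c x \<noteq> 0}"
        "p - (\<Sum>x\<in>{x \<in> idx d. c x \<noteq> 0}. scal (c x) (?f x)) \<in> J"
        using L unfolding basis_mod_def by blast
      show "\<exists>F\<in>MM. p - (\<Sum>w | perm d w. g w (F w)) \<in> J"
        using c(2) mk[OF c(1)] unfolding mkce[OF c(1)] by blast
    qed
    ultimately show "?R1 \<and> ?R2" ..
  next
    assume R: "?R1 \<and> ?R2"
    show ?L unfolding basis_mod_def
    proof (intro conjI allI impI ballI)
      fix c and x :: "'i list \<times> (nat \<Rightarrow> nat)"
      assume c: "finite {x \<in> idx d. c x \<noteq> 0} \<and> (\<Sum>x\<in>{x \<in> idx d. c x \<noteq> 0}. scal (c x) (?f x)) \<in> J"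
        and x: "x \<in> idx d"
      have m: "mk c \<in> MM" using c mk by blast
      have "(\<Sum>w | perm d w. g w (mk c w)) \<in> J" using c unfolding mkce[OF conjunct1[OF c]] by blast
      then have "mk c = 0" using R m by blast
      moreover obtain l w where "x = (l, w)" by (cases x)
      ultimately show "c x = 0" using mkc[of l w c] x by simp
    next
      fix p assume "p \<in> A"
      then obtain F where F: "F \<in> MM" "p - (\<Sum>w | perm d w. g w (F w)) \<in> J" using R by blast
      show "\<exists>c. finite {x \<in> idx d. c x \<noteq> 0} \<and> p - (\<Sum>x\<in>{x \<in> idx d. c x \<noteq> 0}. scal (c x) (?f x)) \<in> J"
      proof (intro exI conjI)
        show "finite {x \<in> idx d. un F x \<noteq> 0}" by (rule ce(1)[OF F(1) un])
        show "p - (\<Sum>x\<in>{x \<in> idx d. un F x \<noteq> 0}. scal (un F x) (?f x)) \<in> J"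
          unfolding ce(2)[OF F(1) un] by (rule F(2))
      qed
    qed
  qed
qed

text \<open>Spanning holds in any case by \<open>Phi_spans\<close>, so independence decides.\<close>

lemma basis_left_iff:
  "basis_mod (\<lambda>(l, w). fmul (emb (delta l)) (Hw d w)) (idx d) (FA d) J \<longleftrightarrow> Phi_inj"
proof -
  have lin: "linear_on (len d) (\<lambda>x. fmul (emb x) (Hw d w) :: 'i gen list \<Rightarrow> 'k)" for w
    by (simp add: linear_on_def emb_add emb_scal fmul_add_left fmul_scal_left)
  have "\<exists>F\<in>MM. p - Phi F \<in> J" if "p \<in> FA d" for p
    using Phi_spans[OF that] that unfolding cong_def by (intro bexI) auto
  then show ?thesis
    using basis_mod_iff[of "\<lambda>w x. fmul (emb x) (Hw d w)" "FA d", OF lin]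
    unfolding Phi_inj_def Phi_def by blast
qed

section \<open>Invertibility of the leading coefficients and the opposite normal form\<close>

lemma sigma_bij:
  assumes aut: "bij_betw sigma (Tn 2) (Tn 2)" and i: "pos i"
  shows "bij_betw (\<sigma> i) (Tn d) (Tn d)"
proof -
  define tau where "tau = inv_into (Tn 2) sigma"
  have ts: "tau (sigma x) = x" if "x \<in> Tn 2" for x
    using aut that by (simp add: tau_def bij_betw_def)
  have tau: "tau x \<in> Tn 2" "sigma (tau x) = x" if "x \<in> Tn 2" for x
    using aut that by (simp_all add: tau_def bij_betw_def inv_into_into f_inv_into_f)
  \<comment> \<open>The inverse of \<open>sigma\<close> is linear, so it has an extension of its
    own, which inverts that of \<open>sigma\<close> on pure tensors.\<close>
  have klt: "klin 2 tau"
    unfolding klin_def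
  proof (intro conjI ballI allI)
    fix x y :: "'i list \<Rightarrow> 'k" and c assume xy: "x \<in> Tn 2" "y \<in> Tn 2"
    have "sigma (tau x + tau y) = x + y" using klin(2) tau xy by (simp add: klin_def)
    then show "tau (x + y) = tau x + tau y" using ts[of "tau x + tau y"] tau xy by simp
  next
    fix x :: "'i list \<Rightarrow> 'k" and c assume x: "x \<in> Tn 2"
    have "sigma (scal c (tau x)) = scal c x" using klin(2) tau x by (simp add: klin_def)
    then show "tau (scal c x) = scal c (tau x)" using ts[of "scal c (tau x)"] tau x by simp
  qed (use tau in auto)
  obtain a b where ab: "i = Suc a" "d = a + (2 + b)" using i pos_split by blast
  have lin: "linear_on (len (a + (2 + b))) (\<lambda>x. tens_ext d i phi (tens_ext d i psi x))"
    if "klin 2 psi" for phi psi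
    using that i by (auto intro!: linear_on_tens_ext[where n' = d] linear_on_id simp: Tn_eq_fs[symmetric] ab(2)[symmetric])
  have inv: "tens_ext d i phi (tens_ext d i psi x) = x"
    if "klin 2 phi" "klin 2 psi" "\<And>x. x \<in> Tn 2 \<Longrightarrow> phi (psi x) = x" "x \<in> Tn d"
    for phi psi :: "('i list \<Rightarrow> 'k) \<Rightarrow> 'i list \<Rightarrow> 'k" and x
  proof (rule block_ext[OF lin[OF that(2)] linear_on_id])
    fix p c q :: "'i list \<Rightarrow> 'k" assume "p \<in> Tn a" "c \<in> Tn 2" "q \<in> Tn b"
    then show "tens_ext d i phi (tens_ext d i psi (tens a p (tens 2 c q))) = tens a p (tens 2 c q)"
      using that klin_closed[OF that(2)] by (simp add: ab tens_ext_mid)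
  qed (use that ab in simp)
  show ?thesis
    by (rule bij_betw_byWitness[where f' = "tens_ext d i tau"])
      (use i klt ts tau in \<open>auto intro!: inv\<close>)
qed

lemma foldr_bij:
  assumes "\<And>i. pos i \<Longrightarrow> bij_betw (\<sigma> i) (Tn d) (Tn d)"
  shows "valid d is \<Longrightarrow> bij_betw (foldr \<sigma> is) (Tn d) (Tn d)"
proof (induction "is")
  case Nil show "bij_betw (foldr \<sigma> []) (Tn d) (Tn d)" by (simp add: bij_betw_def)
next
  case (Cons i js)
  then have "bij_betw (\<sigma> i \<circ> foldr \<sigma> js) (Tn d) (Tn d)"
    using assms[of i] by (intro bij_betw_trans[of _ _ "Tn d"]) simp_all
  then show "bij_betw (foldr \<sigma> (i # js)) (Tn d) (Tn d)" by simp
qed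

lemma foldr_T_MM: "valid d is \<Longrightarrow> F \<in> MM \<Longrightarrow> foldr T is F \<in> MM"
  by (induction "is") simp_all

text \<open>The triangularity. An operator \<open>T i\<close> raises lengths by at most one, and at
  the maximal possible length only its term \<open>\<sigma> i\<close> arriving from below survives.
  What remains there is the single permutation \<open>sprod is\<close> with its leading
  coefficient.\<close>

lemma foldr_T_top:
  assumes x: "x \<in> Tn d"
  shows "reduced d is \<Longrightarrow> perm d v \<Longrightarrow> length is \<le> plen d v \<Longrightarrow>
    foldr T is (E id x) v = (if v = sprod is then foldr \<sigma> is x else 0)"
proof (induction "is" arbitrary: v)
  case Nil show "foldr T [] (E id x) v = (if v = sprod [] then foldr \<sigma> [] x else 0)" by (simp add: E_def)
next
  case (Cons i js)
  have i: "pos i" "reduced d js" "\<not> desc i (sprod js)" using Cons.prems by (auto simp: reduced_Cons)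
  define G where "G = foldr T js (E id x)"
  have IH: "G v = (if v = sprod js then foldr \<sigma> js x else 0)" if "perm d v" "length js \<le> plen d v" for v
    unfolding G_def by (rule Cons.IH[OF i(2) that])
  have pl: "length js = plen d (sprod js)" using i(2) by (simp add: reduced_def)
  have "v \<noteq> sprod js" using Cons.prems(3) pl by auto
  then have Gv: "G v = 0" using IH[OF Cons.prems(2)] Cons.prems(3) by simp
  have p: "perm d (sp i \<circ> v)" using i Cons.prems by simp
  have "T i G v = (if v = sp i \<circ> sprod js then \<sigma> i (foldr \<sigma> js x) else 0)"
  proof (cases "desc i v")
    case True
    then have "length js \<le> plen d (sp i \<circ> v)"
      using plen_down[OF Cons.prems(2) _ _ True] i Cons.prems(3) by simp
    then show ?thesis using IH[OF p] Gv True by (auto simp: T_def sp_comp_eq_iff)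
  next
    case False
    then have up: "plen d (sp i \<circ> v) = Suc (plen d v)" using plen_up[OF Cons.prems(2)] i by simp
    then have "sp i \<circ> v \<noteq> sprod js" using Cons.prems(3) pl by auto
    then show ?thesis using IH[OF p] up Cons.prems(3) Gv False by (auto simp: T_def sp_comp_eq_iff)
  qed
  then show "foldr T (i # js) (E id x) v = (if v = sprod (i # js) then foldr \<sigma> (i # js) x else 0)"
    by (simp add: G_def)
qed

lemma foldr_sigma_zero: "foldr \<sigma> is 0 = 0"
proof (induction "is")
  case (Cons i js)
  have "foldr \<sigma> js 0 = 0" by (rule Cons.IH)
  then show "foldr \<sigma> (i # js) 0 = 0" by simp
qed simp

lemma foldr_T_zero: "foldr T is 0 = 0"
proof (induction "is")
  case (Cons i js)
  have "foldr T js 0 = 0" by (rule Cons.IH)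
  then show "foldr T (i # js) 0 = 0" by simp
qed simp

text \<open>If \<open>F\<close> lists coefficients standing to the right of the
  \<open>Hw d w\<close>, then \<open>Theta F\<close> lists those of the same element standing to the
  left, as \<open>cong_Psi\<close> confirms.\<close>

definition Theta :: "((nat \<Rightarrow> nat) \<Rightarrow> 'i list \<Rightarrow> 'k) \<Rightarrow> (nat \<Rightarrow> nat) \<Rightarrow> 'i list \<Rightarrow> 'k" where
  "Theta F = (\<Sum>w | perm d w. foldr T (rexp d w) (E id (F w)))"

lemma valid_pos: "valid d is \<Longrightarrow> i \<in> set is \<Longrightarrow> pos i"
  by (induction "is") auto

lemma valid_rexp: "perm d w \<Longrightarrow> valid d (rexp d w)"
  using rexp(1)[of w d] by (simp add: reduced_def)

lemma length_rexp: "perm d w \<Longrightarrow> length (rexp d w) = plen d w"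
  using rexp[of w d] by (simp add: reduced_def)

lemma Theta_MM: "F \<in> MM \<Longrightarrow> Theta F \<in> MM"
  unfolding Theta_def by (auto intro!: MM_sum foldr_T_MM valid_rexp simp: MM_D(1))

lemma foldr_T_add:
  assumes "valid d is" "F \<in> MM" "G \<in> MM"
  shows "foldr T is (F + G) = foldr T is F + foldr T is G"
  using assms(1)
proof (induction "is")
  case Nil show "foldr T [] (F + G) = foldr T [] F + foldr T [] G" by (simp del: plus_fun_apply)
next
  case (Cons i js)
  have "foldr T js (F + G) = foldr T js F + foldr T js G"
    by (rule Cons.IH) (use Cons.prems in simp)
  then show "foldr T (i # js) (F + G) = foldr T (i # js) F + foldr T (i # js) G"
    using Cons.prems assms by (simp add: foldr_T_MM)
qed

lemma Theta_add: "F \<in> MM \<Longrightarrow> G \<in> MM \<Longrightarrow> Theta (F + G) = Theta F + Theta G"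
  unfolding Theta_def sum.distrib[symmetric]
  by (intro sum.cong refl) (simp add: E_add foldr_T_add valid_rexp MM_D(1))

lemma Theta_top:
  assumes F: "F \<in> MM" and w: "perm d w" and top: "\<And>v. plen d w < plen d v \<Longrightarrow> F v = 0"
  shows "Theta F w = foldr \<sigma> (rexp d w) (F w)"
proof -
  have "Theta F w = (\<Sum>v | perm d v. foldr T (rexp d v) (E id (F v)) w)"
    by (simp add: Theta_def sum_apply)
  also have "\<dots> = (\<Sum>v | perm d v. if v = w then foldr \<sigma> (rexp d w) (F w) else 0)"
  proof (rule sum.cong)
    fix v assume "v \<in> {v. perm d v}"
    then have v: "perm d v" by simp
    show "foldr T (rexp d v) (E id (F v)) w = (if v = w then foldr \<sigma> (rexp d w) (F w) else 0)"
    proof (cases "plen d v \<le> plen d w")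
      case True
      then show ?thesis
        using foldr_T_top[OF MM_D(1)[OF F] rexp(1)[OF v] w] length_rexp[OF v] rexp(2)[OF v] by auto
    next
      case False
      then show ?thesis using top[of v] by (auto simp: foldr_T_zero)
    qed
  qed simp
  also have "\<dots> = foldr \<sigma> (rexp d w) (F w)" using w by (simp add: sum.delta)
  finally show ?thesis .
qed

text \<open>At a longest permutation in the support of \<open>F\<close> only its own term
  contributes, and it does so through a bijection.\<close>

lemma Theta_inj:
  assumes bij: "\<And>i. pos i \<Longrightarrow> bij_betw (\<sigma> i) (Tn d) (Tn d)"
    and F: "F \<in> MM" and 0: "Theta F = 0"
  shows "F = 0"
proof (rule ccontr)
  assume nz: "F \<noteq> 0"
  let ?X = "{w. perm d w \<and> F w \<noteq> 0}"
  obtain w0 where "F w0 \<noteq> 0" using nz by (auto simp: fun_eq_iff)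
  then have "?X \<noteq> {}" using MM_D(2)[OF F, of w0] by auto
  moreover have fin: "finite ?X" by (rule finite_subset[OF _ finite_perm]) auto
  ultimately have "Max (plen d ` ?X) \<in> plen d ` ?X" by (intro Max_in) auto
  then obtain w where w: "perm d w" "F w \<noteq> 0" "plen d w = Max (plen d ` ?X)" by auto
  have top: "F v = 0" if "plen d w < plen d v" for v
  proof (rule ccontr)
    assume "F v \<noteq> 0"
    then have "v \<in> ?X" using MM_D(2)[OF F, of v] by auto
    then have "plen d v \<le> Max (plen d ` ?X)" using fin by (intro Max_ge) auto
    then show False using that w(3) by simp
  qed
  have "foldr \<sigma> (rexp d w) (F w) = foldr \<sigma> (rexp d w) 0"
    using Theta_top[OF F w(1) top] 0 by (simp add: foldr_sigma_zero)
  then have "F w = 0"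
    using foldr_bij[OF bij valid_rexp[OF w(1)]] MM_D(1)[OF F] Tn_zero
    unfolding bij_betw_def by (meson inj_onD)
  with w(2) show False ..
qed

text \<open>Induction on a strict bound \<open>n\<close> for the lengths in the support of
  \<open>G\<close>. The top layer is solved exactly by inverting the leading coefficients, and the
  error lies in shorter permutations.\<close>

lemma Theta_surj:
  assumes bij: "\<And>i. pos i \<Longrightarrow> bij_betw (\<sigma> i) (Tn d) (Tn d)"
  shows "G \<in> MM \<Longrightarrow> (\<And>w. n \<le> plen d w \<Longrightarrow> G w = 0) \<Longrightarrow> \<exists>F\<in>MM. Theta F = G"
proof (induction n arbitrary: G)
  case 0
  have "G w = 0" for w using 0(2)[of w] by (simp add: zero_fun_def)
  then have "G = 0" by (simp add: fun_eq_iff)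
  moreover have "Theta 0 = 0" using Theta_add[OF MM_zero MM_zero] by simp
  ultimately show "\<exists>F\<in>MM. Theta F = G" using MM_zero by metis
next
  case (Suc n)
  define h where "h w = inv_into (Tn d) (foldr \<sigma> (rexp d w)) (G w)" for w
  have h: "h w \<in> Tn d" "foldr \<sigma> (rexp d w) (h w) = G w" if "perm d w" for w
    using foldr_bij[OF bij valid_rexp[OF that]] MM_D(1)[OF Suc.prems(1), of w]
    by (auto simp: h_def bij_betw_def inv_into_into f_inv_into_f)
  define F0 where "F0 w = (if perm d w \<and> plen d w = n then h w else 0)" for w
  have F0: "F0 \<in> MM" using h(1) by (simp add: MM_def F0_def)
  define G' where "G' = G - Theta F0"
  have "G' w = 0" if n: "n \<le> plen d w" for w
  proof (cases "perm d w")
    case True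
    then have "Theta F0 w = foldr \<sigma> (rexp d w) (F0 w)"
      using n by (intro Theta_top[OF F0]) (auto simp: F0_def)
    also have "\<dots> = G w"
      using h(2)[OF True] True Suc.prems(2)[of w] n by (auto simp: F0_def foldr_sigma_zero)
    finally show ?thesis by (simp add: G'_def)
  next
    case False
    then show ?thesis using MM_D(2)[OF Suc.prems(1) False] MM_D(2)[OF Theta_MM[OF F0] False] by (simp add: G'_def)
  qed
  moreover have "G' \<in> MM" using Suc.prems(1) Theta_MM[OF F0] by (simp add: G'_def)
  ultimately obtain F1 where F1: "F1 \<in> MM" "Theta F1 = G'" using Suc.IH[of G'] by blast
  have "Theta (F0 + F1) = G" using F0 F1 by (simp add: Theta_add G'_def)
  then show "\<exists>F\<in>MM. Theta F = G" using F0 F1(1) by (intro bexI[of _ "F0 + F1"]) simp_all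
qed

definition Psi :: "((nat \<Rightarrow> nat) \<Rightarrow> 'i list \<Rightarrow> 'k) \<Rightarrow> 'i gen list \<Rightarrow> 'k" where
  "Psi F = (\<Sum>w | perm d w. fmul (Hw d w) (emb (F w)))"

lemma cong_Psi:
  assumes F: "F \<in> MM" shows "cong (Psi F) (Phi (Theta F))"
  unfolding Psi_def Theta_def Phi_sum
proof (rule cong_sum)
  fix w assume "w \<in> {w. perm d w}"
  then have w: "perm d w" by simp
  have "\<forall>g\<in>set (map GH (rexp d w)). validg d g" using valid_pos[OF valid_rexp[OF w]] by auto
  then have "cong (fmul (Hw d w) (Phi (E id (F w)))) (Phi (foldr T (rexp d w) (E id (F w))))"
    unfolding Hw_def actw_GH[symmetric] by (rule cong_actw) (simp add: MM_D(1)[OF F])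
  then show "cong (fmul (Hw d w) (emb (F w))) (Phi (foldr T (rexp d w) (E id (F w))))"
    by (simp add: Phi_E Hw_id)
qed

text \<open>\<open>Psi F\<close> is congruent to \<open>Phi (Theta F)\<close>, and
  \<open>Theta\<close> is a bijection of \<open>MM\<close>.\<close>

lemma basis_right_iff:
  assumes bij: "\<And>i. pos i \<Longrightarrow> bij_betw (\<sigma> i) (Tn d) (Tn d)"
  shows "basis_mod (\<lambda>(l, w). fmul (Hw d w) (emb (delta l))) (idx d) (FA d) J \<longleftrightarrow> Phi_inj"
proof -
  have lin: "linear_on (len d) (\<lambda>x. fmul (Hw d w) (emb x) :: 'i gen list \<Rightarrow> 'k)" for w
    by (simp add: linear_on_def emb_add emb_scal fmul_add_right fmul_scal_right)
  have surj: "\<exists>F\<in>MM. Theta F = G" if G: "G \<in> MM" for G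
  proof (rule Theta_surj[OF bij G])
    \<comment> \<open>The bound is one above the maximal length, so no permutation reaches
      it.\<close>
    fix w assume n: "Suc (Max (plen d ` {w. perm d w})) \<le> plen d w"
    have "\<not> perm d w"
    proof
      assume "perm d w"
      then have "plen d w \<le> Max (plen d ` {w. perm d w})" by (intro Max_ge) auto
      with n show False by simp
    qed
    then show "G w = 0" using MM_D(2)[OF G] by simp
  qed
  have PsiJ: "Psi F \<in> J \<longleftrightarrow> Phi (Theta F) \<in> J" if F: "F \<in> MM" for F
    using cong_Psi[OF F] J_diff[of "Psi F" "Psi F - Phi (Theta F)"]
      wideal.add[of "Psi F - Phi (Theta F)" d _ "Phi (Theta F)"] by (auto simp: cong_def)
  have span: "\<exists>F\<in>MM. p - Psi F \<in> J" if p: "p \<in> FA d" for p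
  proof -
    have "actp p (E id one) \<in> MM" using p by simp
    then obtain F where F: "F \<in> MM" "Theta F = actp p (E id one)" using surj by blast
    have "cong (Psi F) (Phi (actp p (E id one)))" using cong_Psi[OF F(1)] F(2) by simp
    then have "cong p (Psi F)" using cong_trans[OF Phi_spans[OF p]] cong_sym by blast
    then show ?thesis using F(1) by (auto simp: cong_def)
  qed
  have "(\<forall>F\<in>MM. Psi F \<in> J \<longrightarrow> F = 0) \<longleftrightarrow> Phi_inj"
  proof
    assume L: "\<forall>F\<in>MM. Psi F \<in> J \<longrightarrow> F = 0"
    show Phi_inj unfolding Phi_inj_def
    proof (intro ballI impI)
      fix G assume G: "G \<in> MM" "Phi G \<in> J"
      obtain F where F: "F \<in> MM" "Theta F = G" using surj[OF G(1)] by blast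
      then have "F = 0" using L PsiJ G(2) by simp
      then show "G = 0" using Theta_add[OF MM_zero MM_zero] F(2) by simp
    qed
  next
    assume inj: Phi_inj
    show "\<forall>F\<in>MM. Psi F \<in> J \<longrightarrow> F = 0"
      using inj PsiJ Theta_MM Theta_inj[OF bij] unfolding Phi_inj_def by blast
  qed
  then show ?thesis
    using basis_mod_iff[of "\<lambda>w x. fmul (Hw d w) (emb x)" "FA d", OF lin] span
    unfolding Psi_def by blast
qed

end

theorem theorem3p6:
  fixes m :: "'i \<Rightarrow> 'i \<Rightarrow> 'i \<Rightarrow> 'k::comm_ring_1"
    and u :: "'i \<Rightarrow> 'k"
    and d :: nat
    and R S :: "'i list \<Rightarrow> 'k"
    and rho sigma :: "('i list \<Rightarrow> 'k) \<Rightarrow> ('i list \<Rightarrow> 'k)"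
  assumes B: "basis_algebra m u"
    and d: "2 \<le> d"
    and RS: "R \<in> Tn 2" "S \<in> Tn 2"
    and lin: "klin 2 rho" "klin 2 sigma"
    and aut: "bij_betw sigma (Tn 2) (Tn 2)"
  shows "((cond_C1_C4 m u R S rho sigma \<and> (3 \<le> d \<longrightarrow> cond_C5_C9 m u R S rho sigma))
            \<longleftrightarrow> basis_mod (\<lambda>(l, w). fmul (emb (delta l)) (Hw d w)) (idx d) (FA d)
                   (wideal d (wrels m u d R S rho sigma)))
       \<and> ((cond_C1_C4 m u R S rho sigma \<and> (3 \<le> d \<longrightarrow> cond_C5_C9 m u R S rho sigma))
            \<longleftrightarrow> basis_mod (\<lambda>(l, w). fmul (Hw d w) (emb (delta l))) (idx d) (FA d)
                   (wideal d (wrels m u d R S rho sigma)))"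
proof -
  interpret qwd m u R S rho sigma d
    by unfold_locales (use assms in auto)
  have "cond_C1_C4 m u R S rho sigma \<and> (3 \<le> d \<longrightarrow> cond_C5_C9 m u R S rho sigma) \<longleftrightarrow> Phi_inj"
    using conds_of_Phi_inj Phi_inj_of_conds by blast
  then show ?thesis
    using basis_left_iff basis_right_iff[OF sigma_bij[OF aut]] by simp
qed

end
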